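(* Let $H$ be a cocommutative weak Hopf algebra in $\mathcal{C}$, $(A,\varphi_A)$ a weak left $H$-module algebra and $\sigma\in Reg_{\varphi_A}(H^2,A)$. Let $(A,H,\psi_H^A,\sigma_H^A)$ be the associated quadruple and assume that it satisfies the twisted and the cocycle conditions. Then $\nu=\nabla_{A\otimes H}\circ(\eta_A\otimes\eta_H)$ is a preunit for the weak crossed product $(A\otimes H,\mu_{A\otimes H})$ associated to this quadruple if and only if $\sigma$ satisfies the normal condition $$\sigma\circ(\eta_H\otimes H)=\sigma\circ(H\otimes\eta_H)=u_1 .$$
   Context: Throughout, $\mathcal{C}$ is a strict symmetric monoidal category with tensor product $\otimes$, unit object $K$, symmetry $c$, and equalizers. For an object $P$ and a morphism $f$, $P\otimes f$ means $id_P\otimes f$ (likewise $f\otimes P$). Algebras $(A,\eta_A,\mu_A)$ are unital associative, coalgebras $(D,\varepsilon_D,\delta_D)$ counital coassociative, all in $\mathcal{C}$; $D$ is cocommutative if $c_{D,D}\circ\delta_D=\delta_D$. For coalgebras $D,E$: $\varepsilon_{D\otimes E}=\varepsilon_D\otimes\varepsilon_E$, $\delta_{D\otimes E}=(D\otimes c_{D,E}\otimes E)\circ(\delta_D\otimes\delta_E)$; $H^2=H\otimes H$ with this coalgebra structure. For morphisms $f,g:B\to A$ from a coalgebra to an algebra, $f\wedge g=\mu_A\circ(f\otimes g)\circ\delta_B$. A weak Hopf algebra $H$ is an algebra and coalgebra in $\mathcal{C}$ with: (a1) $\delta_H\circ\mu_H=(\mu_H\otimes\mu_H)\circ\delta_{H\otimes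 H}$; (a2) $\varepsilon_H\circ\mu_H\circ(\mu_H\otimes H)=(\varepsilon_H\otimes\varepsilon_H)\circ(\mu_H\otimes\mu_H)\circ(H\otimes\delta_H\otimes H)=(\varepsilon_H\otimes\varepsilon_H)\circ(\mu_H\otimes\mu_H)\circ(H\otimes(c_{H,H}\circ\delta_H)\otimes H)$; (a3) $(\delta_H\otimes H)\circ\delta_H\circ\eta_H=(H\otimes\mu_H\otimes H)\circ(\delta_H\otimes\delta_H)\circ(\eta_H\otimes\eta_H)=(H\otimes(\mu_H\circ c_{H,H})\otimes H)\circ(\delta_H\otimes\delta_H)\circ(\eta_H\otimes\eta_H)$; (a4) there is an antipode $\lambda_H:H\to H$ with $id_H\wedge\lambda_H=\Pi_H^L$, $\lambda_H\wedge id_H=\Pi_H^R$, $\lambda_H\wedge id_H\wedge\lambda_H=\lambda_H$, where $\Pi_H^L=((\varepsilon_H\circ\mu_H)\otimes H)\circ(H\otimes c_{H,H})\circ((\delta_H\circ\eta_H)\otimes H)$ and $\Pi_H^R=(H\otimes(\varepsilon_H\circ\mu_H))\circ(c_{H,H}\otimes H)\circ(H\otimes(\delta_H\circ\eta_H))$. A weak left $H$-module algebra is an algebra $A$ with $\varphi_A:H\otimes A\to A$ such that (b1) $\varphi_A\circ(\eta_H\otimes A)=id_A$; (b2) $\varphi_A\circ(H\otimes\mu_A)=\mu_A\circ(\varphi_A\otimes\varphi_A)\circ(H\otimes c_{H,A}\otimes A)\circ(\delta_H\otimes A\otimes A)$; (b3) $\varphi_A\circ(\mu_H\otimes\eta_A)=\varphi_A\circ(H\otimes(\varphi_A\circ(H\otimes\eta_A)))$;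 (b6) $\varphi_A\circ(\Pi_H^L\otimes\eta_A)=\varphi_A\circ(H\otimes\eta_A)$ (equivalently (b4) $\varphi_A\circ(\Pi_H^L\otimes A)=\mu_A\circ((\varphi_A\circ(H\otimes\eta_A))\otimes A)$). $u_1=\varphi_A\circ(H\otimes\eta_A)$, $u_2=\varphi_A\circ(\mu_H\otimes\eta_A)$. $Reg_{\varphi_A}(H^2,A)$ is the set of $\sigma:H^2\to A$ for which there is $\sigma^{-1}:H^2\to A$ with $\sigma\wedge\sigma^{-1}=\sigma^{-1}\wedge\sigma=u_2$, $\sigma\wedge\sigma^{-1}\wedge\sigma=\sigma$, $\sigma^{-1}\wedge\sigma\wedge\sigma^{-1}=\sigma^{-1}$. The quadruple associated to $\sigma$ is given by $\psi_H^A=(\varphi_A\otimes H)\circ(H\otimes c_{H,A})\circ(\delta_H\otimes A)$ and $\sigma_H^A=(\sigma\otimes\mu_H)\circ\delta_{H^2}$; also $\nabla_{A\otimes H}=(\mu_A\otimes H)\circ(A\otimes\psi_H^A)\circ(A\otimes H\otimes\eta_A)$, an idempotent. Twisted condition: $(\mu_A\otimes H)\circ(A\otimes\psi_H^A)\circ(\sigma_H^A\otimes A)=(\mu_A\otimes H)\circ(A\otimes\sigma_H^A)\circ(\psi_H^A\otimes H)\circ(H\otimes\psi_H^A)$. Cocycle condition: $(\mu_A\otimes H)\circ(A\otimes\sigma_H^A)\circ(\sigma_H^A\otimes H)=(\mu_A\otimes H)\circ(A\otimes\sigma_H^A)\circ(\psi_H^A\otimes H)\circ(H\otimes\sigma_H^A)$.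 Under both, $(A\otimes H,\mu_{A\otimes H})$ with $\mu_{A\otimes H}=(\mu_A\otimes H)\circ(\mu_A\otimes\sigma_H^A)\circ(A\otimes\psi_H^A\otimes H)$ is called a weak crossed product (the product is associative). A preunit for an associative product $m$ on $A\otimes H$ is a morphism $\nu:K\to A\otimes H$ with $m\circ(A\otimes H\otimes\nu)=m\circ(\nu\otimes A\otimes H)=m\circ(A\otimes H\otimes(m\circ(\nu\otimes\nu)))$. *)

theory Defs
  imports Main
begin

section \<open>Strict symmetric monoidal categories\<close>

text \<open>
  Objects and arrows live in carrier sets. Composition, identities, the tensor products and the
  symmetry are total functions in HOL, constrained only on the carriers; \<open>g \<cdot> f\<close> means
  ``first \<open>f\<close>, then \<open>g\<close>''. As \<open>Dom\<close> and \<open>Cod\<close> are functions on arrows, hom-sets are disjoint.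
\<close>

record ('o, 'm) smcat =
  Obj  :: "'o set"
  Arr  :: "'m set"
  Dom  :: "'m \<Rightarrow> 'o"
  Cod  :: "'m \<Rightarrow> 'o"
  Id   :: "'o \<Rightarrow> 'm"                 ("\<I>\<index>")
  Comp :: "'m \<Rightarrow> 'm \<Rightarrow> 'm"           (infixr "\<cdot>\<index>" 65)
  Unit :: "'o"                       ("\<K>\<index>")
  TenO :: "'o \<Rightarrow> 'o \<Rightarrow> 'o"           (infixr "\<odot>\<index>" 75)
  Ten  :: "'m \<Rightarrow> 'm \<Rightarrow> 'm"           (infixr "\<otimes>\<index>" 70)
  Sym  :: "'o \<Rightarrow> 'o \<Rightarrow> 'm"           ("\<c>\<index>")

definition Hom :: "('o, 'm) smcat \<Rightarrow> 'o \<Rightarrow> 'o \<Rightarrow> 'm set" where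
  "Hom C a b = {f \<in> Arr C. Dom C f = a \<and> Cod C f = b}"

locale strict_symmetric_monoidal_category =
  fixes C :: "('o, 'm) smcat" (structure)
  assumes Dom_Obj: "f \<in> Arr C \<Longrightarrow> Dom C f \<in> Obj C"
    and Cod_Obj: "f \<in> Arr C \<Longrightarrow> Cod C f \<in> Obj C"
    and Id_Hom: "a \<in> Obj C \<Longrightarrow> \<I> a \<in> Hom C a a"
    and Comp_Hom: "f \<in> Hom C a b \<Longrightarrow> g \<in> Hom C b d \<Longrightarrow> g \<cdot> f \<in> Hom C a d"
    and Comp_Id_left: "f \<in> Hom C a b \<Longrightarrow> \<I> b \<cdot> f = f"
    and Comp_Id_right: "f \<in> Hom C a b \<Longrightarrow> f \<cdot> \<I> a = f"
    and Comp_assoc: "f \<in> Hom C a b \<Longrightarrow> g \<in> Hom C b d \<Longrightarrow> h \<in> Hom C d e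
          \<Longrightarrow> (h \<cdot> g) \<cdot> f = h \<cdot> (g \<cdot> f)"
    and Unit_Obj: "\<K> \<in> Obj C"
    and TenO_Obj: "a \<in> Obj C \<Longrightarrow> b \<in> Obj C \<Longrightarrow> a \<odot> b \<in> Obj C"
    and TenO_assoc: "a \<in> Obj C \<Longrightarrow> b \<in> Obj C \<Longrightarrow> d \<in> Obj C
          \<Longrightarrow> (a \<odot> b) \<odot> d = a \<odot> (b \<odot> d)"
    and TenO_Unit_left: "a \<in> Obj C \<Longrightarrow> \<K> \<odot> a = a"
    and TenO_Unit_right: "a \<in> Obj C \<Longrightarrow> a \<odot> \<K> = a"
    and Ten_Hom: "f \<in> Hom C a b \<Longrightarrow> g \<in> Hom C a' b' \<Longrightarrow> f \<otimes> g \<in> Hom C (a \<odot> a') (b \<odot> b')"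
    and Ten_Id: "a \<in> Obj C \<Longrightarrow> b \<in> Obj C \<Longrightarrow> \<I> a \<otimes> \<I> b = \<I> (a \<odot> b)"
    and Ten_Comp: "f \<in> Hom C a b \<Longrightarrow> g \<in> Hom C b d \<Longrightarrow> f' \<in> Hom C a' b' \<Longrightarrow> g' \<in> Hom C b' d'
          \<Longrightarrow> (g \<cdot> f) \<otimes> (g' \<cdot> f') = (g \<otimes> g') \<cdot> (f \<otimes> f')"
    and Ten_assoc: "f \<in> Arr C \<Longrightarrow> g \<in> Arr C \<Longrightarrow> h \<in> Arr C \<Longrightarrow> (f \<otimes> g) \<otimes> h = f \<otimes> (g \<otimes> h)"
    and Ten_Unit_left: "f \<in> Arr C \<Longrightarrow> \<I> \<K> \<otimes> f = f"
    and Ten_Unit_right: "f \<in> Arr C \<Longrightarrow> f \<otimes> \<I> \<K> = f"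
    and Sym_Hom: "a \<in> Obj C \<Longrightarrow> b \<in> Obj C \<Longrightarrow> \<c> a b \<in> Hom C (a \<odot> b) (b \<odot> a)"
    and Sym_natural: "f \<in> Hom C a b \<Longrightarrow> g \<in> Hom C a' b'
          \<Longrightarrow> \<c> b b' \<cdot> (f \<otimes> g) = (g \<otimes> f) \<cdot> \<c> a a'"
    and Sym_Sym: "a \<in> Obj C \<Longrightarrow> b \<in> Obj C \<Longrightarrow> \<c> b a \<cdot> \<c> a b = \<I> (a \<odot> b)"
    and Sym_hexagon: "a \<in> Obj C \<Longrightarrow> b \<in> Obj C \<Longrightarrow> d \<in> Obj C
          \<Longrightarrow> \<c> a (b \<odot> d) = (\<I> b \<otimes> \<c> a d) \<cdot> (\<c> a b \<otimes> \<I> d)"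

definition is_equalizer :: "('o, 'm) smcat \<Rightarrow> 'm \<Rightarrow> 'm \<Rightarrow> 'm \<Rightarrow> bool" where
  "is_equalizer C e f g \<longleftrightarrow>
     e \<in> Arr C \<and> Cod C e = Dom C f \<and> f \<cdot> e = g \<cdot> e \<and>
     (\<forall>h\<in>Arr C. Cod C h = Dom C f \<and> f \<cdot> h = g \<cdot> h \<longrightarrow>
        (\<exists>!k. k \<in> Hom C (Dom C h) (Dom C e) \<and> e \<cdot> k = h))"
  for C (structure)

definition has_equalizers :: "('o, 'm) smcat \<Rightarrow> bool" where
  "has_equalizers C \<longleftrightarrow>
     (\<forall>f\<in>Arr C. \<forall>g\<in>Arr C. Dom C f = Dom C g \<and> Cod C f = Cod C g \<longrightarrow>
        (\<exists>e. is_equalizer C e f g))"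


section \<open>Algebras, coalgebras and convolution\<close>

definition algebra_in :: "('o, 'm) smcat \<Rightarrow> 'o \<Rightarrow> 'm \<Rightarrow> 'm \<Rightarrow> bool" where
  "algebra_in C A \<eta> \<mu> \<longleftrightarrow>
     A \<in> Obj C \<and> \<eta> \<in> Hom C \<K> A \<and> \<mu> \<in> Hom C (A \<odot> A) A \<and>
     \<mu> \<cdot> (\<I> A \<otimes> \<eta>) = \<I> A \<and> \<mu> \<cdot> (\<eta> \<otimes> \<I> A) = \<I> A \<and>
     \<mu> \<cdot> (\<I> A \<otimes> \<mu>) = \<mu> \<cdot> (\<mu> \<otimes> \<I> A)"
  for C (structure)

definition coalgebra_in :: "('o, 'm) smcat \<Rightarrow> 'o \<Rightarrow> 'm \<Rightarrow> 'm \<Rightarrow> bool" where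
  "coalgebra_in C D \<epsilon> \<delta> \<longleftrightarrow>
     D \<in> Obj C \<and> \<epsilon> \<in> Hom C D \<K> \<and> \<delta> \<in> Hom C D (D \<odot> D) \<and>
     (\<epsilon> \<otimes> \<I> D) \<cdot> \<delta> = \<I> D \<and> (\<I> D \<otimes> \<epsilon>) \<cdot> \<delta> = \<I> D \<and>
     (\<delta> \<otimes> \<I> D) \<cdot> \<delta> = (\<I> D \<otimes> \<delta>) \<cdot> \<delta>"
  for C (structure)

definition cocommutative :: "('o, 'm) smcat \<Rightarrow> 'o \<Rightarrow> 'm \<Rightarrow> bool" where
  "cocommutative C D \<delta> \<longleftrightarrow> \<c> D D \<cdot> \<delta> = \<delta>"
  for C (structure)

definition tensor_comult :: "('o, 'm) smcat \<Rightarrow> 'o \<Rightarrow> 'm \<Rightarrow> 'o \<Rightarrow> 'm \<Rightarrow> 'm" where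
  "tensor_comult C D \<delta>\<^sub>D E \<delta>\<^sub>E = (\<I> D \<otimes> \<c> D E \<otimes> \<I> E) \<cdot> (\<delta>\<^sub>D \<otimes> \<delta>\<^sub>E)"
  for C (structure)

text \<open>\<open>convolution C \<delta> \<mu> f g\<close> is \<open>f \<and> g\<close> for arrows from a coalgebra with coproduct \<open>\<delta>\<close> to an
  algebra with product \<open>\<mu>\<close>.\<close>

definition convolution :: "('o, 'm) smcat \<Rightarrow> 'm \<Rightarrow> 'm \<Rightarrow> 'm \<Rightarrow> 'm \<Rightarrow> 'm" where
  "convolution C \<delta> \<mu> f g = \<mu> \<cdot> (f \<otimes> g) \<cdot> \<delta>"
  for C (structure)


section \<open>Weak Hopf algebras\<close>

definition Pi_L :: "('o, 'm) smcat \<Rightarrow> 'o \<Rightarrow> 'm \<Rightarrow> 'm \<Rightarrow> 'm \<Rightarrow> 'm \<Rightarrow> 'm" where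
  "Pi_L C H \<eta> \<mu> \<epsilon> \<delta> = ((\<epsilon> \<cdot> \<mu>) \<otimes> \<I> H) \<cdot> (\<I> H \<otimes> \<c> H H) \<cdot> ((\<delta> \<cdot> \<eta>) \<otimes> \<I> H)"
  for C (structure)

definition Pi_R :: "('o, 'm) smcat \<Rightarrow> 'o \<Rightarrow> 'm \<Rightarrow> 'm \<Rightarrow> 'm \<Rightarrow> 'm \<Rightarrow> 'm" where
  "Pi_R C H \<eta> \<mu> \<epsilon> \<delta> = (\<I> H \<otimes> (\<epsilon> \<cdot> \<mu>)) \<cdot> (\<c> H H \<otimes> \<I> H) \<cdot> (\<I> H \<otimes> (\<delta> \<cdot> \<eta>))"
  for C (structure)

definition is_antipode ::
    "('o, 'm) smcat \<Rightarrow> 'o \<Rightarrow> 'm \<Rightarrow> 'm \<Rightarrow> 'm \<Rightarrow> 'm \<Rightarrow> 'm \<Rightarrow> bool" where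
  "is_antipode C H \<eta> \<mu> \<epsilon> \<delta> S \<longleftrightarrow>
     S \<in> Hom C H H \<and>
     convolution C \<delta> \<mu> (\<I> H) S = Pi_L C H \<eta> \<mu> \<epsilon> \<delta> \<and>
     convolution C \<delta> \<mu> S (\<I> H) = Pi_R C H \<eta> \<mu> \<epsilon> \<delta> \<and>
     convolution C \<delta> \<mu> (convolution C \<delta> \<mu> S (\<I> H)) S = S"
  for C (structure)

definition weak_Hopf_algebra ::
    "('o, 'm) smcat \<Rightarrow> 'o \<Rightarrow> 'm \<Rightarrow> 'm \<Rightarrow> 'm \<Rightarrow> 'm \<Rightarrow> bool" where
  "weak_Hopf_algebra C H \<eta> \<mu> \<epsilon> \<delta> \<longleftrightarrow>
     algebra_in C H \<eta> \<mu> \<and> coalgebra_in C H \<epsilon> \<delta> \<and>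
     \<delta> \<cdot> \<mu> = (\<mu> \<otimes> \<mu>) \<cdot> tensor_comult C H \<delta> H \<delta> \<and>
     \<epsilon> \<cdot> \<mu> \<cdot> (\<mu> \<otimes> \<I> H) = (\<epsilon> \<otimes> \<epsilon>) \<cdot> (\<mu> \<otimes> \<mu>) \<cdot> (\<I> H \<otimes> \<delta> \<otimes> \<I> H) \<and>
     \<epsilon> \<cdot> \<mu> \<cdot> (\<mu> \<otimes> \<I> H) = (\<epsilon> \<otimes> \<epsilon>) \<cdot> (\<mu> \<otimes> \<mu>) \<cdot> (\<I> H \<otimes> (\<c> H H \<cdot> \<delta>) \<otimes> \<I> H) \<and>
     (\<delta> \<otimes> \<I> H) \<cdot> \<delta> \<cdot> \<eta> = (\<I> H \<otimes> \<mu> \<otimes> \<I> H) \<cdot> (\<delta> \<otimes> \<delta>) \<cdot> (\<eta> \<otimes> \<eta>) \<and>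
     (\<delta> \<otimes> \<I> H) \<cdot> \<delta> \<cdot> \<eta> = (\<I> H \<otimes> (\<mu> \<cdot> \<c> H H) \<otimes> \<I> H) \<cdot> (\<delta> \<otimes> \<delta>) \<cdot> (\<eta> \<otimes> \<eta>) \<and>
     (\<exists>S. is_antipode C H \<eta> \<mu> \<epsilon> \<delta> S)"
  for C (structure)


section \<open>Weak module algebras and regular morphisms\<close>

definition weak_left_module_algebra ::
    "('o, 'm) smcat \<Rightarrow> 'o \<Rightarrow> 'm \<Rightarrow> 'm \<Rightarrow> 'm \<Rightarrow> 'm \<Rightarrow> 'o \<Rightarrow> 'm \<Rightarrow> 'm \<Rightarrow> 'm \<Rightarrow> bool" where
  "weak_left_module_algebra C H \<eta>\<^sub>H \<mu>\<^sub>H \<epsilon>\<^sub>H \<delta>\<^sub>H A \<eta>\<^sub>A \<mu>\<^sub>A \<phi> \<longleftrightarrow>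
     algebra_in C A \<eta>\<^sub>A \<mu>\<^sub>A \<and> \<phi> \<in> Hom C (H \<odot> A) A \<and>
     \<phi> \<cdot> (\<eta>\<^sub>H \<otimes> \<I> A) = \<I> A \<and>
     \<phi> \<cdot> (\<I> H \<otimes> \<mu>\<^sub>A)
       = \<mu>\<^sub>A \<cdot> (\<phi> \<otimes> \<phi>) \<cdot> (\<I> H \<otimes> \<c> H A \<otimes> \<I> A) \<cdot> (\<delta>\<^sub>H \<otimes> \<I> A \<otimes> \<I> A) \<and>
     \<phi> \<cdot> (\<mu>\<^sub>H \<otimes> \<eta>\<^sub>A) = \<phi> \<cdot> (\<I> H \<otimes> (\<phi> \<cdot> (\<I> H \<otimes> \<eta>\<^sub>A))) \<and>
     \<phi> \<cdot> (Pi_L C H \<eta>\<^sub>H \<mu>\<^sub>H \<epsilon>\<^sub>H \<delta>\<^sub>H \<otimes> \<eta>\<^sub>A) = \<phi> \<cdot> (\<I> H \<otimes> \<eta>\<^sub>A)"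
  for C (structure)

definition u1 :: "('o, 'm) smcat \<Rightarrow> 'o \<Rightarrow> 'm \<Rightarrow> 'm \<Rightarrow> 'm" where
  "u1 C H \<eta>\<^sub>A \<phi> = \<phi> \<cdot> (\<I> H \<otimes> \<eta>\<^sub>A)"
  for C (structure)

definition u2 :: "('o, 'm) smcat \<Rightarrow> 'm \<Rightarrow> 'm \<Rightarrow> 'm \<Rightarrow> 'm" where
  "u2 C \<mu>\<^sub>H \<eta>\<^sub>A \<phi> = \<phi> \<cdot> (\<mu>\<^sub>H \<otimes> \<eta>\<^sub>A)"
  for C (structure)

definition Reg2 ::
    "('o, 'm) smcat \<Rightarrow> 'o \<Rightarrow> 'm \<Rightarrow> 'm \<Rightarrow> 'o \<Rightarrow> 'm \<Rightarrow> 'm \<Rightarrow> 'm \<Rightarrow> 'm set" where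
  "Reg2 C H \<mu>\<^sub>H \<delta>\<^sub>H A \<eta>\<^sub>A \<mu>\<^sub>A \<phi> =
     (let conv = convolution C (tensor_comult C H \<delta>\<^sub>H H \<delta>\<^sub>H) \<mu>\<^sub>A
      in {\<sigma> \<in> Hom C (H \<odot> H) A. \<exists>\<tau> \<in> Hom C (H \<odot> H) A.
            conv \<sigma> \<tau> = u2 C \<mu>\<^sub>H \<eta>\<^sub>A \<phi> \<and> conv \<tau> \<sigma> = u2 C \<mu>\<^sub>H \<eta>\<^sub>A \<phi> \<and>
            conv (conv \<sigma> \<tau>) \<sigma> = \<sigma> \<and> conv (conv \<tau> \<sigma>) \<tau> = \<tau>})"
  for C (structure)


section \<open>Weak crossed products\<close>

text \<open>The quadruple \<open>(A, H, \<psi>\<^sub>H\<^sup>A, \<sigma>\<^sub>H\<^sup>A)\<close> associated to \<open>\<sigma>\<close>:\<close>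

definition psi_HA :: "('o, 'm) smcat \<Rightarrow> 'o \<Rightarrow> 'm \<Rightarrow> 'o \<Rightarrow> 'm \<Rightarrow> 'm" where
  "psi_HA C H \<delta>\<^sub>H A \<phi> = (\<phi> \<otimes> \<I> H) \<cdot> (\<I> H \<otimes> \<c> H A) \<cdot> (\<delta>\<^sub>H \<otimes> \<I> A)"
  for C (structure)

definition sigma_HA :: "('o, 'm) smcat \<Rightarrow> 'o \<Rightarrow> 'm \<Rightarrow> 'm \<Rightarrow> 'm \<Rightarrow> 'm" where
  "sigma_HA C H \<mu>\<^sub>H \<delta>\<^sub>H \<sigma> = (\<sigma> \<otimes> \<mu>\<^sub>H) \<cdot> tensor_comult C H \<delta>\<^sub>H H \<delta>\<^sub>H"
  for C (structure)

text \<open>In the remaining definitions \<open>\<psi> : H \<otimes> A \<rightarrow> A \<otimes> H\<close> and \<open>s : H \<otimes> H \<rightarrow> A \<otimes> H\<close> are the last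
  two components of such a quadruple.\<close>

definition nabla :: "('o, 'm) smcat \<Rightarrow> 'o \<Rightarrow> 'o \<Rightarrow> 'm \<Rightarrow> 'm \<Rightarrow> 'm \<Rightarrow> 'm" where
  "nabla C A H \<eta>\<^sub>A \<mu>\<^sub>A \<psi> = (\<mu>\<^sub>A \<otimes> \<I> H) \<cdot> (\<I> A \<otimes> \<psi>) \<cdot> (\<I> A \<otimes> \<I> H \<otimes> \<eta>\<^sub>A)"
  for C (structure)

definition twisted_condition :: "('o, 'm) smcat \<Rightarrow> 'o \<Rightarrow> 'o \<Rightarrow> 'm \<Rightarrow> 'm \<Rightarrow> 'm \<Rightarrow> bool" where
  "twisted_condition C A H \<mu>\<^sub>A \<psi> s \<longleftrightarrow>
     (\<mu>\<^sub>A \<otimes> \<I> H) \<cdot> (\<I> A \<otimes> \<psi>) \<cdot> (s \<otimes> \<I> A)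
       = (\<mu>\<^sub>A \<otimes> \<I> H) \<cdot> (\<I> A \<otimes> s) \<cdot> (\<psi> \<otimes> \<I> H) \<cdot> (\<I> H \<otimes> \<psi>)"
  for C (structure)

definition cocycle_condition :: "('o, 'm) smcat \<Rightarrow> 'o \<Rightarrow> 'o \<Rightarrow> 'm \<Rightarrow> 'm \<Rightarrow> 'm \<Rightarrow> bool" where
  "cocycle_condition C A H \<mu>\<^sub>A \<psi> s \<longleftrightarrow>
     (\<mu>\<^sub>A \<otimes> \<I> H) \<cdot> (\<I> A \<otimes> s) \<cdot> (s \<otimes> \<I> H)
       = (\<mu>\<^sub>A \<otimes> \<I> H) \<cdot> (\<I> A \<otimes> s) \<cdot> (\<psi> \<otimes> \<I> H) \<cdot> (\<I> H \<otimes> s)"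
  for C (structure)

definition crossed_mult :: "('o, 'm) smcat \<Rightarrow> 'o \<Rightarrow> 'o \<Rightarrow> 'm \<Rightarrow> 'm \<Rightarrow> 'm \<Rightarrow> 'm" where
  "crossed_mult C A H \<mu>\<^sub>A \<psi> s
     = (\<mu>\<^sub>A \<otimes> \<I> H) \<cdot> (\<mu>\<^sub>A \<otimes> s) \<cdot> (\<I> A \<otimes> \<psi> \<otimes> \<I> H)"
  for C (structure)

text \<open>Associativity of the product \<open>m\<close> on \<open>B\<close> is not part of this predicate. For
  \<open>crossed_mult\<close> it follows from the twisted and cocycle conditions.\<close>

definition is_preunit :: "('o, 'm) smcat \<Rightarrow> 'o \<Rightarrow> 'm \<Rightarrow> 'm \<Rightarrow> bool" where
  "is_preunit C B m \<nu> \<longleftrightarrow>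
     \<nu> \<in> Hom C \<K> B \<and>
     m \<cdot> (\<I> B \<otimes> \<nu>) = m \<cdot> (\<nu> \<otimes> \<I> B) \<and>
     m \<cdot> (\<nu> \<otimes> \<I> B) = m \<cdot> (\<I> B \<otimes> (m \<cdot> (\<nu> \<otimes> \<nu>)))"
  for C (structure)

end

theory Submission
  imports Defs
begin

text \<open>
  Write \<open>h \<cdot> a\<close> for the action and \<open>1\<^sub>1 \<otimes> 1\<^sub>2\<close> for the coproduct of the unit of \<open>H\<close>, so that
  \<open>\<nu> = u\<^sub>1(1\<^sub>1) \<otimes> 1\<^sub>2\<close>. Regularity gives \<open>\<sigma> \<and> u\<^sub>2 = \<sigma> = u\<^sub>2 \<and> \<sigma>\<close>. Together with the weak bialgebra
  axioms for the coproduct of the unit this yields \<open>\<sigma>\<^sub>H\<^sup>A(h \<otimes> 1) = \<sigma>(h\<^sub>1, 1) \<otimes> h\<^sub>2\<close> and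
  \<open>\<sigma>\<^sub>H\<^sup>A(1 \<otimes> h) = \<sigma>(1, h\<^sub>1) \<otimes> h\<^sub>2\<close> (\<open>SigmaHA_unit_right\<close>, \<open>SigmaHA_unit_left\<close>), and from these
  multiplication by \<open>\<nu>\<close> is computed (\<open>Mul_Nu\<close>, \<open>Nu_Mul\<close>):
  \<open>(a \<otimes> h) \<nu> = a \<sigma>(h\<^sub>1, 1) \<otimes> h\<^sub>2\<close> and \<open>\<nu> (a \<otimes> h) = a \<sigma>(1, h\<^sub>1) \<otimes> h\<^sub>2\<close>.

  If \<open>\<sigma>\<close> is normal, both maps are \<open>\<nabla>\<close>, and \<open>\<nu> \<nu> = \<nu>\<close>, so \<open>\<nu>\<close> is a preunit. Conversely, let \<open>\<nu>\<close> be a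
  preunit. The first preunit equation gives \<open>\<sigma>(-, 1) = \<sigma>(1, -)\<close>. For the second one note that
  \<open>\<nu> \<nu> = \<sigma>\<^sub>H\<^sup>A(1 \<otimes> 1)\<close>; the cocycle condition on \<open>h \<otimes> 1 \<otimes> 1\<close> then makes \<open>f = \<sigma>(-, 1)\<close> idempotent for
  convolution (\<open>SigR_idempotent\<close>). As \<open>\<sigma>(h, 1\<^sub>1) \<otimes> 1\<^sub>2 = f(h\<^sub>1) u\<^sub>2(h\<^sub>2, 1\<^sub>1) \<otimes> 1\<^sub>2\<close>, it follows that
  \<open>\<sigma>(h, 1\<^sub>1) \<otimes> 1\<^sub>2 = f(h\<^sub>1) \<sigma>(h\<^sub>2, 1\<^sub>1) \<otimes> 1\<^sub>2\<close>, and convolution with the inverse of \<open>\<sigma>\<close> gives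
  \<open>u\<^sub>1 = f \<and> u\<^sub>1 = f\<close> (\<open>U1_eq_SigR\<close>).

  The structural steps of these calculations, that is, associativity of composition, the interchange
  law and the naturality and coherence of the symmetry, are decided by computation. Arrows are
  presented as straight-line programs over named wires; two programs that differ only in the names
  of wires and in the order of independent statements denote the same arrow (\<open>coherence\<close>). What
  remains visible are the applications of the algebraic axioms.
\<close>

section \<open>Calculating in a strict symmetric monoidal category\<close>

text \<open>
  The axioms are restated with \<open>Dom\<close> and \<open>Cod\<close> as functions, so that the simplifier can discharge
  typing conditions.
\<close>

context strict_symmetric_monoidal_category
begin

lemma arr_Id [simp]: "a \<in> Obj C \<Longrightarrow> \<I> a \<in> Arr C"
  and Dom_Id [simp]: "a \<in> Obj C \<Longrightarrow> Dom C (\<I> a) = a"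
  and Cod_Id [simp]: "a \<in> Obj C \<Longrightarrow> Cod C (\<I> a) = a"
  using Id_Hom by (auto simp: Hom_def)

lemma arr_Comp [simp]:
  assumes "f \<in> Arr C" "g \<in> Arr C" "Cod C f = Dom C g"
  shows "g \<cdot> f \<in> Arr C" "Dom C (g \<cdot> f) = Dom C f" "Cod C (g \<cdot> f) = Cod C g"
  using Comp_Hom[of f "Dom C f" "Cod C f" g "Cod C g"] assms by (auto simp: Hom_def)

lemma arr_Ten [simp]:
  assumes "f \<in> Arr C" "g \<in> Arr C"
  shows "f \<otimes> g \<in> Arr C" "Dom C (f \<otimes> g) = Dom C f \<odot> Dom C g" "Cod C (f \<otimes> g) = Cod C f \<odot> Cod C g"
  using Ten_Hom[of f "Dom C f" "Cod C f" g "Dom C g" "Cod C g"] assms by (auto simp: Hom_def)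

lemma arr_Sym [simp]:
  assumes "a \<in> Obj C" "b \<in> Obj C"
  shows "\<c> a b \<in> Arr C" "Dom C (\<c> a b) = a \<odot> b" "Cod C (\<c> a b) = b \<odot> a"
  using Sym_Hom[of a b] assms by (auto simp: Hom_def)

lemmas [simp] = Dom_Obj Cod_Obj Unit_Obj TenO_Obj TenO_assoc TenO_Unit_left TenO_Unit_right
  Ten_Id Ten_Unit_left Ten_Unit_right Sym_Sym Ten_assoc

lemma Comp_Id [simp]:
  assumes "f \<in> Arr C"
  shows "Dom C f = a \<Longrightarrow> f \<cdot> \<I> a = f" "Cod C f = b \<Longrightarrow> \<I> b \<cdot> f = f"
  using Comp_Id_left[of f "Dom C f" "Cod C f"] Comp_Id_right[of f "Dom C f" "Cod C f"] assms
  by (auto simp: Hom_def)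

lemma comp_assoc:
  assumes "f \<in> Arr C" "g \<in> Arr C" "h \<in> Arr C" "Cod C f = Dom C g" "Cod C g = Dom C h"
  shows "(h \<cdot> g) \<cdot> f = h \<cdot> g \<cdot> f"
  using Comp_assoc[of f "Dom C f" "Cod C f" g "Cod C g" h "Cod C h"] assms by (auto simp: Hom_def)

lemma interchange:
  assumes "f \<in> Arr C" "g \<in> Arr C" "f' \<in> Arr C" "g' \<in> Arr C"
    and "Cod C f = Dom C g" "Cod C f' = Dom C g'"
  shows "(g \<otimes> g') \<cdot> (f \<otimes> f') = (g \<cdot> f) \<otimes> (g' \<cdot> f')"
  using Ten_Comp[of f "Dom C f" "Cod C f" g "Cod C g" f' "Dom C f'" "Cod C f'" g' "Cod C g'"] assms
  by (auto simp: Hom_def)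

lemma interchange3:
  assumes "f \<in> Arr C" "g \<in> Arr C" "f' \<in> Arr C" "g' \<in> Arr C" "k \<in> Arr C"
    and "Cod C f = Dom C g" "Cod C f' = Dom C g'" "Cod C k = Dom C f \<odot> Dom C f'"
  shows "(g \<otimes> g') \<cdot> (f \<otimes> f') \<cdot> k = ((g \<cdot> f) \<otimes> (g' \<cdot> f')) \<cdot> k"
  using assms interchange[of f g f' g'] comp_assoc[of k "f \<otimes> f'" "g \<otimes> g'"] by simp

lemma sym_nat:
  assumes "f \<in> Arr C" "g \<in> Arr C" "b = Cod C f" "b' = Cod C g"
  shows "\<c> b b' \<cdot> (f \<otimes> g) = (g \<otimes> f) \<cdot> \<c> (Dom C f) (Dom C g)"
  using Sym_natural[of f "Dom C f" "Cod C f" g "Dom C g" "Cod C g"] assms by (auto simp: Hom_def)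

lemma Sym_Unit_right [simp]:
  assumes [simp]: "a \<in> Obj C"
  shows "\<c> a \<K> = \<I> a"
proof -
  have "\<c> a \<K> = \<c> a \<K> \<cdot> \<c> a \<K>"
    using Sym_hexagon[of a \<K> \<K>] by simp
  then have "\<c> \<K> a \<cdot> \<c> a \<K> = \<c> \<K> a \<cdot> \<c> a \<K> \<cdot> \<c> a \<K>" by simp
  also have "\<dots> = (\<c> \<K> a \<cdot> \<c> a \<K>) \<cdot> \<c> a \<K>" by (subst comp_assoc) auto
  finally show ?thesis by simp
qed

lemma inverse_unique:
  assumes "f \<in> Arr C" "g \<in> Arr C" "h \<in> Arr C" "Dom C g = Cod C f" "Dom C f = Cod C h"
    and "g \<cdot> f = \<I> (Dom C f)" "f \<cdot> h = \<I> (Cod C f)"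
  shows "g = h"
proof -
  have "g = g \<cdot> f \<cdot> h" using assms by simp
  also have "\<dots> = (g \<cdot> f) \<cdot> h" using assms by (subst comp_assoc) auto
  finally show ?thesis using assms by simp
qed

lemma Sym_hexagon_left:
  assumes [simp]: "a \<in> Obj C" "b \<in> Obj C" "d \<in> Obj C"
  shows "\<c> (a \<odot> b) d = (\<c> a d \<otimes> \<I> b) \<cdot> (\<I> a \<otimes> \<c> b d)"
proof (rule inverse_unique[where f = "\<c> d (a \<odot> b)"])
  have 1: "\<c> d (a \<odot> b) = (\<I> a \<otimes> \<c> d b) \<cdot> (\<c> d a \<otimes> \<I> b)"
    by (simp add: Sym_hexagon)
  have "\<c> d (a \<odot> b) \<cdot> (\<c> a d \<otimes> \<I> b) \<cdot> (\<I> a \<otimes> \<c> b d)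
     = (\<I> a \<otimes> \<c> d b) \<cdot> (\<c> d a \<otimes> \<I> b) \<cdot> (\<c> a d \<otimes> \<I> b) \<cdot> (\<I> a \<otimes> \<c> b d)"
    unfolding 1 by (subst comp_assoc) auto
  also have "\<dots> = \<I> (a \<odot> b \<odot> d)" by (simp add: interchange3 interchange)
  finally show "\<c> d (a \<odot> b) \<cdot> (\<c> a d \<otimes> \<I> b) \<cdot> (\<I> a \<otimes> \<c> b d) = \<I> (Cod C (\<c> d (a \<odot> b)))"
    by simp
qed auto

lemma Yang_Baxter:
  assumes [simp]: "w \<in> Obj C" "y \<in> Obj C" "z \<in> Obj C"
  shows "(\<c> y z \<otimes> \<I> w) \<cdot> (\<I> y \<otimes> \<c> w z) \<cdot> (\<c> w y \<otimes> \<I> z)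
       = (\<I> z \<otimes> \<c> w y) \<cdot> (\<c> w z \<otimes> \<I> y) \<cdot> (\<I> w \<otimes> \<c> y z)"
proof -
  have "(\<c> y z \<otimes> \<I> w) \<cdot> \<c> w (y \<odot> z) = \<c> w (z \<odot> y) \<cdot> (\<I> w \<otimes> \<c> y z)"
    by (subst sym_nat) auto
  then show ?thesis by (simp add: Sym_hexagon comp_assoc)
qed

end

section \<open>Wires and permutations\<close>

text \<open>A wire carries its sort and a number that tells it apart from other wires of that sort.\<close>

type_synonym 's wire = "'s \<times> nat"

text \<open>The object denoted by a list of sorts; the empty list denotes the unit object.\<close>

primrec tensor :: "('o, 'm) smcat \<Rightarrow> ('s \<Rightarrow> 'o) \<Rightarrow> 's list \<Rightarrow> 'o" where
  "tensor C ob [] = Unit C"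
| "tensor C ob (s # ss) = TenO C (ob s) (tensor C ob ss)"

text \<open>\<open>without xs ys\<close> is what remains of the wires \<open>xs\<close> once the wires \<open>ys\<close> are used up.\<close>

definition without :: "'a list \<Rightarrow> 'a list \<Rightarrow> 'a list" where
  "without xs ys = filter (\<lambda>x. x \<notin> set ys) xs"

lemma without_simps [simp]:
  "set (without xs ys) = set xs - set ys"
  "distinct xs \<Longrightarrow> distinct (without xs ys)"
  "without [] ys = []"
  "without (xs @ xs') ys = without xs ys @ without xs' ys"
  "set xs \<subseteq> set ys \<Longrightarrow> without xs ys = []"
  by (auto simp: without_def filter_empty_conv)

lemma without_disjoint: "set xs \<inter> set ys = {} \<Longrightarrow> without xs ys = xs"
  by (auto simp: without_def filter_id_conv)

text \<open>
  A signature with sorts \<open>'s\<close> and operations \<open>'g\<close>, interpreted in a strict symmetric monoidal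
  category: sorts as objects, operations as arrows between tensor products of sorts.
\<close>

locale interpreted_signature = strict_symmetric_monoidal_category C
  for C :: "('o, 'm) smcat" (structure) +
  fixes ob :: "'s \<Rightarrow> 'o" and din dout :: "'g \<Rightarrow> 's list" and gen :: "'g \<Rightarrow> 'm"
  assumes ob_Obj [simp]: "ob x \<in> Obj C"
    and gen_Hom: "gen g \<in> Hom C (tensor C ob (din g)) (tensor C ob (dout g))"
begin

abbreviation ty :: "'s wire list \<Rightarrow> 'o" where "ty xs \<equiv> tensor C ob (map fst xs)"

abbreviation tw :: "'s wire \<Rightarrow> 'o" where "tw x \<equiv> ob (fst x)"

lemma tensor_Obj [simp]: "tensor C ob ss \<in> Obj C" by (induction ss) auto

lemma tensor_append [simp]: "tensor C ob (ss @ ts) = tensor C ob ss \<odot> tensor C ob ts"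
  by (induction ss) auto

text \<open>\<open>front x xs\<close> is the composite of symmetries that moves the wire \<open>x\<close> to the front of \<open>xs\<close>. The
  value on the empty list is never used.\<close>

primrec front :: "'s wire \<Rightarrow> 's wire list \<Rightarrow> 'm" where
  "front x [] = \<I> \<K>"
| "front x (y # ys) = (if x = y then \<I> (ty (y # ys))
     else (\<c> (tw y) (tw x) \<otimes> \<I> (ty (removeAll x ys))) \<cdot> (\<I> (tw y) \<otimes> front x ys))"

text \<open>\<open>perm xs ys\<close> is the composite of symmetries that rearranges the wires \<open>xs\<close> into the order \<open>ys\<close>. It
  fetches the wires of \<open>ys\<close> one after the other; by \<open>perm_perm\<close> below, the way in which a
  permutation is decomposed does not matter.\<close>

primrec perm :: "'s wire list \<Rightarrow> 's wire list \<Rightarrow> 'm" where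
  "perm xs [] = \<I> \<K>"
| "perm xs (y # ys) = (\<I> (tw y) \<otimes> perm (removeAll y xs) ys) \<cdot> front y xs"

lemma front_typing [simp]:
  "x \<in> set xs \<Longrightarrow> distinct xs \<Longrightarrow> front x xs \<in> Arr C \<and> Dom C (front x xs) = ty xs
     \<and> Cod C (front x xs) = tw x \<odot> ty (removeAll x xs)"
  by (induction xs) auto

text \<open>The two lists are rearrangements of each other, without repetitions.\<close>

definition same_wires :: "'a list \<Rightarrow> 'a list \<Rightarrow> bool" where
  "same_wires xs ys \<longleftrightarrow> distinct xs \<and> distinct ys \<and> set xs = set ys"

lemma same_Cons: "same_wires xs (y # ys) \<Longrightarrow> y \<in> set xs \<and> distinct xs \<and> same_wires (removeAll y xs) ys"
  by (auto simp: same_wires_def distinct_removeAll)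

lemma perm_typing [simp]:
  "same_wires xs ys \<Longrightarrow> perm xs ys \<in> Arr C \<and> Dom C (perm xs ys) = ty xs \<and> Cod C (perm xs ys) = ty ys"
proof (induction ys arbitrary: xs)
  case Nil then show ?case by (auto simp: same_wires_def)
next
  case (Cons y ys)
  then show ?case using same_Cons[OF Cons.prems] by auto
qed

lemma perm_id [simp]: "distinct xs \<Longrightarrow> perm xs xs = \<I> (ty xs)"
  by (induction xs) auto

text \<open>Fetching \<open>y\<close> and then \<open>z\<close>, or \<open>z\<close> and then \<open>y\<close>, differs by the symmetry of the two. The inductive
  step is the Yang-Baxter equation.\<close>

lemma front_front:
  assumes "y \<noteq> z" "y \<in> set xs" "z \<in> set xs" "distinct xs"
  shows "(\<c> (tw y) (tw z) \<otimes> \<I> (ty (removeAll z (removeAll y xs))))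
       \<cdot> (\<I> (tw y) \<otimes> front z (removeAll y xs)) \<cdot> front y xs
     = (\<I> (tw z) \<otimes> front y (removeAll z xs)) \<cdot> front z xs"
  using assms
proof (induction xs)
  case Nil then show ?case by simp
next
  case (Cons w xs)
  consider "w = y" | "w = z" | "w \<noteq> y" "w \<noteq> z" by blast
  then show ?case
  proof cases
    case 1 then show ?thesis using Cons.prems by auto
  next
    case 2
    then have [simp]: "z \<notin> set xs" "y \<in> set xs" "distinct xs" "w = z" "z \<noteq> y" "y \<noteq> z"
      using Cons.prems by auto
    show ?thesis using 2 Cons.prems
      by (simp add: interchange interchange3 distinct_removeAll)
  next
    case 3
    then have [simp]: "y \<in> set xs" "z \<in> set xs" "distinct xs" "w \<noteq> y" "w \<noteq> z" "y \<noteq> w" "z \<noteq> w"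
       "z \<noteq> y" "y \<noteq> z"
      using Cons.prems by auto
    define R where "R = ty (removeAll z (removeAll y xs))"
    have [simp]: "R \<in> Obj C" by (simp add: R_def)
    have R': "ty (removeAll y (removeAll z xs)) = R" 
      unfolding R_def by (simp add: removeAll_filter_not_eq conj_commute)
    let ?fz = "front z (removeAll y xs)" let ?fy = "front y xs"
    let ?w = "tw w" let ?y = "tw y" let ?z = "tw z"
    have t: "?fz \<in> Arr C" "Dom C ?fz = ty (removeAll y xs)" "Cod C ?fz = ?z \<odot> R"
       "?fy \<in> Arr C" "Dom C ?fy = ty xs" "Cod C ?fy = ?y \<odot> ty (removeAll y xs)"
      by (simp_all add: R_def distinct_removeAll)
    have t': "front y (removeAll z xs) \<in> Arr C" "Dom C (front y (removeAll z xs)) = ty (removeAll z xs)"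
      "Cod C (front y (removeAll z xs)) = ?y \<odot> R"
      "front z xs \<in> Arr C" "Dom C (front z xs) = ty xs" "Cod C (front z xs) = ?z \<odot> ty (removeAll z xs)"
      using R' by (simp_all add: distinct_removeAll)
    have IH: "(\<c> ?y ?z \<otimes> \<I> R) \<cdot> (\<I> ?y \<otimes> ?fz) \<cdot> ?fy = (\<I> ?z \<otimes> front y (removeAll z xs)) \<cdot> front z xs"
      using Cons.IH by (simp add: R_def)
    define K where "K = \<I> ?w \<otimes> ((\<I> ?y \<otimes> ?fz) \<cdot> ?fy)"
    have K: "K \<in> Arr C" "Dom C K = ?w \<odot> ty xs" "Cod C K = ?w \<odot> ?y \<odot> ?z \<odot> R"
      using t by (simp_all add: K_def)
    have K_eq: "K = (\<I> (?w \<odot> ?y) \<otimes> ?fz) \<cdot> (\<I> ?w \<otimes> ?fy)"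
      using t by (simp add: K_def interchange flip: Ten_Id)
    have 1: "(\<c> ?y ?z \<otimes> \<I> (ty (removeAll z (removeAll y (w # xs)))))
       \<cdot> (\<I> ?y \<otimes> front z (removeAll y (w # xs))) \<cdot> front y (w # xs)
       = (\<c> ?y ?z \<otimes> \<I> (?w \<odot> R))
       \<cdot> (\<I> ?y \<otimes> ((\<c> ?w ?z \<otimes> \<I> R) \<cdot> (\<I> ?w \<otimes> ?fz)))
       \<cdot> (\<c> ?w ?y \<otimes> \<I> (ty (removeAll y xs))) \<cdot> (\<I> ?w \<otimes> ?fy)" 
      using t by (simp add: R_def)
    also have "\<dots> = (\<c> ?y ?z \<otimes> \<I> (?w \<odot> R)) \<cdot> (\<I> ?y \<otimes> \<c> ?w ?z \<otimes> \<I> R)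
       \<cdot> (\<I> (?y \<odot> ?w) \<otimes> ?fz) \<cdot> (\<c> ?w ?y \<otimes> \<I> (ty (removeAll y xs))) \<cdot> (\<I> ?w \<otimes> ?fy)"
    proof -
      have "\<I> ?y \<otimes> ((\<c> ?w ?z \<otimes> \<I> R) \<cdot> (\<I> ?w \<otimes> ?fz))
         = (\<I> ?y \<otimes> \<c> ?w ?z \<otimes> \<I> R) \<cdot> (\<I> (?y \<odot> ?w) \<otimes> ?fz)"
        using t by (simp add: interchange flip: Ten_Id)
      then show ?thesis using t by (simp add: comp_assoc)
    qed
    also have "(\<I> (?y \<odot> ?w) \<otimes> ?fz) \<cdot> (\<c> ?w ?y \<otimes> \<I> (ty (removeAll y xs))) \<cdot> (\<I> ?w \<otimes> ?fy)
        = (\<c> ?w ?y \<otimes> \<I> (?z \<odot> R)) \<cdot> K"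
    proof -
      have "(\<I> (?y \<odot> ?w) \<otimes> ?fz) \<cdot> (\<c> ?w ?y \<otimes> \<I> (ty (removeAll y xs)))
        = (\<c> ?w ?y \<otimes> \<I> (?z \<odot> R)) \<cdot> (\<I> (?w \<odot> ?y) \<otimes> ?fz)"
        using t by (simp add: interchange del: Ten_Id)
      then have "((\<I> (?y \<odot> ?w) \<otimes> ?fz) \<cdot> (\<c> ?w ?y \<otimes> \<I> (ty (removeAll y xs)))) \<cdot> (\<I> ?w \<otimes> ?fy)
        = ((\<c> ?w ?y \<otimes> \<I> (?z \<odot> R)) \<cdot> (\<I> (?w \<odot> ?y) \<otimes> ?fz)) \<cdot> (\<I> ?w \<otimes> ?fy)" by simp
      then show ?thesis unfolding K_eq using t by (simp add: comp_assoc)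
    qed
    also have "(\<c> ?y ?z \<otimes> \<I> (?w \<odot> R)) \<cdot> (\<I> ?y \<otimes> \<c> ?w ?z \<otimes> \<I> R) \<cdot> (\<c> ?w ?y \<otimes> \<I> (?z \<odot> R)) \<cdot> K
       = (\<I> ?z \<otimes> \<c> ?w ?y \<otimes> \<I> R) \<cdot> (\<c> ?w ?z \<otimes> \<I> (?y \<odot> R)) \<cdot> (\<I> ?w \<otimes> \<c> ?y ?z \<otimes> \<I> R) \<cdot> K"
    proof -
      have "((\<c> ?y ?z \<otimes> \<I> ?w) \<cdot> (\<I> ?y \<otimes> \<c> ?w ?z) \<cdot> (\<c> ?w ?y \<otimes> \<I> ?z)) \<otimes> \<I> R
          = ((\<I> ?z \<otimes> \<c> ?w ?y) \<cdot> (\<c> ?w ?z \<otimes> \<I> ?y) \<cdot> (\<I> ?w \<otimes> \<c> ?y ?z)) \<otimes> \<I> R"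
        by (simp add: Yang_Baxter)
      moreover have "((\<c> ?y ?z \<otimes> \<I> ?w) \<cdot> (\<I> ?y \<otimes> \<c> ?w ?z) \<cdot> (\<c> ?w ?y \<otimes> \<I> ?z)) \<otimes> \<I> R
          = (\<c> ?y ?z \<otimes> \<I> (?w \<odot> R)) \<cdot> (\<I> ?y \<otimes> \<c> ?w ?z \<otimes> \<I> R) \<cdot> (\<c> ?w ?y \<otimes> \<I> (?z \<odot> R))"
        by (simp add: interchange flip: Ten_Id Ten_assoc)
      moreover have "((\<I> ?z \<otimes> \<c> ?w ?y) \<cdot> (\<c> ?w ?z \<otimes> \<I> ?y) \<cdot> (\<I> ?w \<otimes> \<c> ?y ?z)) \<otimes> \<I> R
          = (\<I> ?z \<otimes> \<c> ?w ?y \<otimes> \<I> R) \<cdot> (\<c> ?w ?z \<otimes> \<I> (?y \<odot> R)) \<cdot> (\<I> ?w \<otimes> \<c> ?y ?z \<otimes> \<I> R)"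
        by (simp add: interchange flip: Ten_Id Ten_assoc)
      ultimately have "((\<c> ?y ?z \<otimes> \<I> (?w \<odot> R)) \<cdot> (\<I> ?y \<otimes> \<c> ?w ?z \<otimes> \<I> R) \<cdot> (\<c> ?w ?y \<otimes> \<I> (?z \<odot> R))) \<cdot> K
         = ((\<I> ?z \<otimes> \<c> ?w ?y \<otimes> \<I> R) \<cdot> (\<c> ?w ?z \<otimes> \<I> (?y \<odot> R)) \<cdot> (\<I> ?w \<otimes> \<c> ?y ?z \<otimes> \<I> R)) \<cdot> K"
        by simp
      then show ?thesis using K by (simp add: comp_assoc)
    qed
    also have "(\<I> ?w \<otimes> \<c> ?y ?z \<otimes> \<I> R) \<cdot> K = (\<I> (?w \<odot> ?z) \<otimes> front y (removeAll z xs)) \<cdot> (\<I> ?w \<otimes> front z xs)"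
    proof -
      have "(\<I> ?w \<otimes> \<c> ?y ?z \<otimes> \<I> R) \<cdot> K = \<I> ?w \<otimes> ((\<I> ?z \<otimes> front y (removeAll z xs)) \<cdot> front z xs)"
        unfolding IH[symmetric] K_def using t by (simp add: interchange)
      also have "\<dots> = (\<I> (?w \<odot> ?z) \<otimes> front y (removeAll z xs)) \<cdot> (\<I> ?w \<otimes> front z xs)"
        using t' by (simp add: interchange flip: Ten_Id)
      finally show ?thesis .
    qed
    also have "(\<c> ?w ?z \<otimes> \<I> (?y \<odot> R)) \<cdot> (\<I> (?w \<odot> ?z) \<otimes> front y (removeAll z xs)) \<cdot> (\<I> ?w \<otimes> front z xs)
       = (\<I> (?z \<odot> ?w) \<otimes> front y (removeAll z xs)) \<cdot> (\<c> ?w ?z \<otimes> \<I> (ty (removeAll z xs))) \<cdot> (\<I> ?w \<otimes> front z xs)"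
    proof -
      have "(\<c> ?w ?z \<otimes> \<I> (?y \<odot> R)) \<cdot> (\<I> (?w \<odot> ?z) \<otimes> front y (removeAll z xs))
        = (\<I> (?z \<odot> ?w) \<otimes> front y (removeAll z xs)) \<cdot> (\<c> ?w ?z \<otimes> \<I> (ty (removeAll z xs)))"
        using t' by (simp add: interchange del: Ten_Id)
      then have "((\<c> ?w ?z \<otimes> \<I> (?y \<odot> R)) \<cdot> (\<I> (?w \<odot> ?z) \<otimes> front y (removeAll z xs))) \<cdot> (\<I> ?w \<otimes> front z xs)
        = ((\<I> (?z \<odot> ?w) \<otimes> front y (removeAll z xs)) \<cdot> (\<c> ?w ?z \<otimes> \<I> (ty (removeAll z xs)))) \<cdot> (\<I> ?w \<otimes> front z xs)"
        by simp
      then show ?thesis using t' by (simp add: comp_assoc)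
    qed
    also have "(\<I> ?z \<otimes> \<c> ?w ?y \<otimes> \<I> R) \<cdot> \<dots> = 
       (\<I> ?z \<otimes> ((\<c> ?w ?y \<otimes> \<I> R) \<cdot> (\<I> ?w \<otimes> front y (removeAll z xs)))) \<cdot>
         (\<c> ?w ?z \<otimes> \<I> (ty (removeAll z xs))) \<cdot> (\<I> ?w \<otimes> front z xs)"
    proof -
      have "\<I> ?z \<otimes> ((\<c> ?w ?y \<otimes> \<I> R) \<cdot> (\<I> ?w \<otimes> front y (removeAll z xs)))
         = (\<I> ?z \<otimes> \<c> ?w ?y \<otimes> \<I> R) \<cdot> (\<I> (?z \<odot> ?w) \<otimes> front y (removeAll z xs))"
        using t' by (simp add: interchange flip: Ten_Id)
      then show ?thesis using t' by (simp add: comp_assoc)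
    qed
    also have "\<dots> = (\<I> ?z \<otimes> front y (removeAll z (w # xs))) \<cdot> front z (w # xs)"
      by (simp add: R')
    finally show ?thesis .
  qed
qed


lemma same_removeAll: "same_wires xs ys \<Longrightarrow> same_wires (removeAll z xs) (removeAll z ys)"
  by (auto simp: same_wires_def distinct_removeAll)

lemma same_trans: "same_wires xs ys \<Longrightarrow> same_wires ys zs \<Longrightarrow> same_wires xs zs"
  and same_sym: "same_wires xs ys \<Longrightarrow> same_wires ys xs"
  by (auto simp: same_wires_def)

lemma front_perm:
  assumes "same_wires xs ys" "z \<in> set ys"
  shows "front z ys \<cdot> perm xs ys = (\<I> (tw z) \<otimes> perm (removeAll z xs) (removeAll z ys)) \<cdot> front z xs"
  using assms
proof (induction ys arbitrary: xs)
  case Nil then show ?case by simp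
next
  case (Cons y ys)
  note same_wires = same_Cons[OF Cons.prems(1)]
  have dy: "y \<notin> set ys" "distinct ys" using Cons.prems by (auto simp: same_wires_def)
  show ?case
  proof (cases "z = y")
    case True
    then show ?thesis using same_wires dy by simp
  next
    case False
    then have z: "z \<in> set ys" "z \<in> set xs" "y \<noteq> z" using Cons.prems by (auto simp: same_wires_def)
    have s1: "same_wires (removeAll y xs) ys" using same_wires by simp
    have s2: "same_wires (removeAll z (removeAll y xs)) (removeAll z ys)"
      using same_removeAll[OF s1] .
    have comm: "removeAll y (removeAll z xs) = removeAll z (removeAll y xs)"
      by (simp add: removeAll_filter_not_eq conj_commute)
    define R where "R = ty (removeAll z ys)"
    define R' where "R' = ty (removeAll z (removeAll y xs))"
    have [simp]: "R \<in> Obj C" "R' \<in> Obj C" by (simp_all add: R_def R'_def)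
    let ?p = "perm (removeAll y xs) ys" and ?q = "perm (removeAll z (removeAll y xs)) (removeAll z ys)"
    let ?fz = "front z (removeAll y xs)"
    have t: "?p \<in> Arr C" "Dom C ?p = ty (removeAll y xs)" "Cod C ?p = ty ys"
      "?q \<in> Arr C" "Dom C ?q = R'" "Cod C ?q = R"
      "front y xs \<in> Arr C" "Dom C (front y xs) = ty xs" "Cod C (front y xs) = tw y \<odot> ty (removeAll y xs)"
      "front z ys \<in> Arr C" "Dom C (front z ys) = ty ys" "Cod C (front z ys) = tw z \<odot> R"
      "?fz \<in> Arr C" "Dom C ?fz = ty (removeAll y xs)" "Cod C ?fz = tw z \<odot> R'"
      "front y (removeAll z xs) \<in> Arr C" "Dom C (front y (removeAll z xs)) = ty (removeAll z xs)"
      "Cod C (front y (removeAll z xs)) = tw y \<odot> R'"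
      "front z xs \<in> Arr C" "Dom C (front z xs) = ty xs" "Cod C (front z xs) = tw z \<odot> ty (removeAll z xs)"
      using s1 s2 same_wires z dy by (simp_all add: R_def R'_def distinct_removeAll comm)
    have "front z (y # ys) \<cdot> perm xs (y # ys)
      = (\<c> (tw y) (tw z) \<otimes> \<I> R) \<cdot> (\<I> (tw y) \<otimes> (front z ys \<cdot> ?p)) \<cdot> front y xs"
      using t z by (simp add: comp_assoc interchange3 flip: R_def)
    also have "front z ys \<cdot> ?p = (\<I> (tw z) \<otimes> ?q) \<cdot> ?fz"
      using Cons.IH[OF s1 z(1)] .
    also have "\<I> (tw y) \<otimes> ((\<I> (tw z) \<otimes> ?q) \<cdot> ?fz) = (\<I> (tw y \<odot> tw z) \<otimes> ?q) \<cdot> (\<I> (tw y) \<otimes> ?fz)"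
      using t by (simp add: interchange flip: Ten_Id)
    also have "(\<c> (tw y) (tw z) \<otimes> \<I> R) \<cdot> ((\<I> (tw y \<odot> tw z) \<otimes> ?q) \<cdot> (\<I> (tw y) \<otimes> ?fz)) \<cdot> front y xs
      = ((\<c> (tw y) (tw z) \<otimes> \<I> R) \<cdot> (\<I> (tw y \<odot> tw z) \<otimes> ?q)) \<cdot> (\<I> (tw y) \<otimes> ?fz) \<cdot> front y xs"
      using t by (simp add: comp_assoc)
    also have "(\<c> (tw y) (tw z) \<otimes> \<I> R) \<cdot> (\<I> (tw y \<odot> tw z) \<otimes> ?q)
       = (\<I> (tw z \<odot> tw y) \<otimes> ?q) \<cdot> (\<c> (tw y) (tw z) \<otimes> \<I> R')"
      using t by (simp add: interchange del: Ten_Id)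
    also have "((\<I> (tw z \<odot> tw y) \<otimes> ?q) \<cdot> (\<c> (tw y) (tw z) \<otimes> \<I> R')) \<cdot> (\<I> (tw y) \<otimes> ?fz) \<cdot> front y xs
      = (\<I> (tw z \<odot> tw y) \<otimes> ?q) \<cdot> (\<c> (tw y) (tw z) \<otimes> \<I> R') \<cdot> (\<I> (tw y) \<otimes> ?fz) \<cdot> front y xs"
      using t by (simp add: comp_assoc)
    also have "(\<c> (tw y) (tw z) \<otimes> \<I> R') \<cdot> (\<I> (tw y) \<otimes> ?fz) \<cdot> front y xs
      = (\<I> (tw z) \<otimes> front y (removeAll z xs)) \<cdot> front z xs"
      unfolding R'_def using front_front[of y z xs] z same_wires by simp
    also have "(\<I> (tw z \<odot> tw y) \<otimes> ?q) \<cdot> (\<I> (tw z) \<otimes> front y (removeAll z xs)) \<cdot> front z xs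
      = (\<I> (tw z) \<otimes> ((\<I> (tw y) \<otimes> ?q) \<cdot> front y (removeAll z xs))) \<cdot> front z xs"
      using t by (simp add: interchange3 flip: Ten_Id)
    also have "\<dots> = (\<I> (tw z) \<otimes> perm (removeAll z xs) (removeAll z (y # ys))) \<cdot> front z xs"
      using z by (simp add: comm)
    finally show ?thesis .
  qed
qed

text \<open>Coherence for permutations: composites of symmetries depend only on the rearrangement of wires that
  they effect.\<close>

lemma perm_perm:
  assumes "same_wires xs ys" "same_wires ys zs"
  shows "perm ys zs \<cdot> perm xs ys = perm xs zs"
  using assms
proof (induction zs arbitrary: xs ys)
  case Nil
  then have "xs = []" "ys = []" by (auto simp: same_wires_def)
  then show ?case by simp
next
  case (Cons z zs)
  have z: "z \<in> set ys" "z \<in> set xs" "distinct xs" "distinct ys" "z \<notin> set zs"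
    using Cons.prems by (auto simp: same_wires_def)
  note s = same_Cons[OF Cons.prems(2)]
  have s': "same_wires (removeAll z xs) (removeAll z ys)" "same_wires (removeAll z ys) zs"
    using s same_removeAll[OF Cons.prems(1)] by auto
  note s'' = same_trans[OF s']
  have "perm ys (z # zs) \<cdot> perm xs ys = (\<I> (tw z) \<otimes> perm (removeAll z ys) zs) \<cdot> front z ys \<cdot> perm xs ys"
    using s s' z Cons.prems by (simp add: comp_assoc)
  also have "front z ys \<cdot> perm xs ys = (\<I> (tw z) \<otimes> perm (removeAll z xs) (removeAll z ys)) \<cdot> front z xs"
    using front_perm Cons.prems(1) z(1) by blast
  also have "(\<I> (tw z) \<otimes> perm (removeAll z ys) zs) \<cdot> \<dots> = (\<I> (tw z) \<otimes> perm (removeAll z xs) zs) \<cdot> front z xs"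
    using Cons.IH[OF s'] s' s'' z by (simp add: interchange3)
  finally show ?case by simp
qed

lemma front_append:
  "x \<in> set xs \<Longrightarrow> distinct xs \<Longrightarrow> x \<notin> set us \<Longrightarrow> front x (xs @ us) = front x xs \<otimes> \<I> (ty us)"
proof (induction xs)
  case Nil then show ?case by simp
next
  case (Cons y xs)
  show ?case
  proof (cases "x = y")
    case True then show ?thesis by (simp flip: Ten_Id)
  next
    case False
    then have x: "x \<in> set xs" "distinct xs" "removeAll x us = us" using Cons.prems by auto
    have "front x ((y # xs) @ us) = (\<c> (tw y) (tw x) \<otimes> \<I> (ty (removeAll x xs)) \<otimes> \<I> (ty us))
       \<cdot> (\<I> (tw y) \<otimes> front x xs \<otimes> \<I> (ty us))"
      using Cons x False by simp
    also have "\<dots> = front x (y # xs) \<otimes> \<I> (ty us)"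
      using x False by (simp add: interchange del: Ten_Id Ten_assoc flip: Ten_assoc)
    finally show ?thesis .
  qed
qed

lemma perm_append:
  assumes "same_wires xs ys" "distinct us" "set us \<inter> set xs = {}"
  shows "perm (xs @ us) (ys @ us) = perm xs ys \<otimes> \<I> (ty us)"
  using assms
proof (induction ys arbitrary: xs)
  case Nil then have "xs = []" by (auto simp: same_wires_def)
  then show ?case using Nil by simp
next
  case (Cons y ys)
  note s = same_Cons[OF Cons.prems(1)]
  have y: "y \<notin> set us" using s Cons.prems by auto
  then have y': "removeAll y us = us" by simp
  have "perm (xs @ us) ((y # ys) @ us) = (\<I> (tw y) \<otimes> perm (removeAll y xs) ys \<otimes> \<I> (ty us)) \<cdot> (front y xs \<otimes> \<I> (ty us))"
  proof -
    have "perm (removeAll y xs @ us) (ys @ us) = perm (removeAll y xs) ys \<otimes> \<I> (ty us)"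
      using s Cons.prems by (intro Cons.IH) auto
    then show ?thesis using s y y' by (simp add: front_append)
  qed
  also have "\<dots> = perm xs (y # ys) \<otimes> \<I> (ty us)"
    using s by (simp add: interchange del: Ten_assoc flip: Ten_assoc)
  finally show ?case .
qed

lemma perm_prepend:
  "distinct (us @ xs) \<Longrightarrow> same_wires xs ys \<Longrightarrow> perm (us @ xs) (us @ ys) = \<I> (ty us) \<otimes> perm xs ys"
proof (induction us)
  case Nil then show ?case by simp
next
  case (Cons u us)
  have "same_wires (us @ xs) (us @ ys)" using Cons.prems by (auto simp: same_wires_def)
  moreover have "\<I> (tw u) \<otimes> (\<I> (ty us) \<otimes> perm xs ys) = \<I> (tw u \<odot> ty us) \<otimes> perm xs ys"
    using Cons.prems by (simp del: Ten_Id flip: Ten_assoc Ten_Id)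
  ultimately show ?case using Cons by simp
qed

lemma front_middle:
  "distinct (xs @ x # us) \<Longrightarrow> front x (xs @ x # us) = \<c> (ty xs) (tw x) \<otimes> \<I> (ty us)"
proof (induction xs)
  case Nil
  have "\<c> \<K> (tw x) = \<I> (tw x)"
  proof -
    have "\<I> (tw x) \<cdot> \<c> \<K> (tw x) = \<I> (tw x)"
      using Sym_Sym[of \<K> "tw x"] by (simp del: Comp_Id)
    then show ?thesis by simp
  qed
  then show ?case by simp
next
  case (Cons y xs)
  then have [simp]: "x \<noteq> y" "y \<noteq> x" "x \<notin> set xs" "x \<notin> set us" by auto
  have "front x ((y # xs) @ x # us) = (\<c> (tw y) (tw x) \<otimes> \<I> (ty xs) \<otimes> \<I> (ty us)) \<cdot> (\<I> (tw y) \<otimes> \<c> (ty xs) (tw x) \<otimes> \<I> (ty us))"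
    using Cons by simp
  also have "\<dots> = \<c> (ty (y # xs)) (tw x) \<otimes> \<I> (ty us)"
    by (simp add: Sym_hexagon_left interchange del: Ten_assoc Ten_Id flip: Ten_assoc)
  finally show ?case .
qed

lemma perm_swap:
  "distinct (xs @ ys) \<Longrightarrow> perm (xs @ ys) (ys @ xs) = \<c> (ty xs) (ty ys)"
proof (induction ys)
  case Nil then show ?case by simp
next
  case (Cons y ys)
  then have [simp]: "y \<notin> set xs" "y \<notin> set ys" by auto
  have "perm (xs @ y # ys) ((y # ys) @ xs) = (\<I> (tw y) \<otimes> \<c> (ty xs) (ty ys)) \<cdot> (\<c> (ty xs) (tw y) \<otimes> \<I> (ty ys))"
    using Cons by (simp add: front_middle)
  then show ?case by (simp add: Sym_hexagon)
qed

lemma front_map: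
  "inj_on r (set xs) \<Longrightarrow> x \<in> set xs \<Longrightarrow> \<forall>y\<in>set xs. fst (r y) = fst y \<Longrightarrow> distinct xs \<Longrightarrow>
     front (r x) (map r xs) = front x xs \<and> removeAll (r x) (map r xs) = map r (removeAll x xs)"
proof (induction xs)
  case Nil then show ?case by simp
next
  case (Cons y xs)
  have m: "map (\<lambda>x. fst (r x)) xs = map fst xs" using Cons.prems by auto
  show ?case
  proof (cases "x = y")
    case True
    then have "x \<notin> set xs" "r x \<notin> r ` set xs" using Cons.prems by (auto simp: inj_on_def)
    then have "removeAll (r x) (map r xs) = map r xs" by (intro removeAll_id) auto
    then show ?thesis using True Cons.prems by (simp add: comp_def m)
  next
    case False
    then have x: "x \<in> set xs" "r x \<noteq> r y" using Cons.prems by (auto simp: inj_on_def)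
    have IH: "front (r x) (map r xs) = front x xs \<and> removeAll (r x) (map r xs) = map r (removeAll x xs)"
      using Cons x by simp
    have m: "map (\<lambda>x. fst (r x)) (removeAll x xs) = map fst (removeAll x xs)"
      using Cons.prems by auto
    have "ty (map r (removeAll x xs)) = ty (removeAll x xs)"
      by (simp only: map_map comp_def m)
    then show ?thesis using IH False x Cons.prems by simp
  qed
qed

lemma perm_map:
  "inj_on r (set xs) \<Longrightarrow> same_wires xs ys \<Longrightarrow> \<forall>y\<in>set xs. fst (r y) = fst y \<Longrightarrow>
     perm (map r xs) (map r ys) = perm xs ys"
proof (induction ys arbitrary: xs)
  case Nil then show ?case by simp
next
  case (Cons y ys)
  note s = same_Cons[OF Cons.prems(2)]
  have "perm (map r (removeAll y xs)) (map r ys) = perm (removeAll y xs) ys"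
    using s Cons.prems by (intro Cons.IH) (auto simp: inj_on_def)
  then show ?case using front_map[of r xs y] s Cons.prems by simp
qed

end

section \<open>Straight-line programs\<close>

text \<open>
  A string diagram is presented as a straight-line program: each statement \<open>(g, is, os)\<close> applies the
  operation \<open>g\<close> to the wires \<open>is\<close> and names the results \<open>os\<close>. Every wire is produced once and used
  once. The context of a statement is the list of wires that are available when it is executed.
\<close>

type_synonym ('g, 's) stmt = "'g \<times> 's wire list \<times> 's wire list"

primrec outs :: "('g, 's) stmt list \<Rightarrow> 's wire list" where
  "outs [] = []"
| "outs (st # S) = snd (snd st) @ outs S"

lemma outs_append [simp]: "outs (S @ T) = outs S @ outs T"
  by (induction S) auto

text \<open>\<open>flow din dout ctx S ys\<close>: started in the context \<open>ctx\<close>, the program \<open>S\<close> is well sorted, uses only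
  available wires, and ends with exactly the wires \<open>ys\<close>.\<close>

fun flow :: "('g \<Rightarrow> 's list) \<Rightarrow> ('g \<Rightarrow> 's list) \<Rightarrow> 's wire list \<Rightarrow> ('g, 's) stmt list \<Rightarrow> 's wire list \<Rightarrow> bool"
  where
  "flow din dout ctx [] ys \<longleftrightarrow> distinct ys \<and> set ys = set ctx"
| "flow din dout ctx ((g, is, os) # S) ys \<longleftrightarrow>
     map fst is = din g \<and> map fst os = dout g \<and> distinct is \<and> set is \<subseteq> set ctx \<and>
     flow din dout (os @ without ctx is) S ys"

lemma flow_cong: "set xs = set xs' \<Longrightarrow> flow din dout xs S ys = flow din dout xs' S ys"
proof (induction S arbitrary: xs xs')
  case Nil then show ?case by simp
next
  case (Cons st S)
  obtain g "is" os where st: "st = (g, is, os)" by (cases st)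
  have "flow din dout (os @ without xs is) S ys = flow din dout (os @ without xs' is) S ys"
    by (rule Cons.IH) (simp add: Cons.prems)
  then show ?case using Cons.prems by (simp add: st)
qed

text \<open>\<open>update r xs ys\<close> is the renaming that agrees with \<open>r\<close> except that it sends \<open>xs\<close> to \<open>ys\<close>.\<close>

fun update :: "('a \<Rightarrow> 'b) \<Rightarrow> 'a list \<Rightarrow> 'b list \<Rightarrow> 'a \<Rightarrow> 'b" where
  "update r (x # xs) (y # ys) = (update r xs ys)(x := y)"
| "update r _ _ = r"

lemma update_other: "x \<notin> set xs \<Longrightarrow> update r xs ys x = r x"
  by (induction r xs ys rule: update.induct) auto

lemma map_update [simp]:
  "distinct xs \<Longrightarrow> length xs = length ys \<Longrightarrow> map (update r xs ys) xs = ys"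
proof (induction r xs ys rule: update.induct)
  case (1 r x xs y ys)
  then have "map ((update r xs ys)(x := y)) xs = ys" by (simp del: fun_upd_apply)
  then show ?case by (simp only: update.simps list.map fun_upd_same)
qed auto

lemma map_update_other [simp]:
  "set zs \<inter> set xs = {} \<Longrightarrow> map (update r xs ys) zs = map r zs"
  by (induction zs) (auto simp: update_other)

text \<open>
  All ways of finding in a program a statement that applies \<open>g\<close> to \<open>is\<close> and that can be executed first:
  no statement before it uses any of its inputs. Each solution consists of the outputs of that
  statement and the rest of the program.
\<close>

fun pulls :: "'g \<Rightarrow> 's wire list \<Rightarrow> ('g, 's) stmt list \<Rightarrow> ('s wire list \<times> ('g, 's) stmt list) list" where
  "pulls g is [] = []"
| "pulls g is ((h, js, ps) # S) =
     (if g = h \<and> is = js then [(ps, S)] else []) @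
     (if \<forall>x\<in>set is. x \<notin> set js
      then map (\<lambda>(os, T). (os, (h, js, ps) # T)) (pulls g is S) else [])"

lemma pulls_sound:
  "(os, T) \<in> set (pulls g is S) \<Longrightarrow>
    \<exists>Q R. S = Q @ (g, is, os) # R \<and> T = Q @ R \<and> (\<forall>(h, js, ps)\<in>set Q. set is \<inter> set js = {})"
proof (induction S arbitrary: T)
  case Nil then show ?case by simp
next
  case (Cons st S)
  obtain h js ps where st: "st = (h, js, ps)" by (cases st)
  from Cons.prems consider "g = h" "is = js" "os = ps" "T = S"
    | T' where "(os, T') \<in> set (pulls g is S)" "T = st # T'" "set is \<inter> set js = {}"
    by (auto simp: st split: if_splits)
  then show ?case
  proof cases
    case 1 then show ?thesis unfolding st by (intro exI[of _ "[]"] exI[of _ S]) auto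
  next
    case 2
    from Cons.IH[OF 2(1)] obtain Q R where
      "S = Q @ (g, is, os) # R" "T' = Q @ R" "\<forall>(h, js, ps)\<in>set Q. set is \<inter> set js = {}" by blast
    then show ?thesis using 2 st by (intro exI[of _ "st # Q"] exI[of _ R]) auto
  qed
qed

text \<open>
  \<open>matches ys ys' S r S'\<close> searches for a renaming that extends \<open>r\<close> and identifies the program \<open>S\<close>
  with outputs \<open>ys\<close> with the program \<open>S'\<close> with outputs \<open>ys'\<close>, up to exchanging independent
  statements. The step for one candidate is the separate function \<open>attempt\<close>, which receives the
  recursive call unapplied: the simplifier would otherwise unfold that call under the binder.
\<close>

fun attempt :: "(('s wire \<Rightarrow> 's wire) \<Rightarrow> ('g, 's) stmt list \<Rightarrow> bool) \<Rightarrow> ('s wire \<Rightarrow> 's wire) \<Rightarrow> 's wire list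
    \<Rightarrow> 's wire list \<times> ('g, 's) stmt list \<Rightarrow> bool" where
  "attempt k r os (os', T) = k (update r os os') T"

primrec matches :: "'s wire list \<Rightarrow> 's wire list \<Rightarrow> ('g, 's) stmt list \<Rightarrow> ('s wire \<Rightarrow> 's wire)
    \<Rightarrow> ('g, 's) stmt list \<Rightarrow> bool" where
  "matches ys ys' [] r S' \<longleftrightarrow> S' = [] \<and> ys' = map r ys"
| "matches ys ys' (st # S) r S' \<longleftrightarrow>
     list_ex (attempt (matches ys ys' S) r (snd (snd st))) (pulls (fst st) (map r (fst (snd st))) S')"

context interpreted_signature
begin

text \<open>Well-formed programs never name two wires alike.\<close>

definition well_formed :: "'s wire list \<Rightarrow> ('g, 's) stmt list \<Rightarrow> 's wire list \<Rightarrow> bool" where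
  "well_formed xs S ys \<longleftrightarrow> distinct (xs @ outs S) \<and> flow din dout xs S ys"

text \<open>The arrow denoted by a program: each statement first permutes the context so that its inputs come
  first.\<close>

fun den :: "'s wire list \<Rightarrow> ('g, 's) stmt list \<Rightarrow> 's wire list \<Rightarrow> 'm" where
  "den xs [] ys = perm xs ys"
| "den xs ((g, is, os) # S) ys =
     den (os @ without xs is) S ys \<cdot> (gen g \<otimes> \<I> (ty (without xs is))) \<cdot> perm xs (is @ without xs is)"

lemma gen_typing [simp]:
  "gen g \<in> Arr C" "Dom C (gen g) = tensor C ob (din g)" "Cod C (gen g) = tensor C ob (dout g)"
  using gen_Hom by (auto simp: Hom_def)

lemma wf_Nil [simp]: "well_formed xs [] ys \<longleftrightarrow> same_wires xs ys"
  by (auto simp: well_formed_def same_wires_def)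

lemma wf_Cons: "well_formed xs ((g, is, os) # S) ys \<longleftrightarrow>
    map fst is = din g \<and> map fst os = dout g \<and> distinct is \<and> set is \<subseteq> set xs \<and>
    distinct (xs @ os @ outs S) \<and> well_formed (os @ without xs is) S ys"
  by (auto simp: well_formed_def)

lemma same_without: "distinct xs \<Longrightarrow> distinct is \<Longrightarrow> set is \<subseteq> set xs \<Longrightarrow> same_wires xs (is @ without xs is)"
  by (auto simp: same_wires_def)

lemma den_typing [simp]:
  "well_formed xs S ys \<Longrightarrow> den xs S ys \<in> Arr C \<and> Dom C (den xs S ys) = ty xs \<and> Cod C (den xs S ys) = ty ys"
proof (induction S arbitrary: xs)
  case Nil then show ?case by simp
next
  case (Cons st S)
  obtain g "is" os where st: "st = (g, is, os)" by (cases st)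
  have w: "well_formed xs ((g, is, os) # S) ys" using Cons.prems st by simp
  note w' = w[unfolded wf_Cons]
  have "den (os @ without xs is) S ys \<in> Arr C \<and> Dom C (den (os @ without xs is) S ys) = ty (os @ without xs is)
     \<and> Cod C (den (os @ without xs is) S ys) = ty ys"
    using Cons.IH w' by blast
  moreover have "same_wires xs (is @ without xs is)" using w' by (intro same_without) auto
  ultimately show ?case using w' by (simp add: st)
qed

lemma wf_same: "well_formed xs S ys \<Longrightarrow> same_wires xs' xs \<Longrightarrow> well_formed xs' S ys"
  using flow_cong[of xs' xs din dout S ys] by (auto simp: well_formed_def same_wires_def)

text \<open>The order of the wires in the initial context is immaterial.\<close>

lemma den_perm:
  "well_formed xs S ys \<Longrightarrow> same_wires xs' xs \<Longrightarrow> den xs S ys \<cdot> perm xs' xs = den xs' S ys"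
proof (induction S arbitrary: xs xs')
  case Nil then show ?case by (simp add: perm_perm)
next
  case (Cons st S)
  obtain g "is" os where st: "st = (g, is, os)" by (cases st)
  have w: "well_formed xs ((g, is, os) # S) ys" using Cons.prems st by simp
  have w2: "well_formed xs' ((g, is, os) # S) ys" using wf_same[OF w Cons.prems(2)] .
  note w' = w[unfolded wf_Cons] note w2' = w2[unfolded wf_Cons]
  let ?u = "without xs is" and ?u' = "without xs' is"
  have s: "same_wires xs (is @ ?u)" "same_wires xs' (is @ ?u')" "same_wires ?u' ?u" "distinct (is @ ?u')"
      "same_wires (is @ ?u') (is @ ?u)" "distinct (os @ ?u')" "same_wires (os @ ?u') (os @ ?u)"
    using w' w2' Cons.prems(2) by (auto simp: same_wires_def)
  have s': "same_wires xs' (is @ ?u)" using same_trans[OF Cons.prems(2) s(1)] .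
  have IH: "den (os @ ?u') S ys = den (os @ ?u) S ys \<cdot> (\<I> (ty os) \<otimes> perm ?u' ?u)"
    using Cons.IH[of "os @ ?u" "os @ ?u'"] w' s perm_prepend[of os ?u' ?u] by simp
  have p: "perm (is @ ?u') (is @ ?u) = \<I> (ty is) \<otimes> perm ?u' ?u"
    using perm_prepend s by simp
  have wd: "well_formed (os @ ?u) S ys" using w' by simp
  note dt = den_typing[OF wd]
  have g: "Dom C (gen g) = ty is" "Cod C (gen g) = ty os" using w' by simp_all
  note [simp del] = gen_typing(2,3)
  have "den xs' ((g, is, os) # S) ys
     = den (os @ ?u) S ys \<cdot> (\<I> (ty os) \<otimes> perm ?u' ?u) \<cdot> (gen g \<otimes> \<I> (ty ?u')) \<cdot> perm xs' (is @ ?u')"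
    using s dt g by (simp add: IH comp_assoc)
  also have "(\<I> (ty os) \<otimes> perm ?u' ?u) \<cdot> (gen g \<otimes> \<I> (ty ?u')) \<cdot> perm xs' (is @ ?u')
     = (gen g \<otimes> \<I> (ty ?u)) \<cdot> perm (is @ ?u') (is @ ?u) \<cdot> perm xs' (is @ ?u')"
    unfolding p using s g by (simp add: interchange3)
  also have "perm (is @ ?u') (is @ ?u) \<cdot> perm xs' (is @ ?u') = perm xs (is @ ?u) \<cdot> perm xs' xs"
    using s s' Cons.prems(2) by (simp add: perm_perm)
  also have "den (os @ ?u) S ys \<cdot> (gen g \<otimes> \<I> (ty ?u)) \<cdot> perm xs (is @ ?u) \<cdot> perm xs' xs
     = den xs ((g, is, os) # S) ys \<cdot> perm xs' xs"
    using s dt g Cons.prems(2) by (simp add: comp_assoc)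
  finally show ?case by (simp add: st)
qed

text \<open>A subprogram that leaves the wires \<open>us\<close> alone contributes its own denotation tensored with the
  identity on \<open>us\<close>.\<close>

lemma den_frame:
  assumes "well_formed as S1 bs" "well_formed (bs @ us) S2 ys" "distinct (as @ us @ outs S1 @ outs S2)"
  shows "well_formed (as @ us) (S1 @ S2) ys \<and>
    den (as @ us) (S1 @ S2) ys = den (bs @ us) S2 ys \<cdot> (den as S1 bs \<otimes> \<I> (ty us))"
  using assms
proof (induction S1 arbitrary: as)
  case Nil
  then have s: "same_wires (as @ us) (bs @ us)" "same_wires as bs" by (auto simp: same_wires_def)
  have "perm (as @ us) (bs @ us) = perm as bs \<otimes> \<I> (ty us)"
    using Nil s by (intro perm_append) auto
  then show ?case using Nil wf_same[of "bs @ us" S2 ys "as @ us"] s den_perm[of "bs @ us" S2 ys "as @ us"] by simp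
next
  case (Cons st S)
  obtain g "is" os where st: "st = (g, is, os)" by (cases st)
  have w: "well_formed as ((g, is, os) # S) bs" using Cons.prems st by simp
  note w' = w[unfolded wf_Cons]
  let ?u = "without as is"
  have u: "without (as @ us) is = ?u @ us"
    using w' Cons.prems by (auto simp: intro!: without_disjoint)
  have s: "same_wires as (is @ ?u)" using w' by (auto simp: same_wires_def)
  have IH: "well_formed ((os @ ?u) @ us) (S @ S2) ys \<and> den ((os @ ?u) @ us) (S @ S2) ys
     = den (bs @ us) S2 ys \<cdot> (den (os @ ?u) S bs \<otimes> \<I> (ty us))"
    using w' Cons.prems by (intro Cons.IH) (auto simp: st)
  have p: "perm (as @ us) ((is @ ?u) @ us) = perm as (is @ ?u) \<otimes> \<I> (ty us)"
    using s Cons.prems by (intro perm_append) auto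
  have g: "Dom C (gen g) = ty is" "Cod C (gen g) = ty os" using w' by simp_all
  have dt: "den (os @ ?u) S bs \<in> Arr C" "Dom C (den (os @ ?u) S bs) = ty (os @ ?u)" "Cod C (den (os @ ?u) S bs) = ty bs"
    "den (bs @ us) S2 ys \<in> Arr C" "Dom C (den (bs @ us) S2 ys) = ty (bs @ us)"
    using w' Cons.prems by (meson den_typing)+
  note [simp del] = gen_typing(2,3)
  have "well_formed (as @ us) ((g, is, os) # S @ S2) ys"
    unfolding wf_Cons u using w' IH Cons.prems by (auto simp: st)
  moreover have "den (as @ us) ((g, is, os) # S @ S2) ys
    = (den (bs @ us) S2 ys \<cdot> (den (os @ ?u) S bs \<otimes> \<I> (ty us))) \<cdot> (gen g \<otimes> \<I> (ty (?u @ us)))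
       \<cdot> (perm as (is @ ?u) \<otimes> \<I> (ty us))"
    using p u IH by simp
  moreover have "\<dots> = den (bs @ us) S2 ys \<cdot> ((den (os @ ?u) S bs \<cdot> (gen g \<otimes> \<I> (ty ?u)) \<cdot> perm as (is @ ?u)) \<otimes> \<I> (ty us))"
  proof -
    have "gen g \<otimes> \<I> (ty (?u @ us)) = (gen g \<otimes> \<I> (ty ?u)) \<otimes> \<I> (ty us)" by simp
    then show ?thesis using dt g s by (simp add: comp_assoc interchange del: Ten_assoc Ten_Id)
  qed
  ultimately show ?case by (simp add: st)
qed


lemma without_map:
  assumes "inj_on r (set xs)" "set ys \<subseteq> set xs"
  shows "without (map r xs) (map r ys) = map r (without xs ys)"
proof -
  have "r x \<in> r ` set ys \<longleftrightarrow> x \<in> set ys" if "x \<in> set xs" for x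
    using assms that by (meson inj_on_image_mem_iff)
  then show ?thesis unfolding without_def filter_map by (auto intro!: arg_cong[where f = "map r"] filter_cong)
qed

lemma perm_swap_append:
  assumes "distinct (xs @ ys @ us)"
  shows "perm (xs @ ys @ us) (ys @ xs @ us) = \<c> (ty xs) (ty ys) \<otimes> \<I> (ty us)"
proof -
  have "same_wires (xs @ ys) (ys @ xs)" using assms by (auto simp: same_wires_def)
  moreover have "set us \<inter> set (xs @ ys) = {}" "distinct (xs @ ys)" using assms by auto
  ultimately show ?thesis using perm_append[of "xs @ ys" "ys @ xs" us] perm_swap[of xs ys] assms by simp
qed

lemma den_two:
  assumes w: "well_formed (is1 @ is2 @ us) ((g1, is1, os1) # (g2, is2, os2) # S) ys"
  shows "den (is1 @ is2 @ us) ((g1, is1, os1) # (g2, is2, os2) # S) ys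
       = den (os1 @ os2 @ us) S ys \<cdot> (gen g1 \<otimes> gen g2 \<otimes> \<I> (ty us))"
    and "well_formed (os1 @ os2 @ us) S ys"
proof -
  have d: "distinct (is1 @ is2 @ us @ os1 @ os2 @ outs S)" using w by (auto simp: well_formed_def)
  then have d1: "distinct (is1 @ is2 @ us)" by auto
  have u1: "without (is1 @ is2 @ us) is1 = is2 @ us"
  proof -
    have "set (is2 @ us) \<inter> set is1 = {}" using d by auto
    then show ?thesis using without_disjoint[of "is2 @ us" is1] by simp
  qed
  have w1: "well_formed (os1 @ is2 @ us) ((g2, is2, os2) # S) ys"
    and g1: "map fst is1 = din g1" "map fst os1 = dout g1"
    using w unfolding wf_Cons u1 by auto
  have u2: "without (os1 @ is2 @ us) is2 = os1 @ us"
  proof -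
    have "set os1 \<inter> set is2 = {}" "set us \<inter> set is2 = {}" using d by auto
    then show ?thesis using without_disjoint[of us is2] without_disjoint[of os1 is2] by simp
  qed
  have w2: "well_formed (os2 @ os1 @ us) S ys" and g2: "map fst is2 = din g2" "map fst os2 = dout g2"
    using w1 unfolding wf_Cons u2 by auto
  have sm: "same_wires (os1 @ os2 @ us) (os2 @ os1 @ us)" using d by (auto simp: same_wires_def)
  show w3: "well_formed (os1 @ os2 @ us) S ys" using wf_same[OF w2 sm] .
  have p1: "perm (os1 @ is2 @ us) (is2 @ os1 @ us) = \<c> (ty os1) (ty is2) \<otimes> \<I> (ty us)"
    using d by (intro perm_swap_append) auto
  have p2: "perm (os1 @ os2 @ us) (os2 @ os1 @ us) = \<c> (ty os1) (ty os2) \<otimes> \<I> (ty us)"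
    using d by (intro perm_swap_append) auto
  have s: "den (os1 @ os2 @ us) S ys = den (os2 @ os1 @ us) S ys \<cdot> (\<c> (ty os1) (ty os2) \<otimes> \<I> (ty us))"
    using den_perm[OF w2 sm] unfolding p2 by simp
  define D where "D = den (os2 @ os1 @ us) S ys"
  have D: "D \<in> Arr C" "Dom C D = ty os2 \<odot> ty os1 \<odot> ty us"
    using den_typing[OF w2] by (simp_all add: D_def)
  have g: "Dom C (gen g1) = ty is1" "Cod C (gen g1) = ty os1" "Dom C (gen g2) = ty is2" "Cod C (gen g2) = ty os2"
    using g1 g2 by simp_all
  note [simp del] = gen_typing(2,3)
  have "den (is1 @ is2 @ us) ((g1, is1, os1) # (g2, is2, os2) # S) ys
     = (D \<cdot> (gen g2 \<otimes> \<I> (ty os1 \<odot> ty us)) \<cdot> (\<c> (ty os1) (ty is2) \<otimes> \<I> (ty us))) \<cdot> (gen g1 \<otimes> \<I> (ty is2 \<odot> ty us))"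
    using d by (simp add: u1 u2 D_def g p1 perm_id[OF d1] del: without_simps(4) perm_id)
  also have "\<dots> = D \<cdot> ((gen g2 \<otimes> \<I> (ty os1 \<odot> ty us)) \<cdot> (\<c> (ty os1) (ty is2) \<otimes> \<I> (ty us)) \<cdot> (gen g1 \<otimes> \<I> (ty is2 \<odot> ty us)))"
    using D g by (simp add: comp_assoc)
  also have "(gen g2 \<otimes> \<I> (ty os1 \<odot> ty us)) \<cdot> (\<c> (ty os1) (ty is2) \<otimes> \<I> (ty us)) \<cdot> (gen g1 \<otimes> \<I> (ty is2 \<odot> ty us))
    = ((gen g2 \<otimes> \<I> (ty os1)) \<cdot> \<c> (ty os1) (ty is2) \<cdot> (gen g1 \<otimes> \<I> (ty is2))) \<otimes> \<I> (ty us)"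
  proof -
    have e: "gen g2 \<otimes> \<I> (ty os1 \<odot> ty us) = (gen g2 \<otimes> \<I> (ty os1)) \<otimes> \<I> (ty us)"
      "gen g1 \<otimes> \<I> (ty is2 \<odot> ty us) = (gen g1 \<otimes> \<I> (ty is2)) \<otimes> \<I> (ty us)"
      by simp_all
    show ?thesis unfolding e using g by (simp add: interchange del: Ten_assoc Ten_Id)
  qed
  also have "\<c> (ty os1) (ty is2) \<cdot> (gen g1 \<otimes> \<I> (ty is2)) = (\<I> (ty is2) \<otimes> gen g1) \<cdot> \<c> (ty is1) (ty is2)"
    using g by (subst sym_nat) auto
  also have "(gen g2 \<otimes> \<I> (ty os1)) \<cdot> (\<I> (ty is2) \<otimes> gen g1) \<cdot> \<c> (ty is1) (ty is2) = \<c> (ty os1) (ty os2) \<cdot> (gen g1 \<otimes> gen g2)"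
    using g by (simp add: interchange3 sym_nat)
  also have "(\<c> (ty os1) (ty os2) \<cdot> (gen g1 \<otimes> gen g2)) \<otimes> \<I> (ty us) = (\<c> (ty os1) (ty os2) \<otimes> \<I> (ty us)) \<cdot> ((gen g1 \<otimes> gen g2) \<otimes> \<I> (ty us))"
    using g by (simp add: interchange del: Ten_assoc)
  also have "D \<cdot> \<dots> = den (os1 @ os2 @ us) S ys \<cdot> (gen g1 \<otimes> gen g2 \<otimes> \<I> (ty us))"
    unfolding s using D g by (simp add: D_def comp_assoc)
  finally show "den (is1 @ is2 @ us) ((g1, is1, os1) # (g2, is2, os2) # S) ys
       = den (os1 @ os2 @ us) S ys \<cdot> (gen g1 \<otimes> gen g2 \<otimes> \<I> (ty us))" .
qed

lemma wf_swap:
  assumes w: "well_formed xs ((g1, is1, os1) # (g2, is2, os2) # S) ys" and i: "set is2 \<subseteq> set xs" "set is2 \<inter> set is1 = {}"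
  shows "well_formed xs ((g2, is2, os2) # (g1, is1, os1) # S) ys"
proof -
  have "set (os2 @ without (os1 @ without xs is1) is2) = set (os1 @ without (os2 @ without xs is2) is1)"
    using w i by (auto simp: well_formed_def)
  from flow_cong[OF this] have "flow din dout (os2 @ without (os1 @ without xs is1) is2) S ys
    = flow din dout (os1 @ without (os2 @ without xs is2) is1) S ys" .
  then show ?thesis using w i by (auto simp: well_formed_def simp del: without_simps(4))
qed

text \<open>Independent statements may be exchanged.\<close>

lemma den_swap:
  assumes w: "well_formed xs ((g1, is1, os1) # (g2, is2, os2) # S) ys" and i: "set is2 \<subseteq> set xs" "set is2 \<inter> set is1 = {}"
  shows "den xs ((g2, is2, os2) # (g1, is1, os1) # S) ys = den xs ((g1, is1, os1) # (g2, is2, os2) # S) ys"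
proof -
  let ?S1 = "(g1, is1, os1) # (g2, is2, os2) # S" and ?S2 = "(g2, is2, os2) # (g1, is1, os1) # S"
  define us where "us = without xs (is1 @ is2)"
  have d: "distinct xs" "distinct (os1 @ os2)" "set xs \<inter> set os1 = {}" "set xs \<inter> set os2 = {}"
     "distinct is1" "distinct is2" "set is1 \<subseteq> set xs" 
    using w by (auto simp: well_formed_def)
  have s1: "same_wires xs (is1 @ is2 @ us)" and s2: "same_wires xs (is2 @ is1 @ us)"
    using i d by (auto simp: same_wires_def us_def)
  have s3: "same_wires (is1 @ is2 @ us) (is2 @ is1 @ us)" using same_trans[OF same_sym[OF s1] s2] .
  have so: "same_wires (os1 @ os2 @ us) (os2 @ os1 @ us)" using d by (auto simp: same_wires_def us_def)
  note w1 = wf_same[OF w same_sym[OF s1]]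
  note w2 = wf_same[OF wf_swap[OF w i] same_sym[OF s2]]
  have g: "Dom C (gen g1) = ty is1" "Cod C (gen g1) = ty os1" "Dom C (gen g2) = ty is2" "Cod C (gen g2) = ty os2"
    using w by (auto simp: wf_Cons)
  note t1 = den_typing[OF den_two(2)[OF w1]] and t2 = den_typing[OF den_two(2)[OF w2]]
  note [simp del] = gen_typing(2,3)
  have p: "perm (is1 @ is2 @ us) (is2 @ is1 @ us) = \<c> (ty is1) (ty is2) \<otimes> \<I> (ty us)"
    "perm (os1 @ os2 @ us) (os2 @ os1 @ us) = \<c> (ty os1) (ty os2) \<otimes> \<I> (ty us)"
    using s1 so by (auto simp: same_wires_def intro!: perm_swap_append)
  have "den (is1 @ is2 @ us) ?S2 ys = den (is2 @ is1 @ us) ?S2 ys \<cdot> (\<c> (ty is1) (ty is2) \<otimes> \<I> (ty us))"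
    using den_perm[OF w2 s3] p by simp
  also have "\<dots> = den (os2 @ os1 @ us) S ys \<cdot> (gen g2 \<otimes> gen g1 \<otimes> \<I> (ty us)) \<cdot> (\<c> (ty is1) (ty is2) \<otimes> \<I> (ty us))"
    unfolding den_two(1)[OF w2] using t2 g by (simp add: comp_assoc)
  also have "(gen g2 \<otimes> gen g1 \<otimes> \<I> (ty us)) \<cdot> (\<c> (ty is1) (ty is2) \<otimes> \<I> (ty us))
     = ((gen g2 \<otimes> gen g1) \<cdot> \<c> (ty is1) (ty is2)) \<otimes> \<I> (ty us)"
    using g by (simp add: interchange del: Ten_assoc flip: Ten_assoc)
  also have "(gen g2 \<otimes> gen g1) \<cdot> \<c> (ty is1) (ty is2) = \<c> (ty os1) (ty os2) \<cdot> (gen g1 \<otimes> gen g2)"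
    using g by (simp add: sym_nat)
  also have "(\<c> (ty os1) (ty os2) \<cdot> (gen g1 \<otimes> gen g2)) \<otimes> \<I> (ty us)
     = (\<c> (ty os1) (ty os2) \<otimes> \<I> (ty us)) \<cdot> (gen g1 \<otimes> gen g2 \<otimes> \<I> (ty us))"
    using g by (simp add: interchange del: Ten_assoc flip: Ten_assoc)
  also have "den (os2 @ os1 @ us) S ys \<cdot> \<dots> = (den (os2 @ os1 @ us) S ys \<cdot> (\<c> (ty os1) (ty os2) \<otimes> \<I> (ty us)))
       \<cdot> (gen g1 \<otimes> gen g2 \<otimes> \<I> (ty us))"
    using t2 g by (simp add: comp_assoc)
  also have "den (os2 @ os1 @ us) S ys \<cdot> (\<c> (ty os1) (ty os2) \<otimes> \<I> (ty us)) = den (os1 @ os2 @ us) S ys"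
    using den_perm[OF den_two(2)[OF w2] so] p by simp
  also have "\<dots> \<cdot> (gen g1 \<otimes> gen g2 \<otimes> \<I> (ty us)) = den (is1 @ is2 @ us) ?S1 ys"
    using den_two(1)[OF w1] by simp
  finally have "den (is1 @ is2 @ us) ?S2 ys = den (is1 @ is2 @ us) ?S1 ys" .
  then show ?thesis
    using den_perm[OF w1 s1] den_perm[OF wf_same[OF wf_swap[OF w i] same_sym[OF s1]] s1] by simp
qed

lemma den_move:
  assumes "well_formed xs (Q @ (g, is, os) # R) ys" "set is \<subseteq> set xs" "\<forall>(h, js, ps)\<in>set Q. set is \<inter> set js = {}"
  shows "well_formed xs ((g, is, os) # Q @ R) ys \<and> den xs ((g, is, os) # Q @ R) ys = den xs (Q @ (g, is, os) # R) ys"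
  using assms
proof (induction Q arbitrary: xs)
  case Nil then show ?case by simp
next
  case (Cons st Q)
  obtain h js ps where st: "st = (h, js, ps)" by (cases st)
  let ?xs = "ps @ without xs js"
  have w: "well_formed xs ((h, js, ps) # Q @ (g, is, os) # R) ys" using Cons.prems st by simp
  have IH: "well_formed ?xs ((g, is, os) # Q @ R) ys \<and> den ?xs ((g, is, os) # Q @ R) ys = den ?xs (Q @ (g, is, os) # R) ys"
    using Cons.prems w by (intro Cons.IH) (auto simp: st wf_Cons)
  have w': "well_formed xs ((h, js, ps) # (g, is, os) # Q @ R) ys"
    using w IH by (auto simp: wf_Cons)
  have e: "den xs ((h, js, ps) # (g, is, os) # Q @ R) ys = den xs ((h, js, ps) # Q @ (g, is, os) # R) ys"
    using IH by (subst (1 2) den.simps(2)) simp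
  have "set is \<inter> set js = {}" using Cons.prems st by auto
  then have "well_formed xs ((g, is, os) # (h, js, ps) # Q @ R) ys \<and>
    den xs ((g, is, os) # (h, js, ps) # Q @ R) ys = den xs ((h, js, ps) # (g, is, os) # Q @ R) ys"
    using wf_swap[OF w'] den_swap[OF w'] Cons.prems by simp
  then show ?case using e st by simp
qed

lemma matches_sound:
  "matches ys ys' S r S' \<Longrightarrow> well_formed xs S ys \<Longrightarrow> well_formed (map r xs) S' ys' \<Longrightarrow> \<forall>x\<in>set xs. fst (r x) = fst x \<Longrightarrow>
     den xs S ys = den (map r xs) S' ys'"
proof (induction S arbitrary: xs r S')
  case Nil
  then have "inj_on r (set xs)" by (auto simp: well_formed_def distinct_map)
  then show ?case using Nil by (simp add: perm_map)
next
  case (Cons st S)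
  obtain g "is" os where st: "st = (g, is, os)" by (cases st)
  from Cons.prems(1) obtain os' T where p: "(os', T) \<in> set (pulls g (map r is) S')"
    and m: "matches ys ys' S (update r os os') T"
    by (auto simp: list_ex_iff st)
  from pulls_sound[OF p] obtain Q R where Q: "S' = Q @ (g, map r is, os') # R" "T = Q @ R"
    "\<forall>(h, js, ps)\<in>set Q. set (map r is) \<inter> set js = {}" by blast
  note w = Cons.prems(2)[unfolded st wf_Cons]
  have "set (map r is) \<subseteq> set (map r xs)" using w by auto
  from den_move[OF Cons.prems(3)[unfolded Q(1)] this Q(3)]
  have w2: "well_formed (map r xs) ((g, map r is, os') # T) ys'"
    and d2: "den (map r xs) ((g, map r is, os') # T) ys' = den (map r xs) S' ys'"
    using Q by auto
  note w2' = w2[unfolded wf_Cons]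
  have inj: "inj_on r (set xs)" using w2' by (auto simp: distinct_map)
  have wo: "without (map r xs) (map r is) = map r (without xs is)"
    using without_map inj w by blast
  let ?r = "update r os os'"
  have dos: "distinct os" "length os = length os'"
    using w w2' by (auto dest!: arg_cong[where f = length])
  have dis: "set os \<inter> set xs = {}" using w by auto
  have mo: "map ?r os = os'" using dos by simp
  have mx: "map ?r (without xs is) = map r (without xs is)" using dis by (intro map_update_other) auto
  have fo: "\<forall>x\<in>set os. fst (?r x) = fst x"
  proof -
    have "map (\<lambda>x. fst (?r x)) os = map fst os'" by (subst mo[symmetric]) simp
    then have "map (\<lambda>x. fst (?r x)) os = map fst os" using w w2' by simp
    then show ?thesis by auto
  qed
  have "den (os @ without xs is) S ys = den (map ?r (os @ without xs is)) T ys'"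
  proof (rule Cons.IH[OF m])
    show "well_formed (os @ without xs is) S ys" using w by simp
    show "well_formed (map ?r (os @ without xs is)) T ys'" using w2' by (simp only: map_append wo mo mx)
    show "\<forall>x\<in>set (os @ without xs is). fst (?r x) = fst x"
      using fo dis Cons.prems(4) by (auto simp: update_other)
  qed
  then have D: "den (os @ without xs is) S ys = den (os' @ map r (without xs is)) T ys'" by (simp only: map_append mo mx)
  have pm: "perm (map r xs) (map r (is @ without xs is)) = perm xs (is @ without xs is)"
    using inj w Cons.prems(4) by (intro perm_map) (auto intro!: same_without)
  have "map (\<lambda>x. fst (r x)) (without xs is) = map fst (without xs is)" using Cons.prems(4) by auto
  then have tm: "ty (map r (without xs is)) = ty (without xs is)" by (simp only: map_map comp_def)
  have "den xs ((g, is, os) # S) ys = den (map r xs) ((g, map r is, os') # T) ys'"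
    using D pm tm by (simp add: wo)
  then show ?case using d2 by (simp add: st)
qed

end

section \<open>Diagrams with subdiagrams\<close>

text \<open>
  Diagrams are programs whose statements may apply whole diagrams: \<open>Lam xs b\<close> has inputs \<open>xs\<close>, and
  \<open>Bind os t is b\<close> applies \<open>t\<close> to \<open>is\<close>, names the results \<open>os\<close> and continues with \<open>b\<close>. Replacing a
  subdiagram by one with the same denotation is then a congruence, and equations that hold for
  purely structural reasons are established by the check \<open>coherent\<close>.
\<close>

datatype ('g, 's) tm = Gen 'g | Lam "'s wire list" "('g, 's) body"
  and ('g, 's) body = Ret "'s wire list" | Bind "'s wire list" "('g, 's) tm" "'s wire list" "('g, 's) body"

text \<open>The sorts of the outputs and of the inputs of a diagram.\<close>

primrec tout :: "('g \<Rightarrow> 's list) \<Rightarrow> ('g, 's) tm \<Rightarrow> 's list"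
  and bout :: "('g \<Rightarrow> 's list) \<Rightarrow> ('g, 's) body \<Rightarrow> 's list" where
  "tout dout (Gen g) = dout g"
| "tout dout (Lam xs b) = bout dout b"
| "bout dout (Ret ys) = map fst ys"
| "bout dout (Bind os t is b) = bout dout b"

fun tin :: "('g \<Rightarrow> 's list) \<Rightarrow> ('g, 's) tm \<Rightarrow> 's list" where
  "tin din (Gen g) = din g"
| "tin din (Lam xs b) = map fst xs"

text \<open>Well-typedness. Wires may be named again once they have been used.\<close>

primrec ok :: "('g \<Rightarrow> 's list) \<Rightarrow> ('g \<Rightarrow> 's list) \<Rightarrow> ('g, 's) tm \<Rightarrow> bool"
  and okb :: "('g \<Rightarrow> 's list) \<Rightarrow> ('g \<Rightarrow> 's list) \<Rightarrow> ('g, 's) body \<Rightarrow> 's wire list \<Rightarrow> bool" where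
  "ok din dout (Gen g) = True"
| "ok din dout (Lam xs b) = (distinct xs \<and> okb din dout b xs)"
| "okb din dout (Ret ys) ctx = (distinct ys \<and> set ys = set ctx)"
| "okb din dout (Bind os t is b) ctx = (ok din dout t \<and> map fst is = tin din t \<and> map fst os = tout dout t
     \<and> distinct is \<and> set is \<subseteq> set ctx \<and> distinct (os @ without ctx is) \<and> okb din dout b (os @ without ctx is))"

text \<open>Wires of the given sorts, numbered from \<open>n\<close>.\<close>

definition fresh :: "'s list \<Rightarrow> nat \<Rightarrow> 's wire list" where
  "fresh ss n = zip ss [n..<n + length ss]"

lemma fresh_simps [simp]:
  "map fst (fresh ss n) = ss" "length (fresh ss n) = length ss" "distinct (fresh ss n)"
  by (simp_all add: fresh_def distinct_zipI2)

lemma fresh_bounds: "x \<in> set (fresh ss n) \<Longrightarrow> n \<le> snd x \<and> snd x < n + length ss"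
  by (cases x) (auto simp: fresh_def dest!: set_zip_rightD)

text \<open>
  \<open>flat dout t xs n\<close> inlines all subdiagrams of \<open>t\<close>, applied to the wires \<open>xs\<close>, and numbers all new
  wires from \<open>n\<close> on. It returns the program, its output wires and the next unused number. As with
  \<open>attempt\<close>, the function \<open>after\<close> keeps the recursive call from being unfolded under a binder.
\<close>

fun after :: "(('s wire \<Rightarrow> 's wire) \<Rightarrow> nat \<Rightarrow> ('g, 's) stmt list \<times> 's wire list \<times> nat) \<Rightarrow> ('s wire \<Rightarrow> 's wire)
    \<Rightarrow> 's wire list \<Rightarrow> ('g, 's) stmt list \<times> 's wire list \<times> nat \<Rightarrow> ('g, 's) stmt list \<times> 's wire list \<times> nat" where
  "after k r os (S, ws, n) = map_prod ((@) S) id (k (update r os ws) n)"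

primrec flat :: "('g \<Rightarrow> 's list) \<Rightarrow> ('g, 's) tm \<Rightarrow> 's wire list \<Rightarrow> nat
      \<Rightarrow> ('g, 's) stmt list \<times> 's wire list \<times> nat"
  and flatb :: "('g \<Rightarrow> 's list) \<Rightarrow> ('g, 's) body \<Rightarrow> ('s wire \<Rightarrow> 's wire) \<Rightarrow> nat
      \<Rightarrow> ('g, 's) stmt list \<times> 's wire list \<times> nat" where
  "flat dout (Gen g) xs n = ([(g, xs, fresh (dout g) n)], fresh (dout g) n, n + length (dout g))"
| "flat dout (Lam zs b) xs n = flatb dout b (update id zs xs) n"
| "flatb dout (Ret ys) r n = ([], map r ys, n)"
| "flatb dout (Bind os t is b) r n = after (flatb dout b) r os (flat dout t (map r is) n)"

text \<open>Flattened diagrams are compared by their programs and output wires.\<close>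

fun same_graph :: "('g, 's) stmt list \<times> 's wire list \<times> nat \<Rightarrow> ('g, 's) stmt list \<times> 's wire list \<times> nat \<Rightarrow> bool" where
  "same_graph (S, ys, _) (S', ys', _) = matches ys ys' S id S'"

text \<open>Two diagrams are coherent if they are well typed and have the same wiring after inlining.\<close>

definition coherent :: "('g \<Rightarrow> 's list) \<Rightarrow> ('g \<Rightarrow> 's list) \<Rightarrow> ('g, 's) tm \<Rightarrow> ('g, 's) tm \<Rightarrow> bool" where
  "coherent din dout t u \<longleftrightarrow> ok din dout t \<and> ok din dout u \<and> tin din t = tin din u \<and>
     same_graph (flat dout t (fresh (tin din t) 0) (length (tin din t)))
       (flat dout u (fresh (tin din t) 0) (length (tin din t)))"

context interpreted_signature
begin

text \<open>The arrow denoted by a diagram.\<close>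

primrec sem :: "('g, 's) tm \<Rightarrow> 'm"
  and semb :: "('g, 's) body \<Rightarrow> 's wire list \<Rightarrow> 'm" where
  "sem (Gen g) = gen g"
| "sem (Lam xs b) = semb b xs"
| "semb (Ret ys) ctx = perm ctx ys"
| "semb (Bind os t is b) ctx = (semb b (os @ without ctx is) \<cdot> (sem t \<otimes> \<I> (ty (without ctx is)))
      \<cdot> perm ctx (is @ without ctx is))"

lemma sem_typing [simp]:
  "ok din dout t \<Longrightarrow> sem t \<in> Arr C \<and> Dom C (sem t) = tensor C ob (tin din t) \<and> Cod C (sem t) = tensor C ob (tout dout t)"
  "distinct xs \<Longrightarrow> okb din dout b xs \<Longrightarrow> semb b xs \<in> Arr C \<and> Dom C (semb b xs) = ty xs \<and> Cod C (semb b xs) = tensor C ob (bout dout b)"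
proof (induction t and b arbitrary: and xs rule: tm.induct body.induct)
  case (Gen g) then show ?case by simp
next
  case (Lam zs b) then show ?case by simp
next
  case (Ret ys)
  then have "same_wires xs ys" by (auto simp: same_wires_def)
  then show ?case by simp
next
  case (Bind os t "is" b)
  let ?u = "without xs is"
  have "same_wires xs (is @ ?u)" using Bind.prems by (intro same_without) auto
  moreover have "semb b (os @ ?u) \<in> Arr C \<and> Dom C (semb b (os @ ?u)) = ty (os @ ?u) \<and> Cod C (semb b (os @ ?u)) = tensor C ob (bout dout b)"
    using Bind.prems by (intro Bind.IH) auto
  ultimately show ?case using Bind by simp
qed

lemma wf_outputs:
  assumes "well_formed xs S ys"
  shows "distinct ys \<and> set ys \<subseteq> set xs \<union> set (outs S)"
  using assms
proof (induction S arbitrary: xs)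
  case Nil then show ?case by (auto simp: same_wires_def)
next
  case (Cons st S)
  obtain g "is" os where st: "st = (g, is, os)" by (cases st)
  have "well_formed (os @ without xs is) S ys" using Cons.prems by (simp add: st wf_Cons)
  from Cons.IH[OF this] have "distinct ys \<and> set ys \<subseteq> set (os @ without xs is) \<union> set (outs S)" .
  moreover have "set is \<subseteq> set xs" using Cons.prems by (simp add: st wf_Cons)
  ultimately show ?case by (auto simp: st)
qed

text \<open>The correctness of the result of flattening a diagram with denotation \<open>m\<close> and output sorts \<open>ss\<close>.\<close>

definition flat_ok where
  "flat_ok xs n ss m r \<longleftrightarrow> (case r of (S, ys, n') \<Rightarrow>
     n \<le> n' \<and> well_formed xs S ys \<and> (\<forall>x\<in>set (outs S). n \<le> snd x \<and> snd x < n') \<and> map fst ys = ss \<and> den xs S ys = m)"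

lemma flat_sound:
  "ok din dout t \<Longrightarrow> map fst xs = tin din t \<Longrightarrow> distinct xs \<Longrightarrow> \<forall>x\<in>set xs. snd x < n \<Longrightarrow>
     flat_ok xs n (tout dout t) (sem t) (flat dout t xs n)"
  "okb din dout b zs \<Longrightarrow> distinct zs \<Longrightarrow> inj_on r (set zs) \<Longrightarrow> \<forall>x\<in>set zs. fst (r x) = fst x \<and> snd (r x) < n \<Longrightarrow>
     flat_ok (map r zs) n (bout dout b) (semb b zs) (flatb dout b r n)"
proof (induction t and b arbitrary: xs n and zs r n rule: tm.induct body.induct)
  case (Gen g)
  let ?o = "fresh (dout g) n"
  have o: "\<forall>x\<in>set ?o. n \<le> snd x \<and> snd x < n + length (dout g)" using fresh_bounds by blast
  have d: "distinct (xs @ ?o)" using o Gen by fastforce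
  have "without xs xs = []" by simp
  then have "den xs [(g, xs, ?o)] ?o = gen g" using Gen by simp
  moreover have "well_formed xs [(g, xs, ?o)] ?o" using d Gen by (simp add: wf_Cons same_wires_def)
  ultimately show ?case using o by (simp add: flat_ok_def Let_def)
next
  case (Lam zs b)
  have l: "length zs = length xs" using Lam.prems(2) by (auto dest: arg_cong[where f = length])
  have m: "map (update id zs xs) zs = xs" using Lam l by simp
  have "inj_on (update id zs xs) (set zs)" using m Lam.prems(3) by (metis distinct_map)
  moreover have "\<forall>x\<in>set zs. fst (update id zs xs x) = fst x \<and> snd (update id zs xs x) < n"
  proof -
    have "map (\<lambda>x. fst (update id zs xs x)) zs = map fst xs" by (subst (2) m[symmetric]) simp
    then have "map (\<lambda>x. fst (update id zs xs x)) zs = map fst zs" using Lam.prems(2) by simp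
    moreover have "\<forall>x\<in>set zs. update id zs xs x \<in> set xs" by (subst (2) m[symmetric]) simp
    ultimately show ?thesis using Lam.prems(4) by auto
  qed
  ultimately have "flat_ok (map (update id zs xs) zs) n (bout dout b) (semb b zs) (flatb dout b (update id zs xs) n)"
    using Lam.prems(1) by (intro Lam.IH) auto
  then show ?case using m by simp
next
  case (Ret ys)
  have "same_wires zs ys" using Ret by (auto simp: same_wires_def)
  moreover have "same_wires (map r zs) (map r ys)" using Ret by (auto simp: same_wires_def distinct_map)
  moreover have "map (\<lambda>x. fst (r x)) ys = map fst ys" using Ret by auto
  ultimately show ?case using Ret perm_map[of r zs ys] by (auto simp: flat_ok_def comp_def)
next
  case (Bind os t "is" b)
  let ?u = "without zs is"
  have p: "ok din dout t" "map fst is = tin din t" "map fst os = tout dout t" "distinct is" "set is \<subseteq> set zs"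
    "distinct (os @ ?u)" "okb din dout b (os @ ?u)"
    using Bind.prems(1) by auto
  obtain S1 ws n1 where f1: "flat dout t (map r is) n = (S1, ws, n1)" by (metis prod_cases3)
  obtain S2 ys n2 where f2: "flatb dout b (update r os ws) n1 = (S2, ys, n2)" by (metis prod_cases3)
  have mi: "map (\<lambda>x. fst (r x)) is = map fst is" using p(5) Bind.prems(4) by auto
  have dm: "distinct (map r (is @ ?u))"
  proof -
    have "set (is @ ?u) \<subseteq> set zs" using p(5) by auto
    with Bind.prems(3) have "inj_on r (set (is @ ?u))" by (rule inj_on_subset)
    moreover have "distinct (is @ ?u)" using p(4) Bind.prems(2) by auto
    ultimately show ?thesis by (simp only: distinct_map)
  qed
  have "flat_ok (map r is) n (tout dout t) (sem t) (S1, ws, n1)"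
    unfolding f1[symmetric]
  proof (rule Bind.IH(1)[OF p(1)])
    show "map fst (map r is) = tin din t" using p(2) mi by (simp add: comp_def)
    show "distinct (map r is)" using dm by simp
    show "\<forall>x\<in>set (map r is). snd x < n" using p(5) Bind.prems(4) by auto
  qed
  then have r1: "n \<le> n1" "well_formed (map r is) S1 ws" "\<forall>x\<in>set (outs S1). n \<le> snd x \<and> snd x < n1"
    "map fst ws = tout dout t" "den (map r is) S1 ws = sem t"
    by (auto simp: flat_ok_def)
  note wo = wf_outputs[OF r1(2)]
  let ?r = "update r os ws"
  have l: "length os = length ws" using p(3) r1(4) by (metis length_map)
  have mo: "map ?r os = ws" using p l by simp
  have mu: "map ?r ?u = map r ?u" using p by (intro map_update_other) auto
  have bu: "\<forall>x\<in>set (map r zs). snd x < n" using Bind.prems by auto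
  have wu: "set ws \<inter> set (map r ?u) = {}"
  proof -
    have "set (map r is) \<inter> set (map r ?u) = {}" using dm by simp
    moreover have "set (outs S1) \<inter> set (map r ?u) = {}" using r1(3) bu by fastforce
    ultimately show ?thesis using wo by blast
  qed
  have dw: "distinct (map ?r (os @ ?u))"
    unfolding map_append mo mu using wo wu dm by auto
  have bnd: "\<forall>x\<in>set (ws @ map r ?u). snd x < n1"
  proof
    fix x assume "x \<in> set (ws @ map r ?u)"
    moreover have "set (map r is) \<subseteq> set (map r zs)" "set (map r ?u) \<subseteq> set (map r zs)" using p(5) by auto
    ultimately have "x \<in> set (map r zs) \<or> x \<in> set (outs S1)" using wo unfolding set_append by blast
    then show "snd x < n1" using bu r1(1,3) by (meson order_less_le_trans)
  qed
  have fo: "\<forall>x\<in>set (os @ ?u). fst (?r x) = fst x \<and> snd (?r x) < n1"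
  proof -
    have "map (\<lambda>x. fst (?r x)) os = map fst ws" by (subst (2) mo[symmetric]) simp
    then have "map (\<lambda>x. fst (?r x)) os = map fst os" using p(3) r1(4) by simp
    moreover have "map (\<lambda>x. fst (?r x)) ?u = map fst ?u"
    proof -
      have "map fst (map ?r ?u) = map fst ?u" unfolding mu using Bind.prems(4) by auto
      then show ?thesis by (simp add: comp_def)
    qed
    moreover have "\<forall>x\<in>set (os @ ?u). snd (?r x) < n1"
    proof -
      have "set (map ?r (os @ ?u)) = set (ws @ map r ?u)" by (simp only: map_append mo mu)
      then show ?thesis using bnd by (metis image_eqI list.set_map)
    qed
    ultimately show ?thesis by auto
  qed
  have "flat_ok (map ?r (os @ ?u)) n1 (bout dout b) (semb b (os @ ?u)) (S2, ys, n2)"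
    unfolding f2[symmetric]
  proof (rule Bind.IH(2)[OF p(7) p(6) _ fo])
    show "inj_on ?r (set (os @ ?u))" using dw by (simp only: distinct_map)
  qed
  then have r2: "n1 \<le> n2" "well_formed (ws @ map r ?u) S2 ys" "\<forall>x\<in>set (outs S2). n1 \<le> snd x \<and> snd x < n2"
    "map fst ys = bout dout b" "den (ws @ map r ?u) S2 ys = semb b (os @ ?u)"
    unfolding map_append mo mu by (auto simp: flat_ok_def)
  have dd: "distinct (map r is @ map r ?u @ outs S1 @ outs S2)"
  proof -
    have "distinct (outs S1)" "distinct (outs S2)" using r1(2) r2(2) by (auto simp: well_formed_def)
    moreover have "set (map r (is @ ?u)) \<inter> set (outs S1 @ outs S2) = {}"
    proof -
      have "\<forall>x\<in>set (map r (is @ ?u)). snd x < n" using bu p(5) by auto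
      moreover have "\<forall>x\<in>set (outs S1 @ outs S2). n \<le> snd x" using r1 r2 by fastforce
      ultimately show ?thesis by fastforce
    qed
    moreover have "set (outs S1) \<inter> set (outs S2) = {}" using r1(3) r2(3) by fastforce
    ultimately show ?thesis using dm by auto
  qed
  note fr = den_frame[OF r1(2) r2(2) dd]
  have s0: "same_wires zs (is @ ?u)" using p Bind.prems by (intro same_without) auto
  have s: "same_wires (map r zs) (map r is @ map r ?u)"
    using s0 dm Bind.prems by (auto simp: same_wires_def distinct_map)
  have w: "well_formed (map r zs) (S1 @ S2) ys" using wf_same[OF conjunct1[OF fr] s] .
  have "perm (map r zs) (map r is @ map r ?u) = perm zs (is @ ?u)"
    using perm_map[OF Bind.prems(3) s0] Bind.prems(4) by simp
  then have "den (map r zs) (S1 @ S2) ys = den (map r is @ map r ?u) (S1 @ S2) ys \<cdot> perm zs (is @ ?u)"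
    using den_perm[OF conjunct1[OF fr] s] by simp
  moreover have "ty (map r ?u) = ty ?u"
  proof -
    have "map (\<lambda>x. fst (r x)) ?u = map fst ?u" using Bind.prems(4) by auto
    then show ?thesis by (simp only: map_map comp_def)
  qed
  moreover have "sem t \<in> Arr C \<and> Dom C (sem t) = tensor C ob (tin din t) \<and> Cod C (sem t) = tensor C ob (tout dout t)"
     "semb b (os @ ?u) \<in> Arr C \<and> Dom C (semb b (os @ ?u)) = ty (os @ ?u) \<and> Cod C (semb b (os @ ?u)) = tensor C ob (bout dout b)"
    using sem_typing(1)[OF p(1)] sem_typing(2)[OF p(6,7)] by auto
  ultimately have "den (map r zs) (S1 @ S2) ys = semb (Bind os t is b) zs"
    using fr r1(5) r2(5) s0 p(2,3) by (simp add: comp_assoc)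
  then show ?case using f1 f2 w r1 r2 by (auto simp: flat_ok_def)
qed

text \<open>Coherence for symmetric monoidal categories, in the form that diagrams with the same wiring denote
  the same arrow. Closed instances of the premise are evaluated by \<open>code_simp\<close>.\<close>

theorem coherence:
  assumes "coherent din dout t u"
  shows "sem t = sem u"
proof -
  let ?xs = "fresh (tin din t) 0" and ?n = "length (tin din t)"
  obtain S ys m where f: "flat dout t ?xs ?n = (S, ys, m)" by (metis prod_cases3)
  obtain S' ys' m' where f': "flat dout u ?xs ?n = (S', ys', m')" by (metis prod_cases3)
  have c: "ok din dout t" "ok din dout u" "tin din t = tin din u" "matches ys ys' S id S'"
    using assms by (auto simp: coherent_def f f')
  have b: "\<forall>x\<in>set ?xs. snd x < ?n" using fresh_bounds by fastforce
  have "flat_ok ?xs ?n (tout dout t) (sem t) (S, ys, m)"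
    unfolding f[symmetric] by (rule flat_sound(1)[OF c(1)]) (use b in auto)
  moreover have "flat_ok ?xs ?n (tout dout u) (sem u) (S', ys', m')"
    unfolding f'[symmetric] by (rule flat_sound(1)[OF c(2)]) (use b c(3) in auto)
  ultimately show ?thesis using matches_sound[OF c(4), of ?xs] by (auto simp: flat_ok_def)
qed


lemma sem_Lam_cong: "semb b xs = semb b' xs \<Longrightarrow> sem (Lam xs b) = sem (Lam xs b')"
  by simp

lemma semb_Bind_cong:
  "sem t = sem t' \<Longrightarrow> semb b (os @ without ctx is) = semb b' (os @ without ctx is) \<Longrightarrow>
    semb (Bind os t is b) ctx = semb (Bind os t' is b') ctx"
  by simp

end

text \<open>Identities, symmetries, composites and tensor products as diagrams. The offsets in the tensor product
  keep the wires of its two factors apart.\<close>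

definition identity_tm :: "'s list \<Rightarrow> ('g, 's) tm" where
  "identity_tm ss = Lam (fresh ss 0) (Ret (fresh ss 0))"

definition swap_tm :: "'s list \<Rightarrow> 's list \<Rightarrow> ('g, 's) tm" where
  "swap_tm ss ts = (let xs = fresh ss 0; ys = fresh ts (length ss) in Lam (xs @ ys) (Ret (ys @ xs)))"

definition comp_tm :: "('g \<Rightarrow> 's list) \<Rightarrow> ('g \<Rightarrow> 's list) \<Rightarrow> ('g, 's) tm \<Rightarrow> ('g, 's) tm \<Rightarrow> ('g, 's) tm" where
  "comp_tm din dout u t = (let xs = fresh (tin din t) 0; ys = fresh (tout dout t) 0; zs = fresh (tout dout u) 0
     in Lam xs (Bind ys t xs (Bind zs u ys (Ret zs))))"

definition tensor_tm :: "('g \<Rightarrow> 's list) \<Rightarrow> ('g \<Rightarrow> 's list) \<Rightarrow> ('g, 's) tm \<Rightarrow> ('g, 's) tm \<Rightarrow> ('g, 's) tm" where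
  "tensor_tm din dout t u = (let xs = fresh (tin din t) 0; m = length (tin din t); us = fresh (tin din u) m;
     n = m + length (tin din u); ys = fresh (tout dout t) n; vs = fresh (tout dout u) (n + length (tout dout t))
     in Lam (xs @ us) (Bind ys t xs (Bind vs u us (Ret (ys @ vs)))))"

lemma fresh_disjoint: "m + length ss \<le> n \<Longrightarrow> set (fresh ss m) \<inter> set (fresh ts n) = {}"
proof -
  assume le: "m + length ss \<le> n"
  have False if "x \<in> set (fresh ss m)" "x \<in> set (fresh ts n)" for x
    using fresh_bounds[OF that(1)] fresh_bounds[OF that(2)] le by simp
  then show ?thesis by blast
qed

lemma without_append:
  assumes "set xs \<inter> set us = {}"
  shows "without (xs @ us) xs = us" "without (xs @ us) us = xs"
proof -
  have "without us xs = us" using assms by (intro without_disjoint) auto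
  then show "without (xs @ us) xs = us" by simp
  have "without xs us = xs" using assms by (intro without_disjoint) auto
  then show "without (xs @ us) us = xs" by simp
qed

lemma tm_types [simp]:
  "tin din (identity_tm ss) = ss" "tout dout (identity_tm ss) = ss" "ok din dout (identity_tm ss)"
  "tin din (swap_tm ss ts) = ss @ ts" "tout dout (swap_tm ss ts) = ts @ ss" "ok din dout (swap_tm ss ts)"
  "tin din (comp_tm din dout u t) = tin din t" "tout dout (comp_tm din dout u t) = tout dout u"
  "tin din (tensor_tm din dout t u) = tin din t @ tin din u"
  "tout dout (tensor_tm din dout t u) = tout dout t @ tout dout u"
  using fresh_disjoint[of 0 ss "length ss" ts]
  by (auto simp: identity_tm_def swap_tm_def comp_tm_def tensor_tm_def Let_def)

lemma ok_comp_tm [simp]: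
  "tin din u = tout dout t \<Longrightarrow> ok din dout t \<Longrightarrow> ok din dout u \<Longrightarrow> ok din dout (comp_tm din dout u t)"
  by (simp add: comp_tm_def Let_def)

lemma ok_tensor_tm [simp]:
  assumes "ok din dout t" "ok din dout u"
  shows "ok din dout (tensor_tm din dout t u)"
proof -
  let ?m = "length (tin din t)" let ?n = "?m + length (tin din u)"
  let ?xs = "fresh (tin din t) 0" and ?us = "fresh (tin din u) ?m" and ?ys = "fresh (tout dout t) ?n"
    and ?vs = "fresh (tout dout u) (?n + length (tout dout t))"
  have d: "set ?xs \<inter> set ?us = {}" "set ?us \<inter> set ?ys = {}" "set ?ys \<inter> set ?vs = {}"
    by (auto intro!: fresh_disjoint)
  have d': "set ?ys \<inter> set ?us = {}" using d by auto
  show ?thesis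
    using assms d d' unfolding tensor_tm_def Let_def ok.simps okb.simps without_append(1)[OF d(1)] without_append(2)[OF d'] by auto
qed

context interpreted_signature
begin

lemma sem_identity_tm [simp]: "sem (identity_tm ss) = \<I> (tensor C ob ss)"
  by (simp add: identity_tm_def)

lemma sem_swap_tm [simp]: "sem (swap_tm ss ts) = \<c> (tensor C ob ss) (tensor C ob ts)"
proof -
  have "set (fresh ss 0) \<inter> set (fresh ts (length ss)) = {}" by (intro fresh_disjoint) simp
  then show ?thesis by (simp add: swap_tm_def Let_def perm_swap)
qed

lemma sem_comp_tm [simp]:
  assumes "ok din dout t" "ok din dout u" "tin din u = tout dout t"
  shows "sem (comp_tm din dout u t) = sem u \<cdot> sem t"
  using assms sem_typing(1)[OF assms(1)] sem_typing(1)[OF assms(2)] by (simp add: comp_tm_def Let_def)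

lemma sem_tensor_tm [simp]:
  assumes "ok din dout t" "ok din dout u"
  shows "sem (tensor_tm din dout t u) = sem t \<otimes> sem u"
proof -
  let ?m = "length (tin din t)" let ?n = "?m + length (tin din u)"
  let ?xs = "fresh (tin din t) 0" and ?us = "fresh (tin din u) ?m" and ?ys = "fresh (tout dout t) ?n"
    and ?vs = "fresh (tout dout u) (?n + length (tout dout t))"
  have d: "set ?xs \<inter> set ?us = {}" "set ?us \<inter> set ?ys = {}" "set ?ys \<inter> set ?vs = {}"
    by (auto intro!: fresh_disjoint)
  have d': "set ?ys \<inter> set ?us = {}" "set ?vs \<inter> set ?ys = {}" using d by auto
  note t = sem_typing(1)[OF assms(1)] sem_typing(1)[OF assms(2)]
  have p: "perm (?xs @ ?us) (?xs @ ?us) = \<I> (ty (?xs @ ?us))" using d by simp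
  have p1: "perm (?ys @ ?us) (?us @ ?ys) = \<c> (ty ?ys) (ty ?us)" using d' by (intro perm_swap) simp
  have p2: "perm (?vs @ ?ys) (?ys @ ?vs) = \<c> (ty ?vs) (ty ?ys)" using d' by (intro perm_swap) simp
  have "sem (tensor_tm din dout t u) = (\<c> (ty ?vs) (ty ?ys) \<cdot> (sem u \<otimes> \<I> (ty ?ys)) \<cdot> \<c> (ty ?ys) (ty ?us))
     \<cdot> (sem t \<otimes> \<I> (ty ?us)) \<cdot> \<I> (ty (?xs @ ?us))"
    unfolding tensor_tm_def Let_def sem.simps semb.simps without_append(1)[OF d(1)] without_append(2)[OF d'(1)] p p1 p2 ..
  also have "(sem u \<otimes> \<I> (ty ?ys)) \<cdot> \<c> (ty ?ys) (ty ?us) = \<c> (ty ?ys) (ty ?vs) \<cdot> (\<I> (ty ?ys) \<otimes> sem u)"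
    using t by (simp add: sym_nat)
  also have "\<c> (ty ?vs) (ty ?ys) \<cdot> \<c> (ty ?ys) (ty ?vs) \<cdot> (\<I> (ty ?ys) \<otimes> sem u) = \<I> (ty ?ys) \<otimes> sem u"
  proof -
    have "\<c> (ty ?vs) (ty ?ys) \<cdot> \<c> (ty ?ys) (ty ?vs) \<cdot> (\<I> (ty ?ys) \<otimes> sem u)
      = (\<c> (ty ?vs) (ty ?ys) \<cdot> \<c> (ty ?ys) (ty ?vs)) \<cdot> (\<I> (ty ?ys) \<otimes> sem u)"
      using t by (simp add: comp_assoc del: Sym_Sym)
    then show ?thesis using t by simp
  qed
  finally show ?thesis using t by (simp add: interchange)
qed

end

section \<open>The signature of a crossed product\<close>

text \<open>
  Sorts for the weak Hopf algebra \<open>H\<close> and the algebra \<open>A\<close>; operations for their structure arrows, the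
  action \<open>\<phi>\<close>, the morphism \<open>\<sigma>\<close> and its convolution inverse \<open>\<tau>\<close>.
\<close>

datatype sort = SH | SA

datatype opn = EtaH | MuH | EpsH | DelH | EtaA | MuA | Act | Sig | Tau

primrec op_in :: "opn \<Rightarrow> sort list" where
  "op_in EtaH = []" | "op_in MuH = [SH, SH]" | "op_in EpsH = [SH]" | "op_in DelH = [SH]"
| "op_in EtaA = []" | "op_in MuA = [SA, SA]" | "op_in Act = [SH, SA]" | "op_in Sig = [SH, SH]"
| "op_in Tau = [SH, SH]"

primrec op_out :: "opn \<Rightarrow> sort list" where
  "op_out EtaH = [SH]" | "op_out MuH = [SH]" | "op_out EpsH = []" | "op_out DelH = [SH, SH]"
| "op_out EtaA = [SA]" | "op_out MuA = [SA]" | "op_out Act = [SA]" | "op_out Sig = [SA]"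
| "op_out Tau = [SA]"

type_synonym diagram = "(opn, sort) tm"

abbreviation h :: "nat \<Rightarrow> sort wire" where "h n \<equiv> (SH, n)"
abbreviation a :: "nat \<Rightarrow> sort wire" where "a n \<equiv> (SA, n)"

text \<open>\<open>os \<Leftarrow> t\<langle>is\<rangle>; b\<close> is read as: let \<open>os\<close> be the result of applying \<open>t\<close> to \<open>is\<close>, in \<open>b\<close>.\<close>

notation Bind ("(_ \<Leftarrow> _\<langle>_\<rangle>;/ _)" [61, 61, 61, 60] 60)

abbreviation comp_diagram :: "diagram \<Rightarrow> diagram \<Rightarrow> diagram" (infixr "\<circ>\<^sub>d" 65)
  where "u \<circ>\<^sub>d t \<equiv> comp_tm op_in op_out u t"

abbreviation tensor_diagram :: "diagram \<Rightarrow> diagram \<Rightarrow> diagram" (infixr "\<otimes>\<^sub>d" 70)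
  where "t \<otimes>\<^sub>d u \<equiv> tensor_tm op_in op_out t u"

abbreviation "etaH \<equiv> Gen EtaH :: diagram"
abbreviation "muH \<equiv> Gen MuH :: diagram"
abbreviation "epsH \<equiv> Gen EpsH :: diagram"
abbreviation "delH \<equiv> Gen DelH :: diagram"
abbreviation "etaA \<equiv> Gen EtaA :: diagram"
abbreviation "muA \<equiv> Gen MuA :: diagram"
abbreviation "act \<equiv> Gen Act :: diagram"
abbreviation "sig \<equiv> Gen Sig :: diagram"
abbreviation "tau \<equiv> Gen Tau :: diagram"
abbreviation "idH \<equiv> identity_tm [SH] :: diagram"
abbreviation "idA \<equiv> identity_tm [SA] :: diagram"

abbreviation "idHH \<equiv> identity_tm [SH, SH] :: diagram"
abbreviation "idAH \<equiv> identity_tm [SA, SH] :: diagram"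

text \<open>The coproduct of \<open>H\<^sup>2\<close>, and convolution of diagrams from \<open>H\<^sup>2\<close> to \<open>A\<close>.\<close>

definition delHH :: diagram where
  "delHH = (idH \<otimes>\<^sub>d swap_tm [SH] [SH] \<otimes>\<^sub>d idH) \<circ>\<^sub>d (delH \<otimes>\<^sub>d delH)"

definition conv :: "diagram \<Rightarrow> diagram \<Rightarrow> diagram" where
  "conv f g = muA \<circ>\<^sub>d (f \<otimes>\<^sub>d g) \<circ>\<^sub>d delHH"

text \<open>The morphisms \<open>u\<^sub>1\<close> and \<open>u\<^sub>2\<close>.\<close>

definition U1 :: diagram where
  "U1 = act \<circ>\<^sub>d (idH \<otimes>\<^sub>d etaA)"

definition U2 :: diagram where
  "U2 = act \<circ>\<^sub>d (muH \<otimes>\<^sub>d etaA)"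

text \<open>The quadruple \<open>(A, H, \<psi>\<^sub>H\<^sup>A, \<sigma>\<^sub>H\<^sup>A)\<close>, its product, and the preunit candidate \<open>\<nu>\<close>.\<close>

definition Psi :: diagram where
  "Psi = (act \<otimes>\<^sub>d idH) \<circ>\<^sub>d (idH \<otimes>\<^sub>d swap_tm [SH] [SA]) \<circ>\<^sub>d (delH \<otimes>\<^sub>d idA)"

definition SigmaHA :: diagram where
  "SigmaHA = (sig \<otimes>\<^sub>d muH) \<circ>\<^sub>d delHH"

definition Mul :: diagram where
  "Mul = (muA \<otimes>\<^sub>d idH) \<circ>\<^sub>d (muA \<otimes>\<^sub>d SigmaHA) \<circ>\<^sub>d (idA \<otimes>\<^sub>d Psi \<otimes>\<^sub>d idH)"

definition Nu :: diagram where
  "Nu = ((muA \<otimes>\<^sub>d idH) \<circ>\<^sub>d (idA \<otimes>\<^sub>d Psi) \<circ>\<^sub>d (idA \<otimes>\<^sub>d idH \<otimes>\<^sub>d etaA)) \<circ>\<^sub>d (etaA \<otimes>\<^sub>d etaH)"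

text \<open>The coproduct \<open>1\<^sub>1 \<otimes> 1\<^sub>2\<close> of the unit of \<open>H\<close>.\<close>

definition DelEta :: diagram where
  "DelEta = delH \<circ>\<^sub>d etaH"

text \<open>The restrictions \<open>\<sigma>(-, 1)\<close> and \<open>\<sigma>(1, -)\<close>.\<close>

definition SigR :: diagram where
  "SigR = sig \<circ>\<^sub>d (idH \<otimes>\<^sub>d etaH)"

definition SigL :: diagram where
  "SigL = sig \<circ>\<^sub>d (etaH \<otimes>\<^sub>d idH)"

text \<open>\<open>1\<^sub>1 \<otimes> (h 1\<^sub>2)\<^sub>1 \<otimes> (h 1\<^sub>2)\<^sub>2\<close> and \<open>1\<^sub>1 \<otimes> h\<^sub>1 1\<^sub>2 \<otimes> h\<^sub>2\<close>.\<close>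

definition ProdR :: diagram where
  "ProdR = Lam [h 0] (
      [h 1, h 2] \<Leftarrow> DelEta\<langle>[]\<rangle>;
      [h 3, h 4] \<Leftarrow> delH \<circ>\<^sub>d muH\<langle>[h 0, h 2]\<rangle>;
      Ret [h 1, h 3, h 4])"

definition FactorR :: diagram where
  "FactorR = Lam [h 0] (
      [h 1, h 2] \<Leftarrow> DelEta\<langle>[]\<rangle>;
      [h 3, h 4] \<Leftarrow> delH\<langle>[h 0]\<rangle>;
      [h 5] \<Leftarrow> muH\<langle>[h 3, h 2]\<rangle>;
      Ret [h 1, h 5, h 4])"

text \<open>\<open>1\<^sub>1 \<otimes> (1\<^sub>2 h)\<^sub>1 \<otimes> (1\<^sub>2 h)\<^sub>2\<close> and \<open>1\<^sub>1 \<otimes> 1\<^sub>2 h\<^sub>1 \<otimes> h\<^sub>2\<close>.\<close>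

definition ProdL :: diagram where
  "ProdL = Lam [h 0] (
      [h 1, h 2] \<Leftarrow> DelEta\<langle>[]\<rangle>;
      [h 3, h 4] \<Leftarrow> delH \<circ>\<^sub>d muH\<langle>[h 2, h 0]\<rangle>;
      Ret [h 1, h 3, h 4])"

definition FactorL :: diagram where
  "FactorL = Lam [h 0] (
      [h 1, h 2] \<Leftarrow> DelEta\<langle>[]\<rangle>;
      [h 3, h 4] \<Leftarrow> delH\<langle>[h 0]\<rangle>;
      [h 5] \<Leftarrow> muH\<langle>[h 2, h 3]\<rangle>;
      Ret [h 1, h 5, h 4])"

text \<open>\<open>(h\<^sub>1 \<cdot> u\<^sub>1(k\<^sub>1)) \<sigma>(h\<^sub>2, k\<^sub>2) \<otimes> h\<^sub>3 k\<^sub>3\<close>.\<close>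

definition Absorb :: diagram where
  "Absorb = (muA \<otimes>\<^sub>d idH) \<circ>\<^sub>d (idA \<otimes>\<^sub>d SigmaHA) \<circ>\<^sub>d (Psi \<otimes>\<^sub>d idH) \<circ>\<^sub>d (idH \<otimes>\<^sub>d ((U1 \<otimes>\<^sub>d idH) \<circ>\<^sub>d delH))"

text \<open>\<open>\<sigma>(h\<^sub>1, 1) u\<^sub>2(h\<^sub>2, 1\<^sub>1) \<otimes> 1\<^sub>2\<close>.\<close>

definition SigUnit :: diagram where
  "SigUnit = Lam [h 0] (
      [h 1, h 2] \<Leftarrow> delH\<langle>[h 0]\<rangle>;
      [a 0] \<Leftarrow> SigR\<langle>[h 1]\<rangle>;
      [h 3, h 4] \<Leftarrow> DelEta\<langle>[]\<rangle>;
      [a 1] \<Leftarrow> U2\<langle>[h 2, h 3]\<rangle>;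
      [a 2] \<Leftarrow> muA\<langle>[a 0, a 1]\<rangle>;
      Ret [a 2, h 4])"

text \<open>\<open>\<sigma>(h\<^sub>1, 1) \<sigma>(h\<^sub>2, 1\<^sub>1) \<otimes> 1\<^sub>2\<close>.\<close>

definition SigUnitTwice :: diagram where
  "SigUnitTwice = Lam [h 0] (
      [h 1, h 2] \<Leftarrow> delH\<langle>[h 0]\<rangle>;
      [a 0] \<Leftarrow> SigR\<langle>[h 1]\<rangle>;
      [h 4, h 5] \<Leftarrow> DelEta\<langle>[]\<rangle>;
      [a 1] \<Leftarrow> sig\<langle>[h 2, h 4]\<rangle>;
      [a 2] \<Leftarrow> muA\<langle>[a 0, a 1]\<rangle>;
      Ret [a 2, h 5])"

text \<open>The restriction of a map on \<open>A \<otimes> H\<close> to \<open>1 \<otimes> H\<close>, followed by the counit of \<open>H\<close>.\<close>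

definition Extract :: "diagram \<Rightarrow> diagram" where
  "Extract X = Lam [h 0] (
      [a 0] \<Leftarrow> etaA\<langle>[]\<rangle>;
      [a 1, h 1] \<Leftarrow> X\<langle>[a 0, h 0]\<rangle>;
      [] \<Leftarrow> epsH\<langle>[h 1]\<rangle>;
      Ret [a 1])"

section \<open>Crossed products over a weak Hopf algebra\<close>

text \<open>A weak module algebra over a weak Hopf algebra, and a morphism \<open>\<sigma>\<close> with a convolution inverse \<open>\<tau>\<close> relative to \<open>u\<^sub>2\<close>.\<close>

locale crossed_data = strict_symmetric_monoidal_category C
  for C :: "('o, 'm) smcat" (structure) +
  fixes H A :: 'o and \<eta>\<^sub>H \<mu>\<^sub>H \<epsilon>\<^sub>H \<delta>\<^sub>H \<eta>\<^sub>A \<mu>\<^sub>A \<phi> \<sigma> \<tau> :: 'm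
  assumes hopf: "weak_Hopf_algebra C H \<eta>\<^sub>H \<mu>\<^sub>H \<epsilon>\<^sub>H \<delta>\<^sub>H"
    and module: "weak_left_module_algebra C H \<eta>\<^sub>H \<mu>\<^sub>H \<epsilon>\<^sub>H \<delta>\<^sub>H A \<eta>\<^sub>A \<mu>\<^sub>A \<phi>"
    and \<sigma>_Hom: "\<sigma> \<in> Hom C (H \<odot> H) A" and \<tau>_Hom: "\<tau> \<in> Hom C (H \<odot> H) A"
    and \<sigma>\<tau>: "convolution C (tensor_comult C H \<delta>\<^sub>H H \<delta>\<^sub>H) \<mu>\<^sub>A \<sigma> \<tau> = u2 C \<mu>\<^sub>H \<eta>\<^sub>A \<phi>"
      "convolution C (tensor_comult C H \<delta>\<^sub>H H \<delta>\<^sub>H) \<mu>\<^sub>A \<tau> \<sigma> = u2 C \<mu>\<^sub>H \<eta>\<^sub>A \<phi>"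
      "convolution C (tensor_comult C H \<delta>\<^sub>H H \<delta>\<^sub>H) \<mu>\<^sub>A (convolution C (tensor_comult C H \<delta>\<^sub>H H \<delta>\<^sub>H) \<mu>\<^sub>A \<sigma> \<tau>) \<sigma> = \<sigma>"
begin

primrec interp_sort :: "sort \<Rightarrow> 'o" where
  "interp_sort SH = H" | "interp_sort SA = A"

primrec interp_op :: "opn \<Rightarrow> 'm" where
  "interp_op EtaH = \<eta>\<^sub>H" | "interp_op MuH = \<mu>\<^sub>H" | "interp_op EpsH = \<epsilon>\<^sub>H" | "interp_op DelH = \<delta>\<^sub>H"
| "interp_op EtaA = \<eta>\<^sub>A" | "interp_op MuA = \<mu>\<^sub>A" | "interp_op Act = \<phi>" | "interp_op Sig = \<sigma>"
| "interp_op Tau = \<tau>"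

lemma obj [simp]: "H \<in> Obj C" "A \<in> Obj C"
  using hopf module
  by (auto simp: weak_Hopf_algebra_def weak_left_module_algebra_def algebra_in_def)

sublocale interpreted_signature C interp_sort op_in op_out interp_op
proof
  show "interp_sort x \<in> Obj C" for x by (cases x) auto
  show "interp_op g \<in> Hom C (tensor C interp_sort (op_in g)) (tensor C interp_sort (op_out g))" for g
    using hopf module \<sigma>_Hom \<tau>_Hom
    by (cases g) (auto simp: weak_Hopf_algebra_def weak_left_module_algebra_def algebra_in_def coalgebra_in_def)
qed

abbreviation eqd (infix "\<approx>" 50) where "t \<approx> u \<equiv> sem t = sem u"

text \<open>
  Calculations below are chains \<open>X \<approx> ?c1 L1 \<approx> ?c1 R1 \<approx> ?c2 L2 \<approx> \<dots>\<close>, where each \<open>?ci\<close> is a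
  diagram with holes: a step from \<open>?ci\<close> to \<open>?cj\<close> redraws the same wiring, and a step from \<open>Li\<close> to
  \<open>Ri\<close> applies an equation inside the diagram. The comments give the equations in Sweedler notation,
  with \<open>h \<cdot> a\<close> for the action.
\<close>

lemmas program_congs = sem_Lam_cong semb_Bind_cong refl

lemma unitH: "muH \<circ>\<^sub>d (idH \<otimes>\<^sub>d etaH) \<approx> idH" "muH \<circ>\<^sub>d (etaH \<otimes>\<^sub>d idH) \<approx> idH"
  and assocH: "muH \<circ>\<^sub>d (idH \<otimes>\<^sub>d muH) \<approx> muH \<circ>\<^sub>d (muH \<otimes>\<^sub>d idH)"
  and counitH: "(idH \<otimes>\<^sub>d epsH) \<circ>\<^sub>d delH \<approx> idH"
  and coassocH: "(delH \<otimes>\<^sub>d idH) \<circ>\<^sub>d delH \<approx> (idH \<otimes>\<^sub>d delH) \<circ>\<^sub>d delH"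
  and delH_muH: "delH \<circ>\<^sub>d muH \<approx> (muH \<otimes>\<^sub>d muH) \<circ>\<^sub>d delHH"
  and delH_etaH: "(delH \<otimes>\<^sub>d idH) \<circ>\<^sub>d delH \<circ>\<^sub>d etaH \<approx> (idH \<otimes>\<^sub>d muH \<otimes>\<^sub>d idH) \<circ>\<^sub>d (delH \<otimes>\<^sub>d delH) \<circ>\<^sub>d (etaH \<otimes>\<^sub>d etaH)"
  using hopf by (simp_all add: weak_Hopf_algebra_def algebra_in_def coalgebra_in_def delHH_def tensor_comult_def)

lemma delH_etaH_op: "(delH \<otimes>\<^sub>d idH) \<circ>\<^sub>d delH \<circ>\<^sub>d etaH \<approx> (idH \<otimes>\<^sub>d (muH \<circ>\<^sub>d swap_tm [SH] [SH]) \<otimes>\<^sub>d idH) \<circ>\<^sub>d (delH \<otimes>\<^sub>d delH) \<circ>\<^sub>d (etaH \<otimes>\<^sub>d etaH)"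
proof -
  have "(\<delta>\<^sub>H \<otimes> \<I> H) \<cdot> \<delta>\<^sub>H \<cdot> \<eta>\<^sub>H = (\<I> H \<otimes> (\<mu>\<^sub>H \<cdot> \<c> H H) \<otimes> \<I> H) \<cdot> (\<delta>\<^sub>H \<otimes> \<delta>\<^sub>H) \<cdot> (\<eta>\<^sub>H \<otimes> \<eta>\<^sub>H)"
    using hopf unfolding weak_Hopf_algebra_def by blast
  then show ?thesis by simp
qed

lemma unitA: "muA \<circ>\<^sub>d (idA \<otimes>\<^sub>d etaA) \<approx> idA" "muA \<circ>\<^sub>d (etaA \<otimes>\<^sub>d idA) \<approx> idA"
  and assocA: "muA \<circ>\<^sub>d (idA \<otimes>\<^sub>d muA) \<approx> muA \<circ>\<^sub>d (muA \<otimes>\<^sub>d idA)"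
  and act_etaH: "act \<circ>\<^sub>d (etaH \<otimes>\<^sub>d idA) \<approx> idA"
  and act_muA: "act \<circ>\<^sub>d (idH \<otimes>\<^sub>d muA) \<approx>
     muA \<circ>\<^sub>d (act \<otimes>\<^sub>d act) \<circ>\<^sub>d (idH \<otimes>\<^sub>d swap_tm [SH] [SA] \<otimes>\<^sub>d idA) \<circ>\<^sub>d (delH \<otimes>\<^sub>d idA \<otimes>\<^sub>d idA)"
  and U2_act: "U2 \<approx> act \<circ>\<^sub>d (idH \<otimes>\<^sub>d U1)"
  using module by (simp_all add: weak_left_module_algebra_def algebra_in_def U1_def U2_def)

lemma sig_tau: "conv sig tau \<approx> U2" "conv tau sig \<approx> U2" "conv (conv sig tau) sig \<approx> sig"
  using \<sigma>\<tau> by (simp_all add: conv_def U2_def delHH_def convolution_def tensor_comult_def u2_def)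

subsection \<open>Coproducts of units and of products\<close>

lemma delHH_coassoc: "(delHH \<otimes>\<^sub>d idHH) \<circ>\<^sub>d delHH \<approx> (idHH \<otimes>\<^sub>d delHH) \<circ>\<^sub>d delHH"
proof -
  let ?c1 = "\<lambda>X Y. Lam [h 0, h 1] (
      [h 2, h 3, h 4] \<Leftarrow> X\<langle>[h 0]\<rangle>;
      [h 5, h 6, h 7] \<Leftarrow> Y\<langle>[h 1]\<rangle>;
      Ret [h 2, h 5, h 3, h 6, h 4, h 7])"
  have "(delHH \<otimes>\<^sub>d idHH) \<circ>\<^sub>d delHH \<approx> ?c1 ((delH \<otimes>\<^sub>d idH) \<circ>\<^sub>d delH) ((delH \<otimes>\<^sub>d idH) \<circ>\<^sub>d delH)"
    by (rule coherence) code_simp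
  also have "\<dots> = sem (?c1 ((idH \<otimes>\<^sub>d delH) \<circ>\<^sub>d delH) ((idH \<otimes>\<^sub>d delH) \<circ>\<^sub>d delH))"
    by (intro coassocH program_congs)
  also have "\<dots> = sem ((idHH \<otimes>\<^sub>d delHH) \<circ>\<^sub>d delHH)"
    by (rule coherence) code_simp
  finally show ?thesis .
qed

text \<open>The unit axioms of a weak bialgebra with the iterated coproduct bracketed to the right:
  \<open>1\<^sub>1 \<otimes> 1\<^sub>2 \<otimes> 1\<^sub>3 = 1\<^sub>1 \<otimes> 1\<^sub>2 1'\<^sub>1 \<otimes> 1'\<^sub>2\<close>.\<close>

lemma comult_unit: "(idH \<otimes>\<^sub>d delH) \<circ>\<^sub>d DelEta \<approx> (idH \<otimes>\<^sub>d muH \<otimes>\<^sub>d idH) \<circ>\<^sub>d (delH \<otimes>\<^sub>d delH) \<circ>\<^sub>d (etaH \<otimes>\<^sub>d etaH)"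
proof -
  let ?c1 = "\<lambda>X. Lam [] (
      [h 0] \<Leftarrow> etaH\<langle>[]\<rangle>;
      [h 1, h 2, h 3] \<Leftarrow> X\<langle>[h 0]\<rangle>;
      Ret [h 1, h 2, h 3])"
  let ?c2 = "\<lambda>X. Lam [] (
      [h 1, h 2, h 3] \<Leftarrow> X\<langle>[]\<rangle>;
      Ret [h 1, h 2, h 3])"
  have "(idH \<otimes>\<^sub>d delH) \<circ>\<^sub>d DelEta \<approx> ?c1 ((idH \<otimes>\<^sub>d delH) \<circ>\<^sub>d delH)"
    by (rule coherence) code_simp
  also have "\<dots> = sem (?c1 ((delH \<otimes>\<^sub>d idH) \<circ>\<^sub>d delH))"
    by (intro coassocH[symmetric] program_congs)
  also have "\<dots> = sem (?c2 ((delH \<otimes>\<^sub>d idH) \<circ>\<^sub>d delH \<circ>\<^sub>d etaH))"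
    by (rule coherence) code_simp
  also have "\<dots> = sem (?c2 ((idH \<otimes>\<^sub>d muH \<otimes>\<^sub>d idH) \<circ>\<^sub>d (delH \<otimes>\<^sub>d delH) \<circ>\<^sub>d (etaH \<otimes>\<^sub>d etaH)))"
    by (intro delH_etaH program_congs)
  also have "\<dots> = sem ((idH \<otimes>\<^sub>d muH \<otimes>\<^sub>d idH) \<circ>\<^sub>d (delH \<otimes>\<^sub>d delH) \<circ>\<^sub>d (etaH \<otimes>\<^sub>d etaH))"
    by (rule coherence) code_simp
  finally show ?thesis .
qed

text \<open>The opposite version, \<open>1\<^sub>1 \<otimes> 1\<^sub>2 \<otimes> 1\<^sub>3 = 1\<^sub>1 \<otimes> 1'\<^sub>1 1\<^sub>2 \<otimes> 1'\<^sub>2\<close>.\<close>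

lemma comult_unit_op: "(idH \<otimes>\<^sub>d delH) \<circ>\<^sub>d DelEta \<approx> (idH \<otimes>\<^sub>d (muH \<circ>\<^sub>d swap_tm [SH] [SH]) \<otimes>\<^sub>d idH) \<circ>\<^sub>d (delH \<otimes>\<^sub>d delH) \<circ>\<^sub>d (etaH \<otimes>\<^sub>d etaH)"
proof -
  let ?c1 = "\<lambda>X. Lam [] (
      [h 0] \<Leftarrow> etaH\<langle>[]\<rangle>;
      [h 1, h 2, h 3] \<Leftarrow> X\<langle>[h 0]\<rangle>;
      Ret [h 1, h 2, h 3])"
  let ?c2 = "\<lambda>X. Lam [] (
      [h 1, h 2, h 3] \<Leftarrow> X\<langle>[]\<rangle>;
      Ret [h 1, h 2, h 3])"
  have "(idH \<otimes>\<^sub>d delH) \<circ>\<^sub>d DelEta \<approx> ?c1 ((idH \<otimes>\<^sub>d delH) \<circ>\<^sub>d delH)"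
    by (rule coherence) code_simp
  also have "\<dots> = sem (?c1 ((delH \<otimes>\<^sub>d idH) \<circ>\<^sub>d delH))"
    by (intro coassocH[symmetric] program_congs)
  also have "\<dots> = sem (?c2 ((delH \<otimes>\<^sub>d idH) \<circ>\<^sub>d delH \<circ>\<^sub>d etaH))"
    by (rule coherence) code_simp
  also have "\<dots> = sem (?c2 ((idH \<otimes>\<^sub>d (muH \<circ>\<^sub>d swap_tm [SH] [SH]) \<otimes>\<^sub>d idH) \<circ>\<^sub>d (delH \<otimes>\<^sub>d delH) \<circ>\<^sub>d (etaH \<otimes>\<^sub>d etaH)))"
    by (intro delH_etaH_op program_congs)
  also have "\<dots> = sem ((idH \<otimes>\<^sub>d (muH \<circ>\<^sub>d swap_tm [SH] [SH]) \<otimes>\<^sub>d idH) \<circ>\<^sub>d (delH \<otimes>\<^sub>d delH) \<circ>\<^sub>d (etaH \<otimes>\<^sub>d etaH))"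
    by (rule coherence) code_simp
  finally show ?thesis .
qed

text \<open>\<open>1\<^sub>1 \<otimes> (h 1\<^sub>2)\<^sub>1 \<otimes> (h 1\<^sub>2)\<^sub>2 = 1\<^sub>1 \<otimes> h\<^sub>1 1\<^sub>2 \<otimes> h\<^sub>2\<close>. By multiplicativity of the coproduct the left side is
  \<open>1\<^sub>1 \<otimes> h\<^sub>1 1\<^sub>2 \<otimes> h\<^sub>2 1\<^sub>3 = 1\<^sub>1 \<otimes> h\<^sub>1 1'\<^sub>1 1\<^sub>2 \<otimes> h\<^sub>2 1'\<^sub>2\<close>, and \<open>h\<^sub>1 1'\<^sub>1 \<otimes> h\<^sub>2 1'\<^sub>2\<close> is the coproduct of \<open>h 1 = h\<close>.\<close>

lemma comult_prod_right: "ProdR \<approx> FactorR"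
proof -
  let ?c1 = "\<lambda>X. Lam [h 0] (
      [h 1, h 2] \<Leftarrow> DelEta\<langle>[]\<rangle>;
      [h 4, h 5] \<Leftarrow> X\<langle>[h 0, h 2]\<rangle>;
      Ret [h 1, h 4, h 5])"
  let ?c2 = "\<lambda>X. Lam [h 0] (
      [h 1, h 2] \<Leftarrow> delH\<langle>[h 0]\<rangle>;
      [h 3, h 4, h 5] \<Leftarrow> X\<langle>[]\<rangle>;
      [h 6] \<Leftarrow> muH\<langle>[h 1, h 4]\<rangle>;
      [h 7] \<Leftarrow> muH\<langle>[h 2, h 5]\<rangle>;
      Ret [h 3, h 6, h 7])"
  let ?c3 = "\<lambda>X. Lam [h 0] (
      [h 1, h 2] \<Leftarrow> delH\<langle>[h 0]\<rangle>;
      [h 3, h 4] \<Leftarrow> DelEta\<langle>[]\<rangle>;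
      [h 5, h 6] \<Leftarrow> DelEta\<langle>[]\<rangle>;
      [h 7] \<Leftarrow> X\<langle>[h 1, h 5, h 4]\<rangle>;
      [h 8] \<Leftarrow> muH\<langle>[h 2, h 6]\<rangle>;
      Ret [h 3, h 7, h 8])"
  let ?c4 = "\<lambda>X. Lam [h 0] (
      [h 1] \<Leftarrow> etaH\<langle>[]\<rangle>;
      [h 3, h 4] \<Leftarrow> DelEta\<langle>[]\<rangle>;
      [h 5, h 6] \<Leftarrow> X\<langle>[h 0, h 1]\<rangle>;
      [h 7] \<Leftarrow> muH\<langle>[h 5, h 4]\<rangle>;
      Ret [h 3, h 7, h 6])"
  let ?c5 = "\<lambda>X. Lam [h 0] (
      [h 1] \<Leftarrow> X\<langle>[h 0]\<rangle>;
      [h 2, h 3] \<Leftarrow> delH\<langle>[h 1]\<rangle>;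
      [h 4, h 5] \<Leftarrow> DelEta\<langle>[]\<rangle>;
      [h 6] \<Leftarrow> muH\<langle>[h 2, h 5]\<rangle>;
      Ret [h 4, h 6, h 3])"
  have "ProdR \<approx> ?c1 (delH \<circ>\<^sub>d muH)"
    by (rule coherence) code_simp
  also have "\<dots> = sem (?c1 ((muH \<otimes>\<^sub>d muH) \<circ>\<^sub>d delHH))"
    by (intro delH_muH program_congs)
  also have "\<dots> = sem (?c2 ((idH \<otimes>\<^sub>d delH) \<circ>\<^sub>d DelEta))"
    by (rule coherence) code_simp
  also have "\<dots> = sem (?c2 ((idH \<otimes>\<^sub>d (muH \<circ>\<^sub>d swap_tm [SH] [SH]) \<otimes>\<^sub>d idH) \<circ>\<^sub>d (delH \<otimes>\<^sub>d delH) \<circ>\<^sub>d (etaH \<otimes>\<^sub>d etaH)))"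
    by (intro comult_unit_op program_congs)
  also have "\<dots> = sem (?c3 (muH \<circ>\<^sub>d (idH \<otimes>\<^sub>d muH)))"
    by (rule coherence) code_simp
  also have "\<dots> = sem (?c3 (muH \<circ>\<^sub>d (muH \<otimes>\<^sub>d idH)))"
    by (intro assocH program_congs)
  also have "\<dots> = sem (?c4 ((muH \<otimes>\<^sub>d muH) \<circ>\<^sub>d delHH))"
    by (rule coherence) code_simp
  also have "\<dots> = sem (?c4 (delH \<circ>\<^sub>d muH))"
    by (intro delH_muH[symmetric] program_congs)
  also have "\<dots> = sem (?c5 (muH \<circ>\<^sub>d (idH \<otimes>\<^sub>d etaH)))"
    by (rule coherence) code_simp
  also have "\<dots> = sem (?c5 idH)"
    by (intro unitH program_congs)
  also have "\<dots> = sem FactorR"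
    by (rule coherence) code_simp
  finally show ?thesis .
qed

text \<open>\<open>1\<^sub>1 \<otimes> (1\<^sub>2 h)\<^sub>1 \<otimes> (1\<^sub>2 h)\<^sub>2 = 1\<^sub>1 \<otimes> 1\<^sub>2 h\<^sub>1 \<otimes> h\<^sub>2\<close>, in the same way from the other unit axiom.\<close>

lemma comult_prod_left: "ProdL \<approx> FactorL"
proof -
  let ?c1 = "\<lambda>X. Lam [h 0] (
      [h 1, h 2] \<Leftarrow> DelEta\<langle>[]\<rangle>;
      [h 4, h 5] \<Leftarrow> X\<langle>[h 2, h 0]\<rangle>;
      Ret [h 1, h 4, h 5])"
  let ?c2 = "\<lambda>X. Lam [h 0] (
      [h 1, h 2] \<Leftarrow> delH\<langle>[h 0]\<rangle>;
      [h 3, h 4, h 5] \<Leftarrow> X\<langle>[]\<rangle>;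
      [h 6] \<Leftarrow> muH\<langle>[h 4, h 1]\<rangle>;
      [h 7] \<Leftarrow> muH\<langle>[h 5, h 2]\<rangle>;
      Ret [h 3, h 6, h 7])"
  let ?c3 = "\<lambda>X. Lam [h 0] (
      [h 1, h 2] \<Leftarrow> delH\<langle>[h 0]\<rangle>;
      [h 3, h 4] \<Leftarrow> DelEta\<langle>[]\<rangle>;
      [h 5, h 6] \<Leftarrow> DelEta\<langle>[]\<rangle>;
      [h 7] \<Leftarrow> X\<langle>[h 4, h 5, h 1]\<rangle>;
      [h 8] \<Leftarrow> muH\<langle>[h 6, h 2]\<rangle>;
      Ret [h 3, h 7, h 8])"
  let ?c4 = "\<lambda>X. Lam [h 0] (
      [h 1] \<Leftarrow> etaH\<langle>[]\<rangle>;
      [h 3, h 4] \<Leftarrow> DelEta\<langle>[]\<rangle>;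
      [h 5, h 6] \<Leftarrow> X\<langle>[h 1, h 0]\<rangle>;
      [h 7] \<Leftarrow> muH\<langle>[h 4, h 5]\<rangle>;
      Ret [h 3, h 7, h 6])"
  let ?c5 = "\<lambda>X. Lam [h 0] (
      [h 1] \<Leftarrow> X\<langle>[h 0]\<rangle>;
      [h 2, h 3] \<Leftarrow> delH\<langle>[h 1]\<rangle>;
      [h 4, h 5] \<Leftarrow> DelEta\<langle>[]\<rangle>;
      [h 6] \<Leftarrow> muH\<langle>[h 5, h 2]\<rangle>;
      Ret [h 4, h 6, h 3])"
  have "ProdL \<approx> ?c1 (delH \<circ>\<^sub>d muH)"
    by (rule coherence) code_simp
  also have "\<dots> = sem (?c1 ((muH \<otimes>\<^sub>d muH) \<circ>\<^sub>d delHH))"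
    by (intro delH_muH program_congs)
  also have "\<dots> = sem (?c2 ((idH \<otimes>\<^sub>d delH) \<circ>\<^sub>d DelEta))"
    by (rule coherence) code_simp
  also have "\<dots> = sem (?c2 ((idH \<otimes>\<^sub>d muH \<otimes>\<^sub>d idH) \<circ>\<^sub>d (delH \<otimes>\<^sub>d delH) \<circ>\<^sub>d (etaH \<otimes>\<^sub>d etaH)))"
    by (intro comult_unit program_congs)
  also have "\<dots> = sem (?c3 (muH \<circ>\<^sub>d (muH \<otimes>\<^sub>d idH)))"
    by (rule coherence) code_simp
  also have "\<dots> = sem (?c3 (muH \<circ>\<^sub>d (idH \<otimes>\<^sub>d muH)))"
    by (intro assocH[symmetric] program_congs)
  also have "\<dots> = sem (?c4 ((muH \<otimes>\<^sub>d muH) \<circ>\<^sub>d delHH))"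
    by (rule coherence) code_simp
  also have "\<dots> = sem (?c4 (delH \<circ>\<^sub>d muH))"
    by (intro delH_muH[symmetric] program_congs)
  also have "\<dots> = sem (?c5 (muH \<circ>\<^sub>d (etaH \<otimes>\<^sub>d idH)))"
    by (rule coherence) code_simp
  also have "\<dots> = sem (?c5 idH)"
    by (intro unitH program_congs)
  also have "\<dots> = sem FactorL"
    by (rule coherence) code_simp
  finally show ?thesis .
qed

subsection \<open>Regular morphisms and the unit\<close>

text \<open>\<open>\<sigma> \<and> u\<^sub>2 = \<sigma> \<and> (\<tau> \<and> \<sigma>) = (\<sigma> \<and> \<tau>) \<and> \<sigma> = \<sigma>\<close>.\<close>

lemma sig_U2: "conv sig U2 \<approx> sig"
proof -
  let ?c1 = "\<lambda>X. Lam [h 0, h 1] (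
      [h 2, h 3, h 4, h 5] \<Leftarrow> delHH\<langle>[h 0, h 1]\<rangle>;
      [a 0] \<Leftarrow> sig\<langle>[h 2, h 3]\<rangle>;
      [a 1] \<Leftarrow> X\<langle>[h 4, h 5]\<rangle>;
      [a 2] \<Leftarrow> muA\<langle>[a 0, a 1]\<rangle>;
      Ret [a 2])"
  let ?c2 = "\<lambda>X Y. Lam [h 0, h 1] (
      [h 2, h 3, h 4, h 5, h 6, h 7] \<Leftarrow> X\<langle>[h 0, h 1]\<rangle>;
      [a 0] \<Leftarrow> sig\<langle>[h 2, h 3]\<rangle>;
      [a 1] \<Leftarrow> tau\<langle>[h 4, h 5]\<rangle>;
      [a 2] \<Leftarrow> sig\<langle>[h 6, h 7]\<rangle>;
      [a 3] \<Leftarrow> Y\<langle>[a 0, a 1, a 2]\<rangle>;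
      Ret [a 3])"
  let ?c3 = "\<lambda>X. Lam [h 0, h 1] (
      [a 0] \<Leftarrow> X\<langle>[h 0, h 1]\<rangle>;
      Ret [a 0])"
  have "conv sig U2 \<approx> ?c1 U2"
    by (rule coherence) code_simp
  also have "\<dots> = sem (?c1 (conv tau sig))"
    by (intro sig_tau(2)[symmetric] program_congs)
  also have "\<dots> = sem (?c2 ((idHH \<otimes>\<^sub>d delHH) \<circ>\<^sub>d delHH) (muA \<circ>\<^sub>d (idA \<otimes>\<^sub>d muA)))"
    by (rule coherence) code_simp
  also have "\<dots> = sem (?c2 ((delHH \<otimes>\<^sub>d idHH) \<circ>\<^sub>d delHH) (muA \<circ>\<^sub>d (muA \<otimes>\<^sub>d idA)))"
    by (intro delHH_coassoc[symmetric] assocA program_congs)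
  also have "\<dots> = sem (?c3 (conv (conv sig tau) sig))"
    by (rule coherence) code_simp
  also have "\<dots> = sem (?c3 sig)"
    by (intro sig_tau(3) program_congs)
  also have "\<dots> = sem sig"
    by (rule coherence) code_simp
  finally show ?thesis .
qed

lemma U2_sig: "conv U2 sig \<approx> sig"
proof -
  let ?c1 = "\<lambda>X. Lam [h 0, h 1] (
      [h 2, h 3, h 4, h 5] \<Leftarrow> delHH\<langle>[h 0, h 1]\<rangle>;
      [a 0] \<Leftarrow> X\<langle>[h 2, h 3]\<rangle>;
      [a 1] \<Leftarrow> sig\<langle>[h 4, h 5]\<rangle>;
      [a 2] \<Leftarrow> muA\<langle>[a 0, a 1]\<rangle>;
      Ret [a 2])"
  let ?c2 = "\<lambda>X. Lam [h 0, h 1] (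
      [a 0] \<Leftarrow> X\<langle>[h 0, h 1]\<rangle>;
      Ret [a 0])"
  have "conv U2 sig \<approx> ?c1 U2"
    by (rule coherence) code_simp
  also have "\<dots> = sem (?c1 (conv sig tau))"
    by (intro sig_tau(1)[symmetric] program_congs)
  also have "\<dots> = sem (?c2 (conv (conv sig tau) sig))"
    by (rule coherence) code_simp
  also have "\<dots> = sem (?c2 sig)"
    by (intro sig_tau(3) program_congs)
  also have "\<dots> = sem sig"
    by (rule coherence) code_simp
  finally show ?thesis .
qed

text \<open>\<open>\<sigma>(h\<^sub>1, 1\<^sub>1) \<otimes> h\<^sub>2 1\<^sub>2 = \<sigma>(h\<^sub>1, 1) \<otimes> h\<^sub>2\<close>, for every regular \<open>\<sigma>\<close>. The coproduct of the unit is not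
  \<open>1 \<otimes> 1\<close>, so this is not formal; writing \<open>\<sigma> = \<sigma> \<and> u\<^sub>2\<close> turns the two sides into
  \<open>\<sigma>(h\<^sub>1, 1\<^sub>1) u\<^sub>1((h\<^sub>2 1\<^sub>2)\<^sub>1) \<otimes> (h\<^sub>2 1\<^sub>2)\<^sub>2\<close> and \<open>\<sigma>(h\<^sub>1, 1\<^sub>1) u\<^sub>1(h\<^sub>2 1\<^sub>2) \<otimes> h\<^sub>3\<close>, where
  the lemma \<open>comult_prod_right\<close> applies.\<close>

lemma SigmaHA_unit_right: "SigmaHA \<circ>\<^sub>d (idH \<otimes>\<^sub>d etaH) \<approx> (SigR \<otimes>\<^sub>d idH) \<circ>\<^sub>d delH"
proof -
  let ?c1 = "\<lambda>X. Lam [h 0] (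
      [h 1] \<Leftarrow> etaH\<langle>[]\<rangle>;
      [h 2, h 3, h 4, h 5] \<Leftarrow> delHH\<langle>[h 0, h 1]\<rangle>;
      [a 0] \<Leftarrow> X\<langle>[h 2, h 3]\<rangle>;
      [h 6] \<Leftarrow> muH\<langle>[h 4, h 5]\<rangle>;
      Ret [a 0, h 6])"
  let ?c2 = "\<lambda>X. Lam [h 0] (
      [h 1] \<Leftarrow> etaH\<langle>[]\<rangle>;
      [h 2, h 3, h 4, h 5, h 6, h 7] \<Leftarrow> X\<langle>[h 0, h 1]\<rangle>;
      [a 0] \<Leftarrow> sig\<langle>[h 2, h 3]\<rangle>;
      [h 8] \<Leftarrow> muH\<langle>[h 4, h 5]\<rangle>;
      [h 9] \<Leftarrow> muH\<langle>[h 6, h 7]\<rangle>;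
      [a 1] \<Leftarrow> U1\<langle>[h 8]\<rangle>;
      [a 2] \<Leftarrow> muA\<langle>[a 0, a 1]\<rangle>;
      Ret [a 2, h 9])"
  let ?c3 = "\<lambda>X. Lam [h 0] (
      [h 1, h 2] \<Leftarrow> delH\<langle>[h 0]\<rangle>;
      [h 3, h 4] \<Leftarrow> DelEta\<langle>[]\<rangle>;
      [h 5, h 6] \<Leftarrow> X\<langle>[h 2, h 4]\<rangle>;
      [a 0] \<Leftarrow> sig\<langle>[h 1, h 3]\<rangle>;
      [a 1] \<Leftarrow> U1\<langle>[h 5]\<rangle>;
      [a 2] \<Leftarrow> muA\<langle>[a 0, a 1]\<rangle>;
      Ret [a 2, h 6])"
  let ?c4 = "\<lambda>X. Lam [h 0] (
      [h 1, h 2] \<Leftarrow> delH\<langle>[h 0]\<rangle>;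
      [h 4, h 5, h 6] \<Leftarrow> X\<langle>[h 2]\<rangle>;
      [a 0] \<Leftarrow> sig\<langle>[h 1, h 4]\<rangle>;
      [a 1] \<Leftarrow> U1\<langle>[h 5]\<rangle>;
      [a 2] \<Leftarrow> muA\<langle>[a 0, a 1]\<rangle>;
      Ret [a 2, h 6])"
  let ?c5 = "\<lambda>X. Lam [h 0] (
      [h 1, h 2, h 3] \<Leftarrow> X\<langle>[h 0]\<rangle>;
      [h 4, h 5] \<Leftarrow> DelEta\<langle>[]\<rangle>;
      [a 0] \<Leftarrow> sig\<langle>[h 1, h 4]\<rangle>;
      [h 6] \<Leftarrow> muH\<langle>[h 2, h 5]\<rangle>;
      [a 1] \<Leftarrow> U1\<langle>[h 6]\<rangle>;
      [a 2] \<Leftarrow> muA\<langle>[a 0, a 1]\<rangle>;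
      Ret [a 2, h 3])"
  let ?c6 = "\<lambda>X. Lam [h 0] (
      [h 1, h 2] \<Leftarrow> delH\<langle>[h 0]\<rangle>;
      [h 3] \<Leftarrow> etaH\<langle>[]\<rangle>;
      [a 0] \<Leftarrow> X\<langle>[h 1, h 3]\<rangle>;
      Ret [a 0, h 2])"
  have "SigmaHA \<circ>\<^sub>d (idH \<otimes>\<^sub>d etaH) \<approx> ?c1 sig"
    by (rule coherence) code_simp
  also have "\<dots> = sem (?c1 (conv sig U2))"
    by (intro sig_U2[symmetric] program_congs)
  also have "\<dots> = sem (?c2 ((delHH \<otimes>\<^sub>d idHH) \<circ>\<^sub>d delHH))"
    by (rule coherence) code_simp
  also have "\<dots> = sem (?c2 ((idHH \<otimes>\<^sub>d delHH) \<circ>\<^sub>d delHH))"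
    by (intro delHH_coassoc program_congs)
  also have "\<dots> = sem (?c3 ((muH \<otimes>\<^sub>d muH) \<circ>\<^sub>d delHH))"
    by (rule coherence) code_simp
  also have "\<dots> = sem (?c3 (delH \<circ>\<^sub>d muH))"
    by (intro delH_muH[symmetric] program_congs)
  also have "\<dots> = sem (?c4 ProdR)"
    by (rule coherence) code_simp
  also have "\<dots> = sem (?c4 FactorR)"
    by (intro comult_prod_right program_congs)
  also have "\<dots> = sem (?c5 ((idH \<otimes>\<^sub>d delH) \<circ>\<^sub>d delH))"
    by (rule coherence) code_simp
  also have "\<dots> = sem (?c5 ((delH \<otimes>\<^sub>d idH) \<circ>\<^sub>d delH))"
    by (intro coassocH[symmetric] program_congs)
  also have "\<dots> = sem (?c6 (conv sig U2))"
    by (rule coherence) code_simp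
  also have "\<dots> = sem (?c6 sig)"
    by (intro sig_U2 program_congs)
  also have "\<dots> = sem ((SigR \<otimes>\<^sub>d idH) \<circ>\<^sub>d delH)"
    by (rule coherence) code_simp
  finally show ?thesis .
qed

text \<open>The mirror image: \<open>\<sigma>(1\<^sub>1, h\<^sub>1) \<otimes> 1\<^sub>2 h\<^sub>2 = \<sigma>(1, h\<^sub>1) \<otimes> h\<^sub>2\<close>.\<close>

lemma SigmaHA_unit_left: "SigmaHA \<circ>\<^sub>d (etaH \<otimes>\<^sub>d idH) \<approx> (SigL \<otimes>\<^sub>d idH) \<circ>\<^sub>d delH"
proof -
  let ?c1 = "\<lambda>X. Lam [h 0] (
      [h 1] \<Leftarrow> etaH\<langle>[]\<rangle>;
      [h 2, h 3, h 4, h 5] \<Leftarrow> delHH\<langle>[h 1, h 0]\<rangle>;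
      [a 0] \<Leftarrow> X\<langle>[h 2, h 3]\<rangle>;
      [h 6] \<Leftarrow> muH\<langle>[h 4, h 5]\<rangle>;
      Ret [a 0, h 6])"
  let ?c2 = "\<lambda>X. Lam [h 0] (
      [h 1] \<Leftarrow> etaH\<langle>[]\<rangle>;
      [h 2, h 3, h 4, h 5, h 6, h 7] \<Leftarrow> X\<langle>[h 1, h 0]\<rangle>;
      [a 0] \<Leftarrow> sig\<langle>[h 2, h 3]\<rangle>;
      [h 8] \<Leftarrow> muH\<langle>[h 4, h 5]\<rangle>;
      [h 9] \<Leftarrow> muH\<langle>[h 6, h 7]\<rangle>;
      [a 1] \<Leftarrow> U1\<langle>[h 8]\<rangle>;
      [a 2] \<Leftarrow> muA\<langle>[a 0, a 1]\<rangle>;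
      Ret [a 2, h 9])"
  let ?c3 = "\<lambda>X. Lam [h 0] (
      [h 1, h 2] \<Leftarrow> delH\<langle>[h 0]\<rangle>;
      [h 3, h 4] \<Leftarrow> DelEta\<langle>[]\<rangle>;
      [h 5, h 6] \<Leftarrow> X\<langle>[h 4, h 2]\<rangle>;
      [a 0] \<Leftarrow> sig\<langle>[h 3, h 1]\<rangle>;
      [a 1] \<Leftarrow> U1\<langle>[h 5]\<rangle>;
      [a 2] \<Leftarrow> muA\<langle>[a 0, a 1]\<rangle>;
      Ret [a 2, h 6])"
  let ?c4 = "\<lambda>X. Lam [h 0] (
      [h 1, h 2] \<Leftarrow> delH\<langle>[h 0]\<rangle>;
      [h 4, h 5, h 6] \<Leftarrow> X\<langle>[h 2]\<rangle>;
      [a 0] \<Leftarrow> sig\<langle>[h 4, h 1]\<rangle>;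
      [a 1] \<Leftarrow> U1\<langle>[h 5]\<rangle>;
      [a 2] \<Leftarrow> muA\<langle>[a 0, a 1]\<rangle>;
      Ret [a 2, h 6])"
  let ?c5 = "\<lambda>X. Lam [h 0] (
      [h 1, h 2, h 3] \<Leftarrow> X\<langle>[h 0]\<rangle>;
      [h 4, h 5] \<Leftarrow> DelEta\<langle>[]\<rangle>;
      [a 0] \<Leftarrow> sig\<langle>[h 4, h 1]\<rangle>;
      [h 6] \<Leftarrow> muH\<langle>[h 5, h 2]\<rangle>;
      [a 1] \<Leftarrow> U1\<langle>[h 6]\<rangle>;
      [a 2] \<Leftarrow> muA\<langle>[a 0, a 1]\<rangle>;
      Ret [a 2, h 3])"
  let ?c6 = "\<lambda>X. Lam [h 0] (
      [h 1, h 2] \<Leftarrow> delH\<langle>[h 0]\<rangle>;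
      [h 3] \<Leftarrow> etaH\<langle>[]\<rangle>;
      [a 0] \<Leftarrow> X\<langle>[h 3, h 1]\<rangle>;
      Ret [a 0, h 2])"
  have "SigmaHA \<circ>\<^sub>d (etaH \<otimes>\<^sub>d idH) \<approx> ?c1 sig"
    by (rule coherence) code_simp
  also have "\<dots> = sem (?c1 (conv sig U2))"
    by (intro sig_U2[symmetric] program_congs)
  also have "\<dots> = sem (?c2 ((delHH \<otimes>\<^sub>d idHH) \<circ>\<^sub>d delHH))"
    by (rule coherence) code_simp
  also have "\<dots> = sem (?c2 ((idHH \<otimes>\<^sub>d delHH) \<circ>\<^sub>d delHH))"
    by (intro delHH_coassoc program_congs)
  also have "\<dots> = sem (?c3 ((muH \<otimes>\<^sub>d muH) \<circ>\<^sub>d delHH))"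
    by (rule coherence) code_simp
  also have "\<dots> = sem (?c3 (delH \<circ>\<^sub>d muH))"
    by (intro delH_muH[symmetric] program_congs)
  also have "\<dots> = sem (?c4 ProdL)"
    by (rule coherence) code_simp
  also have "\<dots> = sem (?c4 FactorL)"
    by (intro comult_prod_left program_congs)
  also have "\<dots> = sem (?c5 ((idH \<otimes>\<^sub>d delH) \<circ>\<^sub>d delH))"
    by (rule coherence) code_simp
  also have "\<dots> = sem (?c5 ((delH \<otimes>\<^sub>d idH) \<circ>\<^sub>d delH))"
    by (intro coassocH[symmetric] program_congs)
  also have "\<dots> = sem (?c6 (conv sig U2))"
    by (rule coherence) code_simp
  also have "\<dots> = sem (?c6 sig)"
    by (intro sig_U2 program_congs)
  also have "\<dots> = sem ((SigL \<otimes>\<^sub>d idH) \<circ>\<^sub>d delH)"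
    by (rule coherence) code_simp
  finally show ?thesis .
qed

subsection \<open>Multiplication by the preunit candidate\<close>

text \<open>\<open>(h\<^sub>1 \<cdot> u\<^sub>1(k\<^sub>1)) \<sigma>(h\<^sub>2, k\<^sub>2) \<otimes> h\<^sub>3 k\<^sub>3 = \<sigma>(h\<^sub>1, k\<^sub>1) \<otimes> h\<^sub>2 k\<^sub>2\<close>, since \<open>h \<cdot> u\<^sub>1(k) = u\<^sub>2(h, k)\<close> and
  \<open>u\<^sub>2 \<and> \<sigma> = \<sigma>\<close>.\<close>

lemma module_absorb: "Absorb \<approx> SigmaHA"
proof -
  let ?c1 = "\<lambda>X Y. Lam [h 0, h 1] (
      [h 2, h 3, h 4, h 5, h 6, h 7] \<Leftarrow> X\<langle>[h 0, h 1]\<rangle>;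
      [a 0] \<Leftarrow> Y\<langle>[h 2, h 3]\<rangle>;
      [a 1] \<Leftarrow> sig\<langle>[h 4, h 5]\<rangle>;
      [h 8] \<Leftarrow> muH\<langle>[h 6, h 7]\<rangle>;
      [a 2] \<Leftarrow> muA\<langle>[a 0, a 1]\<rangle>;
      Ret [a 2, h 8])"
  let ?c2 = "\<lambda>X. Lam [h 0, h 1] (
      [h 2, h 3, h 4, h 5] \<Leftarrow> delHH\<langle>[h 0, h 1]\<rangle>;
      [a 0] \<Leftarrow> X\<langle>[h 2, h 3]\<rangle>;
      [h 6] \<Leftarrow> muH\<langle>[h 4, h 5]\<rangle>;
      Ret [a 0, h 6])"
  have "Absorb \<approx> ?c1 ((idHH \<otimes>\<^sub>d delHH) \<circ>\<^sub>d delHH) (act \<circ>\<^sub>d (idH \<otimes>\<^sub>d U1))"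
    by (rule coherence) code_simp
  also have "\<dots> = sem (?c1 ((delHH \<otimes>\<^sub>d idHH) \<circ>\<^sub>d delHH) U2)"
    by (intro delHH_coassoc[symmetric] U2_act[symmetric] program_congs)
  also have "\<dots> = sem (?c2 (conv U2 sig))"
    by (rule coherence) code_simp
  also have "\<dots> = sem (?c2 sig)"
    by (intro U2_sig program_congs)
  also have "\<dots> = sem SigmaHA"
    by (rule coherence) code_simp
  finally show ?thesis .
qed

text \<open>\<open>\<nu> = u\<^sub>1(1\<^sub>1) \<otimes> 1\<^sub>2\<close>.\<close>

lemma Nu_eq: "Nu \<approx> (U1 \<otimes>\<^sub>d idH) \<circ>\<^sub>d DelEta"
proof -
  let ?c1 = "\<lambda>X. Lam [] (
      [h 0] \<Leftarrow> etaH\<langle>[]\<rangle>;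
      [h 1, h 2] \<Leftarrow> delH\<langle>[h 0]\<rangle>;
      [a 1] \<Leftarrow> U1\<langle>[h 1]\<rangle>;
      [a 0] \<Leftarrow> X\<langle>[a 1]\<rangle>;
      Ret [a 0, h 2])"
  have "Nu \<approx> ?c1 (muA \<circ>\<^sub>d (etaA \<otimes>\<^sub>d idA))"
    by (rule coherence) code_simp
  also have "\<dots> = sem (?c1 idA)"
    by (intro unitA program_congs)
  also have "\<dots> = sem ((U1 \<otimes>\<^sub>d idH) \<circ>\<^sub>d DelEta)"
    by (rule coherence) code_simp
  finally show ?thesis .
qed

text \<open>Right multiplication by \<open>\<nu>\<close> is \<open>a \<otimes> h \<mapsto> a \<sigma>(h\<^sub>1, 1) \<otimes> h\<^sub>2\<close>.\<close>

lemma Mul_Nu: "Mul \<circ>\<^sub>d (idAH \<otimes>\<^sub>d Nu) \<approx> (muA \<otimes>\<^sub>d idH) \<circ>\<^sub>d (idA \<otimes>\<^sub>d ((SigR \<otimes>\<^sub>d idH) \<circ>\<^sub>d delH))"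
proof -
  let ?c1 = "\<lambda>X. Lam [a 0, h 0] (
      [a 1, h 1] \<Leftarrow> X\<langle>[]\<rangle>;
      [a 2, h 2] \<Leftarrow> Mul\<langle>[a 0, h 0, a 1, h 1]\<rangle>;
      Ret [a 2, h 2])"
  let ?c2 = "\<lambda>X. Lam [a 0, h 0] (
      [h 1] \<Leftarrow> etaH\<langle>[]\<rangle>;
      [h 3, h 4] \<Leftarrow> delH\<langle>[h 1]\<rangle>;
      [a 1] \<Leftarrow> U1\<langle>[h 3]\<rangle>;
      [a 2, h 5] \<Leftarrow> Psi\<langle>[h 0, a 1]\<rangle>;
      [a 3, h 6] \<Leftarrow> SigmaHA\<langle>[h 5, h 4]\<rangle>;
      [a 4] \<Leftarrow> X\<langle>[a 0, a 2, a 3]\<rangle>;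
      Ret [a 4, h 6])"
  let ?c3 = "\<lambda>X. Lam [a 0, h 0] (
      [h 1] \<Leftarrow> etaH\<langle>[]\<rangle>;
      [a 1, h 2] \<Leftarrow> X\<langle>[h 0, h 1]\<rangle>;
      [a 2] \<Leftarrow> muA\<langle>[a 0, a 1]\<rangle>;
      Ret [a 2, h 2])"
  let ?c4 = "\<lambda>X. Lam [a 0, h 0] (
      [a 1, h 2] \<Leftarrow> X\<langle>[h 0]\<rangle>;
      [a 2] \<Leftarrow> muA\<langle>[a 0, a 1]\<rangle>;
      Ret [a 2, h 2])"
  have "Mul \<circ>\<^sub>d (idAH \<otimes>\<^sub>d Nu) \<approx> ?c1 Nu"
    by (rule coherence) code_simp
  also have "\<dots> = sem (?c1 ((U1 \<otimes>\<^sub>d idH) \<circ>\<^sub>d DelEta))"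
    by (intro Nu_eq program_congs)
  also have "\<dots> = sem (?c2 (muA \<circ>\<^sub>d (muA \<otimes>\<^sub>d idA)))"
    by (rule coherence) code_simp
  also have "\<dots> = sem (?c2 (muA \<circ>\<^sub>d (idA \<otimes>\<^sub>d muA)))"
    by (intro assocA[symmetric] program_congs)
  also have "\<dots> = sem (?c3 Absorb)"
    by (rule coherence) code_simp
  also have "\<dots> = sem (?c3 SigmaHA)"
    by (intro module_absorb program_congs)
  also have "\<dots> = sem (?c4 (SigmaHA \<circ>\<^sub>d (idH \<otimes>\<^sub>d etaH)))"
    by (rule coherence) code_simp
  also have "\<dots> = sem (?c4 ((SigR \<otimes>\<^sub>d idH) \<circ>\<^sub>d delH))"
    by (intro SigmaHA_unit_right program_congs)
  also have "\<dots> = sem ((muA \<otimes>\<^sub>d idH) \<circ>\<^sub>d (idA \<otimes>\<^sub>d ((SigR \<otimes>\<^sub>d idH) \<circ>\<^sub>d delH)))"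
    by (rule coherence) code_simp
  finally show ?thesis .
qed

text \<open>\<open>u\<^sub>1(h\<^sub>1) (h\<^sub>2 \<cdot> b) \<otimes> h\<^sub>3 = (h\<^sub>1 \<cdot> b) \<otimes> h\<^sub>2\<close>, from \<open>h \<cdot> (1 b) = (h\<^sub>1 \<cdot> 1) (h\<^sub>2 \<cdot> b)\<close>.\<close>

lemma U1_Psi: "(muA \<otimes>\<^sub>d idH) \<circ>\<^sub>d (idA \<otimes>\<^sub>d Psi) \<circ>\<^sub>d (((U1 \<otimes>\<^sub>d idH) \<circ>\<^sub>d delH) \<otimes>\<^sub>d idA) \<approx> Psi"
proof -
  let ?c1 = "\<lambda>X. Lam [h 0, a 0] (
      [h 1, h 2, h 3] \<Leftarrow> X\<langle>[h 0]\<rangle>;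
      [a 1] \<Leftarrow> act\<langle>[h 2, a 0]\<rangle>;
      [a 2] \<Leftarrow> U1\<langle>[h 1]\<rangle>;
      [a 3] \<Leftarrow> muA\<langle>[a 2, a 1]\<rangle>;
      Ret [a 3, h 3])"
  let ?c2 = "\<lambda>X. Lam [h 0, a 0] (
      [h 1, h 2] \<Leftarrow> delH\<langle>[h 0]\<rangle>;
      [a 1] \<Leftarrow> etaA\<langle>[]\<rangle>;
      [a 2] \<Leftarrow> X\<langle>[h 1, a 1, a 0]\<rangle>;
      Ret [a 2, h 2])"
  let ?c3 = "\<lambda>X. Lam [h 0, a 0] (
      [h 1, h 2] \<Leftarrow> delH\<langle>[h 0]\<rangle>;
      [a 1] \<Leftarrow> X\<langle>[a 0]\<rangle>;
      [a 2] \<Leftarrow> act\<langle>[h 1, a 1]\<rangle>;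
      Ret [a 2, h 2])"
  have "(muA \<otimes>\<^sub>d idH) \<circ>\<^sub>d (idA \<otimes>\<^sub>d Psi) \<circ>\<^sub>d (((U1 \<otimes>\<^sub>d idH) \<circ>\<^sub>d delH) \<otimes>\<^sub>d idA) \<approx> ?c1 ((idH \<otimes>\<^sub>d delH) \<circ>\<^sub>d delH)"
    by (rule coherence) code_simp
  also have "\<dots> = sem (?c1 ((delH \<otimes>\<^sub>d idH) \<circ>\<^sub>d delH))"
    by (intro coassocH[symmetric] program_congs)
  also have "\<dots> = sem (?c2 (muA \<circ>\<^sub>d (act \<otimes>\<^sub>d act) \<circ>\<^sub>d (idH \<otimes>\<^sub>d swap_tm [SH] [SA] \<otimes>\<^sub>d idA) \<circ>\<^sub>d (delH \<otimes>\<^sub>d idA \<otimes>\<^sub>d idA)))"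
    by (rule coherence) code_simp
  also have "\<dots> = sem (?c2 (act \<circ>\<^sub>d (idH \<otimes>\<^sub>d muA)))"
    by (intro act_muA[symmetric] program_congs)
  also have "\<dots> = sem (?c3 (muA \<circ>\<^sub>d (etaA \<otimes>\<^sub>d idA)))"
    by (rule coherence) code_simp
  also have "\<dots> = sem (?c3 idA)"
    by (intro unitA program_congs)
  also have "\<dots> = sem Psi"
    by (rule coherence) code_simp
  finally show ?thesis .
qed

text \<open>\<open>(1\<^sub>1 \<cdot> b) \<otimes> 1\<^sub>2 = b u\<^sub>1(1\<^sub>1) \<otimes> 1\<^sub>2\<close>. Writing \<open>b = b 1\<close> gives \<open>(1\<^sub>1 \<cdot> b) u\<^sub>1(1\<^sub>2) \<otimes> 1\<^sub>3\<close>; the first unit axiom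
  turns this into \<open>(1\<^sub>1 \<cdot> b) (1\<^sub>2 \<cdot> u\<^sub>1(1'\<^sub>1)) \<otimes> 1'\<^sub>2\<close>, which is the action of \<open>1\<close> on \<open>b u\<^sub>1(1'\<^sub>1)\<close>.\<close>

lemma Psi_etaH: "Psi \<circ>\<^sub>d (etaH \<otimes>\<^sub>d idA) \<approx> (muA \<otimes>\<^sub>d idH) \<circ>\<^sub>d (idA \<otimes>\<^sub>d ((U1 \<otimes>\<^sub>d idH) \<circ>\<^sub>d DelEta))"
proof -
  let ?c1 = "\<lambda>X. Lam [a 0] (
      [h 1, h 2] \<Leftarrow> DelEta\<langle>[]\<rangle>;
      [a 1] \<Leftarrow> X\<langle>[a 0]\<rangle>;
      [a 2] \<Leftarrow> act\<langle>[h 1, a 1]\<rangle>;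
      Ret [a 2, h 2])"
  let ?c2 = "\<lambda>X. Lam [a 0] (
      [h 1, h 2] \<Leftarrow> DelEta\<langle>[]\<rangle>;
      [a 1] \<Leftarrow> etaA\<langle>[]\<rangle>;
      [a 2] \<Leftarrow> X\<langle>[h 1, a 0, a 1]\<rangle>;
      Ret [a 2, h 2])"
  let ?c3 = "\<lambda>X. Lam [a 0] (
      [h 1, h 2, h 3] \<Leftarrow> X\<langle>[]\<rangle>;
      [a 1] \<Leftarrow> act\<langle>[h 1, a 0]\<rangle>;
      [a 2] \<Leftarrow> U1\<langle>[h 2]\<rangle>;
      [a 3] \<Leftarrow> muA\<langle>[a 1, a 2]\<rangle>;
      Ret [a 3, h 3])"
  let ?c4 = "\<lambda>X. Lam [a 0] (
      [h 1, h 2] \<Leftarrow> DelEta\<langle>[]\<rangle>;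
      [h 3, h 4] \<Leftarrow> DelEta\<langle>[]\<rangle>;
      [a 1] \<Leftarrow> act\<langle>[h 1, a 0]\<rangle>;
      [a 2] \<Leftarrow> X\<langle>[h 2, h 3]\<rangle>;
      [a 3] \<Leftarrow> muA\<langle>[a 1, a 2]\<rangle>;
      Ret [a 3, h 4])"
  let ?c5 = "\<lambda>X. Lam [a 0] (
      [h 0] \<Leftarrow> etaH\<langle>[]\<rangle>;
      [h 3, h 4] \<Leftarrow> DelEta\<langle>[]\<rangle>;
      [a 1] \<Leftarrow> U1\<langle>[h 3]\<rangle>;
      [a 2] \<Leftarrow> X\<langle>[h 0, a 0, a 1]\<rangle>;
      Ret [a 2, h 4])"
  let ?c6 = "\<lambda>X. Lam [a 0] (
      [h 3, h 4] \<Leftarrow> DelEta\<langle>[]\<rangle>;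
      [a 1] \<Leftarrow> U1\<langle>[h 3]\<rangle>;
      [a 2] \<Leftarrow> muA\<langle>[a 0, a 1]\<rangle>;
      [a 3] \<Leftarrow> X\<langle>[a 2]\<rangle>;
      Ret [a 3, h 4])"
  have "Psi \<circ>\<^sub>d (etaH \<otimes>\<^sub>d idA) \<approx> ?c1 idA"
    by (rule coherence) code_simp
  also have "\<dots> = sem (?c1 (muA \<circ>\<^sub>d (idA \<otimes>\<^sub>d etaA)))"
    by (intro unitA[symmetric] program_congs)
  also have "\<dots> = sem (?c2 (act \<circ>\<^sub>d (idH \<otimes>\<^sub>d muA)))"
    by (rule coherence) code_simp
  also have "\<dots> = sem (?c2 (muA \<circ>\<^sub>d (act \<otimes>\<^sub>d act) \<circ>\<^sub>d (idH \<otimes>\<^sub>d swap_tm [SH] [SA] \<otimes>\<^sub>d idA) \<circ>\<^sub>d (delH \<otimes>\<^sub>d idA \<otimes>\<^sub>d idA)))"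
    by (intro act_muA program_congs)
  also have "\<dots> = sem (?c3 ((delH \<otimes>\<^sub>d idH) \<circ>\<^sub>d delH \<circ>\<^sub>d etaH))"
    by (rule coherence) code_simp
  also have "\<dots> = sem (?c3 ((idH \<otimes>\<^sub>d muH \<otimes>\<^sub>d idH) \<circ>\<^sub>d (delH \<otimes>\<^sub>d delH) \<circ>\<^sub>d (etaH \<otimes>\<^sub>d etaH)))"
    by (intro delH_etaH program_congs)
  also have "\<dots> = sem (?c4 U2)"
    by (rule coherence) code_simp
  also have "\<dots> = sem (?c4 (act \<circ>\<^sub>d (idH \<otimes>\<^sub>d U1)))"
    by (intro U2_act program_congs)
  also have "\<dots> = sem (?c5 (muA \<circ>\<^sub>d (act \<otimes>\<^sub>d act) \<circ>\<^sub>d (idH \<otimes>\<^sub>d swap_tm [SH] [SA] \<otimes>\<^sub>d idA) \<circ>\<^sub>d (delH \<otimes>\<^sub>d idA \<otimes>\<^sub>d idA)))"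
    by (rule coherence) code_simp
  also have "\<dots> = sem (?c5 (act \<circ>\<^sub>d (idH \<otimes>\<^sub>d muA)))"
    by (intro act_muA[symmetric] program_congs)
  also have "\<dots> = sem (?c6 (act \<circ>\<^sub>d (etaH \<otimes>\<^sub>d idA)))"
    by (rule coherence) code_simp
  also have "\<dots> = sem (?c6 idA)"
    by (intro act_etaH program_congs)
  also have "\<dots> = sem ((muA \<otimes>\<^sub>d idH) \<circ>\<^sub>d (idA \<otimes>\<^sub>d ((U1 \<otimes>\<^sub>d idH) \<circ>\<^sub>d DelEta)))"
    by (rule coherence) code_simp
  finally show ?thesis .
qed

text \<open>\<open>u\<^sub>1(h\<^sub>1) \<sigma>(h\<^sub>2, k) = \<sigma>(h, k)\<close>, because \<open>\<sigma> = u\<^sub>2 \<and> \<sigma>\<close> and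
  \<open>u\<^sub>1(h\<^sub>1) (h\<^sub>2 \<cdot> u\<^sub>1(k)) = h \<cdot> (1 u\<^sub>1(k)) = u\<^sub>2(h, k)\<close>.\<close>

lemma U1_sig: "muA \<circ>\<^sub>d (U1 \<otimes>\<^sub>d sig) \<circ>\<^sub>d (delH \<otimes>\<^sub>d idH) \<approx> sig"
proof -
  let ?c1 = "\<lambda>X. Lam [h 0, h 1] (
      [h 2, h 3] \<Leftarrow> delH\<langle>[h 0]\<rangle>;
      [a 0] \<Leftarrow> U1\<langle>[h 2]\<rangle>;
      [a 1] \<Leftarrow> X\<langle>[h 3, h 1]\<rangle>;
      [a 2] \<Leftarrow> muA\<langle>[a 0, a 1]\<rangle>;
      Ret [a 2])"
  let ?c2 = "\<lambda>X Y Z. Lam [h 0, h 1] (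
      [h 2, h 3, h 4] \<Leftarrow> X\<langle>[h 0]\<rangle>;
      [h 5, h 6] \<Leftarrow> delH\<langle>[h 1]\<rangle>;
      [a 0] \<Leftarrow> U1\<langle>[h 2]\<rangle>;
      [a 1] \<Leftarrow> Y\<langle>[h 3, h 5]\<rangle>;
      [a 2] \<Leftarrow> sig\<langle>[h 4, h 6]\<rangle>;
      [a 3] \<Leftarrow> Z\<langle>[a 0, a 1, a 2]\<rangle>;
      Ret [a 3])"
  let ?c3 = "\<lambda>X. Lam [h 0, h 1] (
      [h 2, h 4] \<Leftarrow> delH\<langle>[h 0]\<rangle>;
      [h 5, h 6] \<Leftarrow> delH\<langle>[h 1]\<rangle>;
      [a 1] \<Leftarrow> U1\<langle>[h 5]\<rangle>;
      [a 4] \<Leftarrow> etaA\<langle>[]\<rangle>;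
      [a 0] \<Leftarrow> X\<langle>[h 2, a 4, a 1]\<rangle>;
      [a 2] \<Leftarrow> sig\<langle>[h 4, h 6]\<rangle>;
      [a 3] \<Leftarrow> muA\<langle>[a 0, a 2]\<rangle>;
      Ret [a 3])"
  let ?c4 = "\<lambda>X. Lam [h 0, h 1] (
      [h 2, h 4] \<Leftarrow> delH\<langle>[h 0]\<rangle>;
      [h 5, h 6] \<Leftarrow> delH\<langle>[h 1]\<rangle>;
      [a 1] \<Leftarrow> U1\<langle>[h 5]\<rangle>;
      [a 4] \<Leftarrow> X\<langle>[a 1]\<rangle>;
      [a 0] \<Leftarrow> act\<langle>[h 2, a 4]\<rangle>;
      [a 2] \<Leftarrow> sig\<langle>[h 4, h 6]\<rangle>;
      [a 3] \<Leftarrow> muA\<langle>[a 0, a 2]\<rangle>;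
      Ret [a 3])"
  let ?c5 = "\<lambda>X. Lam [h 0, h 1] (
      [h 2, h 4] \<Leftarrow> delH\<langle>[h 0]\<rangle>;
      [h 5, h 6] \<Leftarrow> delH\<langle>[h 1]\<rangle>;
      [a 0] \<Leftarrow> X\<langle>[h 2, h 5]\<rangle>;
      [a 2] \<Leftarrow> sig\<langle>[h 4, h 6]\<rangle>;
      [a 3] \<Leftarrow> muA\<langle>[a 0, a 2]\<rangle>;
      Ret [a 3])"
  let ?c6 = "\<lambda>X. Lam [h 0, h 1] (
      [a 0] \<Leftarrow> X\<langle>[h 0, h 1]\<rangle>;
      Ret [a 0])"
  have "muA \<circ>\<^sub>d (U1 \<otimes>\<^sub>d sig) \<circ>\<^sub>d (delH \<otimes>\<^sub>d idH) \<approx> ?c1 sig"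
    by (rule coherence) code_simp
  also have "\<dots> = sem (?c1 (conv U2 sig))"
    by (intro U2_sig[symmetric] program_congs)
  also have "\<dots> = sem (?c2 ((idH \<otimes>\<^sub>d delH) \<circ>\<^sub>d delH) U2 (muA \<circ>\<^sub>d (idA \<otimes>\<^sub>d muA)))"
    by (rule coherence) code_simp
  also have "\<dots> = sem (?c2 ((delH \<otimes>\<^sub>d idH) \<circ>\<^sub>d delH) (act \<circ>\<^sub>d (idH \<otimes>\<^sub>d U1)) (muA \<circ>\<^sub>d (muA \<otimes>\<^sub>d idA)))"
    by (intro coassocH[symmetric] U2_act assocA program_congs)
  also have "\<dots> = sem (?c3 (muA \<circ>\<^sub>d (act \<otimes>\<^sub>d act) \<circ>\<^sub>d (idH \<otimes>\<^sub>d swap_tm [SH] [SA] \<otimes>\<^sub>d idA) \<circ>\<^sub>d (delH \<otimes>\<^sub>d idA \<otimes>\<^sub>d idA)))"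
    by (rule coherence) code_simp
  also have "\<dots> = sem (?c3 (act \<circ>\<^sub>d (idH \<otimes>\<^sub>d muA)))"
    by (intro act_muA[symmetric] program_congs)
  also have "\<dots> = sem (?c4 (muA \<circ>\<^sub>d (etaA \<otimes>\<^sub>d idA)))"
    by (rule coherence) code_simp
  also have "\<dots> = sem (?c4 idA)"
    by (intro unitA program_congs)
  also have "\<dots> = sem (?c5 (act \<circ>\<^sub>d (idH \<otimes>\<^sub>d U1)))"
    by (rule coherence) code_simp
  also have "\<dots> = sem (?c5 U2)"
    by (intro U2_act[symmetric] program_congs)
  also have "\<dots> = sem (?c6 (conv U2 sig))"
    by (rule coherence) code_simp
  also have "\<dots> = sem (?c6 sig)"
    by (intro U2_sig program_congs)
  also have "\<dots> = sem sig"
    by (rule coherence) code_simp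
  finally show ?thesis .
qed

text \<open>Left multiplication by \<open>\<nu>\<close> is \<open>a \<otimes> h \<mapsto> a \<sigma>(1, h\<^sub>1) \<otimes> h\<^sub>2\<close>.\<close>

lemma Nu_Mul: "Mul \<circ>\<^sub>d (Nu \<otimes>\<^sub>d idAH) \<approx> (muA \<otimes>\<^sub>d idH) \<circ>\<^sub>d (idA \<otimes>\<^sub>d ((SigL \<otimes>\<^sub>d idH) \<circ>\<^sub>d delH))"
proof -
  let ?c1 = "\<lambda>X. Lam [a 0, h 0] (
      [a 1, h 1] \<Leftarrow> X\<langle>[]\<rangle>;
      [a 2, h 2] \<Leftarrow> Mul\<langle>[a 1, h 1, a 0, h 0]\<rangle>;
      Ret [a 2, h 2])"
  let ?c2 = "\<lambda>X. Lam [a 0, h 0] (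
      [h 1] \<Leftarrow> etaH\<langle>[]\<rangle>;
      [a 2, h 3] \<Leftarrow> X\<langle>[h 1, a 0]\<rangle>;
      [a 3, h 4] \<Leftarrow> SigmaHA\<langle>[h 3, h 0]\<rangle>;
      [a 4] \<Leftarrow> muA\<langle>[a 2, a 3]\<rangle>;
      Ret [a 4, h 4])"
  let ?c3 = "\<lambda>X. Lam [a 0, h 0] (
      [a 2, h 3] \<Leftarrow> X\<langle>[a 0]\<rangle>;
      [a 3, h 4] \<Leftarrow> SigmaHA\<langle>[h 3, h 0]\<rangle>;
      [a 4] \<Leftarrow> muA\<langle>[a 2, a 3]\<rangle>;
      Ret [a 4, h 4])"
  let ?c4 = "\<lambda>X Y. Lam [a 0, h 0] (
      [h 1] \<Leftarrow> etaH\<langle>[]\<rangle>;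
      [h 2, h 3, h 4] \<Leftarrow> X\<langle>[h 1]\<rangle>;
      [a 1] \<Leftarrow> U1\<langle>[h 2]\<rangle>;
      [h 5, h 6] \<Leftarrow> delH\<langle>[h 0]\<rangle>;
      [a 2] \<Leftarrow> sig\<langle>[h 3, h 5]\<rangle>;
      [h 7] \<Leftarrow> muH\<langle>[h 4, h 6]\<rangle>;
      [a 3] \<Leftarrow> Y\<langle>[a 0, a 1, a 2]\<rangle>;
      Ret [a 3, h 7])"
  let ?c5 = "\<lambda>X. Lam [a 0, h 0] (
      [h 1] \<Leftarrow> etaH\<langle>[]\<rangle>;
      [h 2, h 3, h 4, h 5] \<Leftarrow> delHH\<langle>[h 1, h 0]\<rangle>;
      [a 1] \<Leftarrow> X\<langle>[h 2, h 3]\<rangle>;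
      [h 6] \<Leftarrow> muH\<langle>[h 4, h 5]\<rangle>;
      [a 2] \<Leftarrow> muA\<langle>[a 0, a 1]\<rangle>;
      Ret [a 2, h 6])"
  let ?c6 = "\<lambda>X. Lam [a 0, h 0] (
      [a 1, h 2] \<Leftarrow> X\<langle>[h 0]\<rangle>;
      [a 2] \<Leftarrow> muA\<langle>[a 0, a 1]\<rangle>;
      Ret [a 2, h 2])"
  have "Mul \<circ>\<^sub>d (Nu \<otimes>\<^sub>d idAH) \<approx> ?c1 Nu"
    by (rule coherence) code_simp
  also have "\<dots> = sem (?c1 ((U1 \<otimes>\<^sub>d idH) \<circ>\<^sub>d DelEta))"
    by (intro Nu_eq program_congs)
  also have "\<dots> = sem (?c2 ((muA \<otimes>\<^sub>d idH) \<circ>\<^sub>d (idA \<otimes>\<^sub>d Psi) \<circ>\<^sub>d (((U1 \<otimes>\<^sub>d idH) \<circ>\<^sub>d delH) \<otimes>\<^sub>d idA)))"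
    by (rule coherence) code_simp
  also have "\<dots> = sem (?c2 Psi)"
    by (intro U1_Psi program_congs)
  also have "\<dots> = sem (?c3 (Psi \<circ>\<^sub>d (etaH \<otimes>\<^sub>d idA)))"
    by (rule coherence) code_simp
  also have "\<dots> = sem (?c3 ((muA \<otimes>\<^sub>d idH) \<circ>\<^sub>d (idA \<otimes>\<^sub>d ((U1 \<otimes>\<^sub>d idH) \<circ>\<^sub>d DelEta))))"
    by (intro Psi_etaH program_congs)
  also have "\<dots> = sem (?c4 ((idH \<otimes>\<^sub>d delH) \<circ>\<^sub>d delH) (muA \<circ>\<^sub>d (muA \<otimes>\<^sub>d idA)))"
    by (rule coherence) code_simp
  also have "\<dots> = sem (?c4 ((delH \<otimes>\<^sub>d idH) \<circ>\<^sub>d delH) (muA \<circ>\<^sub>d (idA \<otimes>\<^sub>d muA)))"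
    by (intro coassocH[symmetric] assocA[symmetric] program_congs)
  also have "\<dots> = sem (?c5 (muA \<circ>\<^sub>d (U1 \<otimes>\<^sub>d sig) \<circ>\<^sub>d (delH \<otimes>\<^sub>d idH)))"
    by (rule coherence) code_simp
  also have "\<dots> = sem (?c5 sig)"
    by (intro U1_sig program_congs)
  also have "\<dots> = sem (?c6 (SigmaHA \<circ>\<^sub>d (etaH \<otimes>\<^sub>d idH)))"
    by (rule coherence) code_simp
  also have "\<dots> = sem (?c6 ((SigL \<otimes>\<^sub>d idH) \<circ>\<^sub>d delH))"
    by (intro SigmaHA_unit_left program_congs)
  also have "\<dots> = sem ((muA \<otimes>\<^sub>d idH) \<circ>\<^sub>d (idA \<otimes>\<^sub>d ((SigL \<otimes>\<^sub>d idH) \<circ>\<^sub>d delH)))"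
    by (rule coherence) code_simp
  finally show ?thesis .
qed

subsection \<open>From a preunit to the normal condition\<close>

text \<open>\<open>\<sigma>(h, 1\<^sub>1) \<otimes> 1\<^sub>2 = \<sigma>(h\<^sub>1, 1) u\<^sub>2(h\<^sub>2, 1\<^sub>1) \<otimes> 1\<^sub>2\<close>: the values of \<open>\<sigma>\<close> on the first leg of the
  coproduct of the unit are determined by \<open>\<sigma>(-, 1)\<close>.\<close>

lemma sig_DelEta: "(sig \<otimes>\<^sub>d idH) \<circ>\<^sub>d (idH \<otimes>\<^sub>d DelEta) \<approx> SigUnit"
proof -
  let ?c1 = "\<lambda>X. Lam [h 0] (
      [h 1, h 2] \<Leftarrow> DelEta\<langle>[]\<rangle>;
      [a 0] \<Leftarrow> X\<langle>[h 0, h 1]\<rangle>;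
      Ret [a 0, h 2])"
  let ?c2 = "\<lambda>X. Lam [h 0] (
      [h 1, h 2, h 3] \<Leftarrow> X\<langle>[]\<rangle>;
      [h 4, h 5] \<Leftarrow> delH\<langle>[h 0]\<rangle>;
      [a 0] \<Leftarrow> sig\<langle>[h 4, h 1]\<rangle>;
      [a 1] \<Leftarrow> U2\<langle>[h 5, h 2]\<rangle>;
      [a 2] \<Leftarrow> muA\<langle>[a 0, a 1]\<rangle>;
      Ret [a 2, h 3])"
  let ?c3 = "\<lambda>X. Lam [h 0] (
      [h 1, h 2] \<Leftarrow> DelEta\<langle>[]\<rangle>;
      [h 3, h 6] \<Leftarrow> DelEta\<langle>[]\<rangle>;
      [h 4, h 5] \<Leftarrow> delH\<langle>[h 0]\<rangle>;
      [a 0] \<Leftarrow> sig\<langle>[h 4, h 1]\<rangle>;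
      [h 7] \<Leftarrow> X\<langle>[h 5, h 2, h 3]\<rangle>;
      [a 1] \<Leftarrow> U1\<langle>[h 7]\<rangle>;
      [a 2] \<Leftarrow> muA\<langle>[a 0, a 1]\<rangle>;
      Ret [a 2, h 6])"
  let ?c4 = "\<lambda>X. Lam [h 0] (
      [a 0, h 1] \<Leftarrow> X\<langle>[h 0]\<rangle>;
      [h 3, h 6] \<Leftarrow> DelEta\<langle>[]\<rangle>;
      [a 1] \<Leftarrow> U2\<langle>[h 1, h 3]\<rangle>;
      [a 2] \<Leftarrow> muA\<langle>[a 0, a 1]\<rangle>;
      Ret [a 2, h 6])"
  have "(sig \<otimes>\<^sub>d idH) \<circ>\<^sub>d (idH \<otimes>\<^sub>d DelEta) \<approx> ?c1 sig"
    by (rule coherence) code_simp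
  also have "\<dots> = sem (?c1 (conv sig U2))"
    by (intro sig_U2[symmetric] program_congs)
  also have "\<dots> = sem (?c2 ((delH \<otimes>\<^sub>d idH) \<circ>\<^sub>d delH \<circ>\<^sub>d etaH))"
    by (rule coherence) code_simp
  also have "\<dots> = sem (?c2 ((idH \<otimes>\<^sub>d muH \<otimes>\<^sub>d idH) \<circ>\<^sub>d (delH \<otimes>\<^sub>d delH) \<circ>\<^sub>d (etaH \<otimes>\<^sub>d etaH)))"
    by (intro delH_etaH program_congs)
  also have "\<dots> = sem (?c3 (muH \<circ>\<^sub>d (idH \<otimes>\<^sub>d muH)))"
    by (rule coherence) code_simp
  also have "\<dots> = sem (?c3 (muH \<circ>\<^sub>d (muH \<otimes>\<^sub>d idH)))"
    by (intro assocH program_congs)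
  also have "\<dots> = sem (?c4 (SigmaHA \<circ>\<^sub>d (idH \<otimes>\<^sub>d etaH)))"
    by (rule coherence) code_simp
  also have "\<dots> = sem (?c4 ((SigR \<otimes>\<^sub>d idH) \<circ>\<^sub>d delH))"
    by (intro SigmaHA_unit_right program_congs)
  also have "\<dots> = sem SigUnit"
    by (rule coherence) code_simp
  finally show ?thesis .
qed

text \<open>\<open>\<nu> \<nu> = \<sigma>(1\<^sub>1, 1'\<^sub>1) \<otimes> 1\<^sub>2 1'\<^sub>2\<close>.\<close>

lemma Nu_Nu: "Mul \<circ>\<^sub>d (Nu \<otimes>\<^sub>d Nu) \<approx> SigmaHA \<circ>\<^sub>d (etaH \<otimes>\<^sub>d etaH)"
proof -
  let ?c1 = "\<lambda>X Y. Lam [] (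
      [a 0, h 0] \<Leftarrow> X\<langle>[]\<rangle>;
      [a 1, h 1] \<Leftarrow> Y\<langle>[a 0, h 0]\<rangle>;
      Ret [a 1, h 1])"
  let ?c2 = "\<lambda>X. Lam [] (
      [h 0] \<Leftarrow> etaH\<langle>[]\<rangle>;
      [h 1, h 2, h 3] \<Leftarrow> X\<langle>[h 0]\<rangle>;
      [a 0] \<Leftarrow> U1\<langle>[h 1]\<rangle>;
      [a 1] \<Leftarrow> SigR\<langle>[h 2]\<rangle>;
      [a 2] \<Leftarrow> muA\<langle>[a 0, a 1]\<rangle>;
      Ret [a 2, h 3])"
  let ?c3 = "\<lambda>X. Lam [] (
      [h 0] \<Leftarrow> etaH\<langle>[]\<rangle>;
      [h 1, h 2] \<Leftarrow> delH\<langle>[h 0]\<rangle>;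
      [h 3] \<Leftarrow> etaH\<langle>[]\<rangle>;
      [a 0] \<Leftarrow> X\<langle>[h 1, h 3]\<rangle>;
      Ret [a 0, h 2])"
  let ?c4 = "\<lambda>X. Lam [] (
      [h 0] \<Leftarrow> etaH\<langle>[]\<rangle>;
      [a 0, h 1] \<Leftarrow> X\<langle>[h 0]\<rangle>;
      Ret [a 0, h 1])"
  have "Mul \<circ>\<^sub>d (Nu \<otimes>\<^sub>d Nu) \<approx> ?c1 Nu (Mul \<circ>\<^sub>d (idAH \<otimes>\<^sub>d Nu))"
    by (rule coherence) code_simp
  also have "\<dots> = sem (?c1 ((U1 \<otimes>\<^sub>d idH) \<circ>\<^sub>d DelEta) ((muA \<otimes>\<^sub>d idH) \<circ>\<^sub>d (idA \<otimes>\<^sub>d ((SigR \<otimes>\<^sub>d idH) \<circ>\<^sub>d delH))))"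
    by (intro Nu_eq Mul_Nu program_congs)
  also have "\<dots> = sem (?c2 ((idH \<otimes>\<^sub>d delH) \<circ>\<^sub>d delH))"
    by (rule coherence) code_simp
  also have "\<dots> = sem (?c2 ((delH \<otimes>\<^sub>d idH) \<circ>\<^sub>d delH))"
    by (intro coassocH[symmetric] program_congs)
  also have "\<dots> = sem (?c3 (muA \<circ>\<^sub>d (U1 \<otimes>\<^sub>d sig) \<circ>\<^sub>d (delH \<otimes>\<^sub>d idH)))"
    by (rule coherence) code_simp
  also have "\<dots> = sem (?c3 sig)"
    by (intro U1_sig program_congs)
  also have "\<dots> = sem (?c4 ((SigR \<otimes>\<^sub>d idH) \<circ>\<^sub>d delH))"
    by (rule coherence) code_simp
  also have "\<dots> = sem (?c4 (SigmaHA \<circ>\<^sub>d (idH \<otimes>\<^sub>d etaH)))"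
    by (intro SigmaHA_unit_right[symmetric] program_congs)
  also have "\<dots> = sem (SigmaHA \<circ>\<^sub>d (etaH \<otimes>\<^sub>d etaH))"
    by (rule coherence) code_simp
  finally show ?thesis .
qed

lemma extract_SigR: "SigR \<approx> Extract ((muA \<otimes>\<^sub>d idH) \<circ>\<^sub>d (idA \<otimes>\<^sub>d ((SigR \<otimes>\<^sub>d idH) \<circ>\<^sub>d delH)))"
proof -
  let ?c1 = "\<lambda>X. Lam [h 0] (
      [h 1] \<Leftarrow> X\<langle>[h 0]\<rangle>;
      [a 0] \<Leftarrow> SigR\<langle>[h 1]\<rangle>;
      Ret [a 0])"
  let ?c2 = "\<lambda>X. Lam [h 0] (
      [h 1, h 2] \<Leftarrow> delH\<langle>[h 0]\<rangle>;
      [] \<Leftarrow> epsH\<langle>[h 2]\<rangle>;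
      [a 0] \<Leftarrow> SigR\<langle>[h 1]\<rangle>;
      [a 1] \<Leftarrow> X\<langle>[a 0]\<rangle>;
      Ret [a 1])"
  have "SigR \<approx> ?c1 idH"
    by (rule coherence) code_simp
  also have "\<dots> = sem (?c1 ((idH \<otimes>\<^sub>d epsH) \<circ>\<^sub>d delH))"
    by (intro counitH[symmetric] program_congs)
  also have "\<dots> = sem (?c2 idA)"
    by (rule coherence) code_simp
  also have "\<dots> = sem (?c2 (muA \<circ>\<^sub>d (etaA \<otimes>\<^sub>d idA)))"
    by (intro unitA[symmetric] program_congs)
  also have "\<dots> = sem (Extract ((muA \<otimes>\<^sub>d idH) \<circ>\<^sub>d (idA \<otimes>\<^sub>d ((SigR \<otimes>\<^sub>d idH) \<circ>\<^sub>d delH))))"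
    by (rule coherence) code_simp
  finally show ?thesis .
qed

lemma extract_SigL: "SigL \<approx> Extract ((muA \<otimes>\<^sub>d idH) \<circ>\<^sub>d (idA \<otimes>\<^sub>d ((SigL \<otimes>\<^sub>d idH) \<circ>\<^sub>d delH)))"
proof -
  let ?c1 = "\<lambda>X. Lam [h 0] (
      [h 1] \<Leftarrow> X\<langle>[h 0]\<rangle>;
      [a 0] \<Leftarrow> SigL\<langle>[h 1]\<rangle>;
      Ret [a 0])"
  let ?c2 = "\<lambda>X. Lam [h 0] (
      [h 1, h 2] \<Leftarrow> delH\<langle>[h 0]\<rangle>;
      [] \<Leftarrow> epsH\<langle>[h 2]\<rangle>;
      [a 0] \<Leftarrow> SigL\<langle>[h 1]\<rangle>;
      [a 1] \<Leftarrow> X\<langle>[a 0]\<rangle>;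
      Ret [a 1])"
  have "SigL \<approx> ?c1 idH"
    by (rule coherence) code_simp
  also have "\<dots> = sem (?c1 ((idH \<otimes>\<^sub>d epsH) \<circ>\<^sub>d delH))"
    by (intro counitH[symmetric] program_congs)
  also have "\<dots> = sem (?c2 idA)"
    by (rule coherence) code_simp
  also have "\<dots> = sem (?c2 (muA \<circ>\<^sub>d (etaA \<otimes>\<^sub>d idA)))"
    by (intro unitA[symmetric] program_congs)
  also have "\<dots> = sem (Extract ((muA \<otimes>\<^sub>d idH) \<circ>\<^sub>d (idA \<otimes>\<^sub>d ((SigL \<otimes>\<^sub>d idH) \<circ>\<^sub>d delH))))"
    by (rule coherence) code_simp
  finally show ?thesis .
qed

text \<open>\<open>\<sigma>(-, 1) \<and> u\<^sub>1 = \<sigma>(-, 1)\<close>: apply the counit to the free leg in \<open>sig_DelEta\<close>.\<close>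

lemma SigR_U1: "SigR \<approx> muA \<circ>\<^sub>d (SigR \<otimes>\<^sub>d U1) \<circ>\<^sub>d delH"
proof -
  let ?c1 = "\<lambda>X. Lam [h 0] (
      [h 1] \<Leftarrow> etaH\<langle>[]\<rangle>;
      [h 2] \<Leftarrow> X\<langle>[h 1]\<rangle>;
      [a 0] \<Leftarrow> sig\<langle>[h 0, h 2]\<rangle>;
      Ret [a 0])"
  let ?c2 = "\<lambda>X. Lam [h 0] (
      [a 0, h 1] \<Leftarrow> X\<langle>[h 0]\<rangle>;
      [] \<Leftarrow> epsH\<langle>[h 1]\<rangle>;
      Ret [a 0])"
  let ?c3 = "\<lambda>X. Lam [h 0] (
      [h 1, h 2] \<Leftarrow> delH\<langle>[h 0]\<rangle>;
      [a 0] \<Leftarrow> SigR\<langle>[h 1]\<rangle>;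
      [h 3] \<Leftarrow> etaH\<langle>[]\<rangle>;
      [h 4] \<Leftarrow> X\<langle>[h 3]\<rangle>;
      [a 1] \<Leftarrow> U2\<langle>[h 2, h 4]\<rangle>;
      [a 2] \<Leftarrow> muA\<langle>[a 0, a 1]\<rangle>;
      Ret [a 2])"
  let ?c4 = "\<lambda>X. Lam [h 0] (
      [h 1, h 2] \<Leftarrow> delH\<langle>[h 0]\<rangle>;
      [a 0] \<Leftarrow> SigR\<langle>[h 1]\<rangle>;
      [h 3] \<Leftarrow> X\<langle>[h 2]\<rangle>;
      [a 1] \<Leftarrow> U1\<langle>[h 3]\<rangle>;
      [a 2] \<Leftarrow> muA\<langle>[a 0, a 1]\<rangle>;
      Ret [a 2])"
  have "SigR \<approx> ?c1 idH"
    by (rule coherence) code_simp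
  also have "\<dots> = sem (?c1 ((idH \<otimes>\<^sub>d epsH) \<circ>\<^sub>d delH))"
    by (intro counitH[symmetric] program_congs)
  also have "\<dots> = sem (?c2 ((sig \<otimes>\<^sub>d idH) \<circ>\<^sub>d (idH \<otimes>\<^sub>d DelEta)))"
    by (rule coherence) code_simp
  also have "\<dots> = sem (?c2 SigUnit)"
    by (intro sig_DelEta program_congs)
  also have "\<dots> = sem (?c3 ((idH \<otimes>\<^sub>d epsH) \<circ>\<^sub>d delH))"
    by (rule coherence) code_simp
  also have "\<dots> = sem (?c3 idH)"
    by (intro counitH program_congs)
  also have "\<dots> = sem (?c4 (muH \<circ>\<^sub>d (idH \<otimes>\<^sub>d etaH)))"
    by (rule coherence) code_simp
  also have "\<dots> = sem (?c4 idH)"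
    by (intro unitH program_congs)
  also have "\<dots> = sem (muA \<circ>\<^sub>d (SigR \<otimes>\<^sub>d U1) \<circ>\<^sub>d delH)"
    by (rule coherence) code_simp
  finally show ?thesis .
qed

text \<open>For a preunit \<open>\<nu>\<close>, \<open>\<sigma>(-, 1)\<close> is idempotent for convolution. The product of \<open>1 \<otimes> h\<close> with \<open>\<nu>\<close> equals its
  product with \<open>\<nu> \<nu> = \<sigma>\<^sub>H\<^sup>A(1 \<otimes> 1)\<close>; the former is \<open>\<sigma>(h\<^sub>1, 1) \<otimes> h\<^sub>2\<close> and the latter is, by the cocycle
  condition on \<open>h \<otimes> 1 \<otimes> 1\<close>, equal to \<open>\<sigma>(h\<^sub>1, 1) \<sigma>(h\<^sub>2, 1) \<otimes> h\<^sub>3\<close>.\<close>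

lemma SigR_idempotent:
  assumes P1: "Mul \<circ>\<^sub>d (idAH \<otimes>\<^sub>d Nu) \<approx> Mul \<circ>\<^sub>d (Nu \<otimes>\<^sub>d idAH)"
    and P2: "Mul \<circ>\<^sub>d (Nu \<otimes>\<^sub>d idAH) \<approx> Mul \<circ>\<^sub>d (idAH \<otimes>\<^sub>d (Mul \<circ>\<^sub>d (Nu \<otimes>\<^sub>d Nu)))"
    and cocycle: "(muA \<otimes>\<^sub>d idH) \<circ>\<^sub>d (idA \<otimes>\<^sub>d SigmaHA) \<circ>\<^sub>d (SigmaHA \<otimes>\<^sub>d idH) \<approx> (muA \<otimes>\<^sub>d idH) \<circ>\<^sub>d (idA \<otimes>\<^sub>d SigmaHA) \<circ>\<^sub>d (Psi \<otimes>\<^sub>d idH) \<circ>\<^sub>d (idH \<otimes>\<^sub>d SigmaHA)"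
  shows "SigR \<approx> muA \<circ>\<^sub>d (SigR \<otimes>\<^sub>d SigR) \<circ>\<^sub>d delH"
proof -
  let ?c1 = "\<lambda>X. Lam [h 0] (
      [a 0] \<Leftarrow> X\<langle>[h 0]\<rangle>;
      Ret [a 0])"
  let ?c2 = "\<lambda>X. Lam [h 0] (
      [a 0] \<Leftarrow> etaA\<langle>[]\<rangle>;
      [a 1, h 1] \<Leftarrow> X\<langle>[a 0, h 0]\<rangle>;
      [] \<Leftarrow> epsH\<langle>[h 1]\<rangle>;
      Ret [a 1])"
  let ?c3 = "\<lambda>X. Lam [h 0] (
      [a 0] \<Leftarrow> etaA\<langle>[]\<rangle>;
      [a 1, h 1] \<Leftarrow> X\<langle>[]\<rangle>;
      [a 2, h 2] \<Leftarrow> Mul\<langle>[a 0, h 0, a 1, h 1]\<rangle>;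
      [] \<Leftarrow> epsH\<langle>[h 2]\<rangle>;
      Ret [a 2])"
  let ?c4 = "\<lambda>X. Lam [h 0] (
      [h 1] \<Leftarrow> etaH\<langle>[]\<rangle>;
      [h 2] \<Leftarrow> etaH\<langle>[]\<rangle>;
      [a 1, h 3] \<Leftarrow> SigmaHA\<langle>[h 1, h 2]\<rangle>;
      [a 2, h 4] \<Leftarrow> Psi\<langle>[h 0, a 1]\<rangle>;
      [a 3, h 5] \<Leftarrow> SigmaHA\<langle>[h 4, h 3]\<rangle>;
      [a 4] \<Leftarrow> X\<langle>[a 2]\<rangle>;
      [a 5] \<Leftarrow> muA\<langle>[a 4, a 3]\<rangle>;
      [] \<Leftarrow> epsH\<langle>[h 5]\<rangle>;
      Ret [a 5])"
  let ?c5 = "\<lambda>X. Lam [h 0] (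
      [h 1] \<Leftarrow> etaH\<langle>[]\<rangle>;
      [h 2] \<Leftarrow> etaH\<langle>[]\<rangle>;
      [a 0, h 3] \<Leftarrow> X\<langle>[h 0, h 1, h 2]\<rangle>;
      [] \<Leftarrow> epsH\<langle>[h 3]\<rangle>;
      Ret [a 0])"
  let ?c6 = "\<lambda>X Y. Lam [h 0] (
      [a 0, h 1] \<Leftarrow> X\<langle>[h 0]\<rangle>;
      [a 1, h 2] \<Leftarrow> Y\<langle>[h 1]\<rangle>;
      [] \<Leftarrow> epsH\<langle>[h 2]\<rangle>;
      [a 2] \<Leftarrow> muA\<langle>[a 0, a 1]\<rangle>;
      Ret [a 2])"
  let ?c7 = "\<lambda>X. Lam [h 0] (
      [h 1, h 2] \<Leftarrow> delH\<langle>[h 0]\<rangle>;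
      [a 0] \<Leftarrow> SigR\<langle>[h 1]\<rangle>;
      [h 3] \<Leftarrow> X\<langle>[h 2]\<rangle>;
      [a 1] \<Leftarrow> SigR\<langle>[h 3]\<rangle>;
      [a 2] \<Leftarrow> muA\<langle>[a 0, a 1]\<rangle>;
      Ret [a 2])"
  have "SigR \<approx> ?c1 SigR"
    by (rule coherence) code_simp
  also have "\<dots> = sem (?c1 (Extract ((muA \<otimes>\<^sub>d idH) \<circ>\<^sub>d (idA \<otimes>\<^sub>d ((SigR \<otimes>\<^sub>d idH) \<circ>\<^sub>d delH)))))"
    by (intro extract_SigR program_congs)
  also have "\<dots> = sem (?c2 ((muA \<otimes>\<^sub>d idH) \<circ>\<^sub>d (idA \<otimes>\<^sub>d ((SigR \<otimes>\<^sub>d idH) \<circ>\<^sub>d delH))))"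
    by (rule coherence) code_simp
  also have "\<dots> = sem (?c2 (Mul \<circ>\<^sub>d (idAH \<otimes>\<^sub>d Nu)))"
    by (intro Mul_Nu[symmetric] program_congs)
  also have "\<dots> = sem (?c2 (Mul \<circ>\<^sub>d (Nu \<otimes>\<^sub>d idAH)))"
    by (intro P1 program_congs)
  also have "\<dots> = sem (?c2 (Mul \<circ>\<^sub>d (idAH \<otimes>\<^sub>d (Mul \<circ>\<^sub>d (Nu \<otimes>\<^sub>d Nu)))))"
    by (intro P2 program_congs)
  also have "\<dots> = sem (?c3 (Mul \<circ>\<^sub>d (Nu \<otimes>\<^sub>d Nu)))"
    by (rule coherence) code_simp
  also have "\<dots> = sem (?c3 (SigmaHA \<circ>\<^sub>d (etaH \<otimes>\<^sub>d etaH)))"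
    by (intro Nu_Nu program_congs)
  also have "\<dots> = sem (?c4 (muA \<circ>\<^sub>d (etaA \<otimes>\<^sub>d idA)))"
    by (rule coherence) code_simp
  also have "\<dots> = sem (?c4 idA)"
    by (intro unitA program_congs)
  also have "\<dots> = sem (?c5 ((muA \<otimes>\<^sub>d idH) \<circ>\<^sub>d (idA \<otimes>\<^sub>d SigmaHA) \<circ>\<^sub>d (Psi \<otimes>\<^sub>d idH) \<circ>\<^sub>d (idH \<otimes>\<^sub>d SigmaHA)))"
    by (rule coherence) code_simp
  also have "\<dots> = sem (?c5 ((muA \<otimes>\<^sub>d idH) \<circ>\<^sub>d (idA \<otimes>\<^sub>d SigmaHA) \<circ>\<^sub>d (SigmaHA \<otimes>\<^sub>d idH)))"
    by (intro cocycle[symmetric] program_congs)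
  also have "\<dots> = sem (?c6 (SigmaHA \<circ>\<^sub>d (idH \<otimes>\<^sub>d etaH)) (SigmaHA \<circ>\<^sub>d (idH \<otimes>\<^sub>d etaH)))"
    by (rule coherence) code_simp
  also have "\<dots> = sem (?c6 ((SigR \<otimes>\<^sub>d idH) \<circ>\<^sub>d delH) ((SigR \<otimes>\<^sub>d idH) \<circ>\<^sub>d delH))"
    by (intro SigmaHA_unit_right program_congs)
  also have "\<dots> = sem (?c7 ((idH \<otimes>\<^sub>d epsH) \<circ>\<^sub>d delH))"
    by (rule coherence) code_simp
  also have "\<dots> = sem (?c7 idH)"
    by (intro counitH program_congs)
  also have "\<dots> = sem (muA \<circ>\<^sub>d (SigR \<otimes>\<^sub>d SigR) \<circ>\<^sub>d delH)"
    by (rule coherence) code_simp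
  finally show ?thesis .
qed

text \<open>Idempotence of \<open>\<sigma>(-, 1)\<close> propagates along \<open>sig_DelEta\<close>:
  \<open>\<sigma>(h, 1\<^sub>1) \<otimes> 1\<^sub>2 = \<sigma>(h\<^sub>1, 1) \<sigma>(h\<^sub>2, 1\<^sub>1) \<otimes> 1\<^sub>2\<close>.\<close>

lemma sig_DelEta_twice:
  assumes idem: "SigR \<approx> muA \<circ>\<^sub>d (SigR \<otimes>\<^sub>d SigR) \<circ>\<^sub>d delH"
  shows "(sig \<otimes>\<^sub>d idH) \<circ>\<^sub>d (idH \<otimes>\<^sub>d DelEta) \<approx> SigUnitTwice"
proof -
  let ?c1 = "\<lambda>X. Lam [h 0] (
      [a 0, h 1] \<Leftarrow> X\<langle>[h 0]\<rangle>;
      Ret [a 0, h 1])"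
  let ?c2 = "\<lambda>X. Lam [h 0] (
      [h 1, h 2] \<Leftarrow> delH\<langle>[h 0]\<rangle>;
      [a 0] \<Leftarrow> X\<langle>[h 1]\<rangle>;
      [h 3, h 4] \<Leftarrow> DelEta\<langle>[]\<rangle>;
      [a 1] \<Leftarrow> U2\<langle>[h 2, h 3]\<rangle>;
      [a 2] \<Leftarrow> muA\<langle>[a 0, a 1]\<rangle>;
      Ret [a 2, h 4])"
  let ?c3 = "\<lambda>X Y. Lam [h 0] (
      [h 1, h 2, h 3] \<Leftarrow> X\<langle>[h 0]\<rangle>;
      [a 0] \<Leftarrow> SigR\<langle>[h 1]\<rangle>;
      [a 1] \<Leftarrow> SigR\<langle>[h 2]\<rangle>;
      [h 4, h 5] \<Leftarrow> DelEta\<langle>[]\<rangle>;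
      [a 2] \<Leftarrow> U2\<langle>[h 3, h 4]\<rangle>;
      [a 3] \<Leftarrow> Y\<langle>[a 0, a 1, a 2]\<rangle>;
      Ret [a 3, h 5])"
  let ?c4 = "\<lambda>X. Lam [h 0] (
      [h 1, h 2] \<Leftarrow> delH\<langle>[h 0]\<rangle>;
      [a 0] \<Leftarrow> SigR\<langle>[h 1]\<rangle>;
      [a 1, h 3] \<Leftarrow> X\<langle>[h 2]\<rangle>;
      [a 2] \<Leftarrow> muA\<langle>[a 0, a 1]\<rangle>;
      Ret [a 2, h 3])"
  have "(sig \<otimes>\<^sub>d idH) \<circ>\<^sub>d (idH \<otimes>\<^sub>d DelEta) \<approx> ?c1 ((sig \<otimes>\<^sub>d idH) \<circ>\<^sub>d (idH \<otimes>\<^sub>d DelEta))"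
    by (rule coherence) code_simp
  also have "\<dots> = sem (?c1 SigUnit)"
    by (intro sig_DelEta program_congs)
  also have "\<dots> = sem (?c2 SigR)"
    by (rule coherence) code_simp
  also have "\<dots> = sem (?c2 (muA \<circ>\<^sub>d (SigR \<otimes>\<^sub>d SigR) \<circ>\<^sub>d delH))"
    by (intro idem program_congs)
  also have "\<dots> = sem (?c3 ((delH \<otimes>\<^sub>d idH) \<circ>\<^sub>d delH) (muA \<circ>\<^sub>d (muA \<otimes>\<^sub>d idA)))"
    by (rule coherence) code_simp
  also have "\<dots> = sem (?c3 ((idH \<otimes>\<^sub>d delH) \<circ>\<^sub>d delH) (muA \<circ>\<^sub>d (idA \<otimes>\<^sub>d muA)))"
    by (intro coassocH assocA[symmetric] program_congs)
  also have "\<dots> = sem (?c4 SigUnit)"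
    by (rule coherence) code_simp
  also have "\<dots> = sem (?c4 ((sig \<otimes>\<^sub>d idH) \<circ>\<^sub>d (idH \<otimes>\<^sub>d DelEta)))"
    by (intro sig_DelEta[symmetric] program_congs)
  also have "\<dots> = sem SigUnitTwice"
    by (rule coherence) code_simp
  finally show ?thesis .
qed

text \<open>An idempotent \<open>\<sigma>(-, 1)\<close> equals \<open>u\<^sub>1\<close>: convolving \<open>sig_DelEta_twice\<close> with \<open>\<tau>(-, 1\<^sub>2)\<close> gives
  \<open>u\<^sub>1(h) = u\<^sub>2(h, 1) = \<sigma>(h\<^sub>1, 1) u\<^sub>1(h\<^sub>2) = \<sigma>(h, 1)\<close>.\<close>

lemma U1_eq_SigR:
  assumes idem: "SigR \<approx> muA \<circ>\<^sub>d (SigR \<otimes>\<^sub>d SigR) \<circ>\<^sub>d delH"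
  shows "U1 \<approx> SigR"
proof -
  let ?c1 = "\<lambda>X. Lam [h 0] (
      [h 1] \<Leftarrow> X\<langle>[h 0]\<rangle>;
      [a 0] \<Leftarrow> U1\<langle>[h 1]\<rangle>;
      Ret [a 0])"
  let ?c2 = "\<lambda>X. Lam [h 0] (
      [h 1] \<Leftarrow> etaH\<langle>[]\<rangle>;
      [a 0] \<Leftarrow> X\<langle>[h 0, h 1]\<rangle>;
      Ret [a 0])"
  let ?c3 = "\<lambda>X. Lam [h 0] (
      [h 1, h 2] \<Leftarrow> delH\<langle>[h 0]\<rangle>;
      [a 0, h 3] \<Leftarrow> X\<langle>[h 1]\<rangle>;
      [a 1] \<Leftarrow> tau\<langle>[h 2, h 3]\<rangle>;
      [a 2] \<Leftarrow> muA\<langle>[a 0, a 1]\<rangle>;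
      Ret [a 2])"
  let ?c4 = "\<lambda>X Y. Lam [h 0] (
      [h 1, h 2, h 3] \<Leftarrow> X\<langle>[h 0]\<rangle>;
      [a 0] \<Leftarrow> SigR\<langle>[h 1]\<rangle>;
      [h 4, h 5] \<Leftarrow> DelEta\<langle>[]\<rangle>;
      [a 1] \<Leftarrow> sig\<langle>[h 2, h 4]\<rangle>;
      [a 2] \<Leftarrow> tau\<langle>[h 3, h 5]\<rangle>;
      [a 3] \<Leftarrow> Y\<langle>[a 0, a 1, a 2]\<rangle>;
      Ret [a 3])"
  let ?c5 = "\<lambda>X. Lam [h 0] (
      [h 1, h 2] \<Leftarrow> delH\<langle>[h 0]\<rangle>;
      [h 3] \<Leftarrow> etaH\<langle>[]\<rangle>;
      [a 0] \<Leftarrow> SigR\<langle>[h 1]\<rangle>;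
      [a 1] \<Leftarrow> X\<langle>[h 2, h 3]\<rangle>;
      [a 2] \<Leftarrow> muA\<langle>[a 0, a 1]\<rangle>;
      Ret [a 2])"
  let ?c6 = "\<lambda>X. Lam [h 0] (
      [h 1, h 2] \<Leftarrow> delH\<langle>[h 0]\<rangle>;
      [a 0] \<Leftarrow> SigR\<langle>[h 1]\<rangle>;
      [h 3] \<Leftarrow> X\<langle>[h 2]\<rangle>;
      [a 1] \<Leftarrow> U1\<langle>[h 3]\<rangle>;
      [a 2] \<Leftarrow> muA\<langle>[a 0, a 1]\<rangle>;
      Ret [a 2])"
  let ?c7 = "\<lambda>X. Lam [h 0] (
      [a 0] \<Leftarrow> X\<langle>[h 0]\<rangle>;
      Ret [a 0])"
  have "U1 \<approx> ?c1 idH"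
    by (rule coherence) code_simp
  also have "\<dots> = sem (?c1 (muH \<circ>\<^sub>d (idH \<otimes>\<^sub>d etaH)))"
    by (intro unitH[symmetric] program_congs)
  also have "\<dots> = sem (?c2 U2)"
    by (rule coherence) code_simp
  also have "\<dots> = sem (?c2 (conv sig tau))"
    by (intro sig_tau(1)[symmetric] program_congs)
  also have "\<dots> = sem (?c3 ((sig \<otimes>\<^sub>d idH) \<circ>\<^sub>d (idH \<otimes>\<^sub>d DelEta)))"
    by (rule coherence) code_simp
  also have "\<dots> = sem (?c3 SigUnitTwice)"
    by (intro sig_DelEta_twice idem program_congs)
  also have "\<dots> = sem (?c4 ((delH \<otimes>\<^sub>d idH) \<circ>\<^sub>d delH) (muA \<circ>\<^sub>d (muA \<otimes>\<^sub>d idA)))"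
    by (rule coherence) code_simp
  also have "\<dots> = sem (?c4 ((idH \<otimes>\<^sub>d delH) \<circ>\<^sub>d delH) (muA \<circ>\<^sub>d (idA \<otimes>\<^sub>d muA)))"
    by (intro coassocH assocA[symmetric] program_congs)
  also have "\<dots> = sem (?c5 (conv sig tau))"
    by (rule coherence) code_simp
  also have "\<dots> = sem (?c5 U2)"
    by (intro sig_tau(1) program_congs)
  also have "\<dots> = sem (?c6 (muH \<circ>\<^sub>d (idH \<otimes>\<^sub>d etaH)))"
    by (rule coherence) code_simp
  also have "\<dots> = sem (?c6 idH)"
    by (intro unitH program_congs)
  also have "\<dots> = sem (?c7 (muA \<circ>\<^sub>d (SigR \<otimes>\<^sub>d U1) \<circ>\<^sub>d delH))"
    by (rule coherence) code_simp
  also have "\<dots> = sem (?c7 SigR)"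
    by (intro SigR_U1[symmetric] program_congs)
  also have "\<dots> = sem SigR"
    by (rule coherence) code_simp
  finally show ?thesis .
qed

subsection \<open>From the normal condition to a preunit\<close>

text \<open>If \<open>\<sigma>(-, 1) = u\<^sub>1\<close>, right multiplication by \<open>\<nu>\<close> is the idempotent \<open>\<nabla>(a \<otimes> h) = a u\<^sub>1(h\<^sub>1) \<otimes> h\<^sub>2\<close>; likewise on the left.\<close>

lemma Mul_Nu_normal:
  assumes normal: "SigR \<approx> U1"
  shows "Mul \<circ>\<^sub>d (idAH \<otimes>\<^sub>d Nu) \<approx> (muA \<otimes>\<^sub>d idH) \<circ>\<^sub>d (idA \<otimes>\<^sub>d ((U1 \<otimes>\<^sub>d idH) \<circ>\<^sub>d delH))"
proof -
  let ?c1 = "\<lambda>X. Lam [a 0, h 0] (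
      [a 1, h 1] \<Leftarrow> X\<langle>[a 0, h 0]\<rangle>;
      Ret [a 1, h 1])"
  let ?c2 = "\<lambda>X. Lam [a 0, h 0] (
      [h 1, h 2] \<Leftarrow> delH\<langle>[h 0]\<rangle>;
      [a 1] \<Leftarrow> X\<langle>[h 1]\<rangle>;
      [a 2] \<Leftarrow> muA\<langle>[a 0, a 1]\<rangle>;
      Ret [a 2, h 2])"
  have "Mul \<circ>\<^sub>d (idAH \<otimes>\<^sub>d Nu) \<approx> ?c1 (Mul \<circ>\<^sub>d (idAH \<otimes>\<^sub>d Nu))"
    by (rule coherence) code_simp
  also have "\<dots> = sem (?c1 ((muA \<otimes>\<^sub>d idH) \<circ>\<^sub>d (idA \<otimes>\<^sub>d ((SigR \<otimes>\<^sub>d idH) \<circ>\<^sub>d delH))))"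
    by (intro Mul_Nu program_congs)
  also have "\<dots> = sem (?c2 SigR)"
    by (rule coherence) code_simp
  also have "\<dots> = sem (?c2 U1)"
    by (intro normal program_congs)
  also have "\<dots> = sem ((muA \<otimes>\<^sub>d idH) \<circ>\<^sub>d (idA \<otimes>\<^sub>d ((U1 \<otimes>\<^sub>d idH) \<circ>\<^sub>d delH)))"
    by (rule coherence) code_simp
  finally show ?thesis .
qed

lemma Nu_Mul_normal:
  assumes normal: "SigL \<approx> U1"
  shows "Mul \<circ>\<^sub>d (Nu \<otimes>\<^sub>d idAH) \<approx> (muA \<otimes>\<^sub>d idH) \<circ>\<^sub>d (idA \<otimes>\<^sub>d ((U1 \<otimes>\<^sub>d idH) \<circ>\<^sub>d delH))"
proof -
  let ?c1 = "\<lambda>X. Lam [a 0, h 0] (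
      [a 1, h 1] \<Leftarrow> X\<langle>[a 0, h 0]\<rangle>;
      Ret [a 1, h 1])"
  let ?c2 = "\<lambda>X. Lam [a 0, h 0] (
      [h 1, h 2] \<Leftarrow> delH\<langle>[h 0]\<rangle>;
      [a 1] \<Leftarrow> X\<langle>[h 1]\<rangle>;
      [a 2] \<Leftarrow> muA\<langle>[a 0, a 1]\<rangle>;
      Ret [a 2, h 2])"
  have "Mul \<circ>\<^sub>d (Nu \<otimes>\<^sub>d idAH) \<approx> ?c1 (Mul \<circ>\<^sub>d (Nu \<otimes>\<^sub>d idAH))"
    by (rule coherence) code_simp
  also have "\<dots> = sem (?c1 ((muA \<otimes>\<^sub>d idH) \<circ>\<^sub>d (idA \<otimes>\<^sub>d ((SigL \<otimes>\<^sub>d idH) \<circ>\<^sub>d delH))))"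
    by (intro Nu_Mul program_congs)
  also have "\<dots> = sem (?c2 SigL)"
    by (rule coherence) code_simp
  also have "\<dots> = sem (?c2 U1)"
    by (intro normal program_congs)
  also have "\<dots> = sem ((muA \<otimes>\<^sub>d idH) \<circ>\<^sub>d (idA \<otimes>\<^sub>d ((U1 \<otimes>\<^sub>d idH) \<circ>\<^sub>d delH)))"
    by (rule coherence) code_simp
  finally show ?thesis .
qed

text \<open>If \<open>\<sigma>(-, 1) = u\<^sub>1\<close>, then \<open>\<nu> \<nu> = \<sigma>\<^sub>H\<^sup>A(1 \<otimes> 1) = u\<^sub>1(1\<^sub>1) \<otimes> 1\<^sub>2 = \<nu>\<close>.\<close>

lemma Nu_Nu_normal:
  assumes normal: "SigR \<approx> U1"
  shows "Mul \<circ>\<^sub>d (idAH \<otimes>\<^sub>d (Mul \<circ>\<^sub>d (Nu \<otimes>\<^sub>d Nu))) \<approx> Mul \<circ>\<^sub>d (idAH \<otimes>\<^sub>d Nu)"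
proof -
  let ?c1 = "\<lambda>X. Lam [a 0, h 0] (
      [a 1, h 1] \<Leftarrow> X\<langle>[]\<rangle>;
      [a 2, h 2] \<Leftarrow> Mul\<langle>[a 0, h 0, a 1, h 1]\<rangle>;
      Ret [a 2, h 2])"
  let ?c2 = "\<lambda>X. Lam [a 0, h 0] (
      [h 3] \<Leftarrow> etaH\<langle>[]\<rangle>;
      [a 1, h 1] \<Leftarrow> X\<langle>[h 3]\<rangle>;
      [a 2, h 2] \<Leftarrow> Mul\<langle>[a 0, h 0, a 1, h 1]\<rangle>;
      Ret [a 2, h 2])"
  let ?c3 = "\<lambda>X. Lam [a 0, h 0] (
      [h 3, h 1] \<Leftarrow> DelEta\<langle>[]\<rangle>;
      [a 1] \<Leftarrow> X\<langle>[h 3]\<rangle>;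
      [a 2, h 2] \<Leftarrow> Mul\<langle>[a 0, h 0, a 1, h 1]\<rangle>;
      Ret [a 2, h 2])"
  let ?c4 = "\<lambda>X. Lam [a 0, h 0] (
      [a 1, h 1] \<Leftarrow> X\<langle>[]\<rangle>;
      [a 2, h 2] \<Leftarrow> Mul\<langle>[a 0, h 0, a 1, h 1]\<rangle>;
      Ret [a 2, h 2])"
  have "Mul \<circ>\<^sub>d (idAH \<otimes>\<^sub>d (Mul \<circ>\<^sub>d (Nu \<otimes>\<^sub>d Nu))) \<approx> ?c1 (Mul \<circ>\<^sub>d (Nu \<otimes>\<^sub>d Nu))"
    by (rule coherence) code_simp
  also have "\<dots> = sem (?c1 (SigmaHA \<circ>\<^sub>d (etaH \<otimes>\<^sub>d etaH)))"
    by (intro Nu_Nu program_congs)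
  also have "\<dots> = sem (?c2 (SigmaHA \<circ>\<^sub>d (idH \<otimes>\<^sub>d etaH)))"
    by (rule coherence) code_simp
  also have "\<dots> = sem (?c2 ((SigR \<otimes>\<^sub>d idH) \<circ>\<^sub>d delH))"
    by (intro SigmaHA_unit_right program_congs)
  also have "\<dots> = sem (?c3 SigR)"
    by (rule coherence) code_simp
  also have "\<dots> = sem (?c3 U1)"
    by (intro normal program_congs)
  also have "\<dots> = sem (?c4 ((U1 \<otimes>\<^sub>d idH) \<circ>\<^sub>d DelEta))"
    by (rule coherence) code_simp
  also have "\<dots> = sem (?c4 Nu)"
    by (intro Nu_eq[symmetric] program_congs)
  also have "\<dots> = sem (Mul \<circ>\<^sub>d (idAH \<otimes>\<^sub>d Nu))"
    by (rule coherence) code_simp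
  finally show ?thesis .
qed

subsection \<open>Preunits and the normal condition\<close>

lemma ok_diagrams [simp]:
  "ok op_in op_out Mul" "tin op_in Mul = [SA, SH, SA, SH]" "tout op_out Mul = [SA, SH]"
  "ok op_in op_out Nu" "tin op_in Nu = []" "tout op_out Nu = [SA, SH]"
  "ok op_in op_out Psi" "tin op_in Psi = [SH, SA]" "tout op_out Psi = [SA, SH]"
  "ok op_in op_out SigmaHA" "tin op_in SigmaHA = [SH, SH]" "tout op_out SigmaHA = [SA, SH]"
  by code_simp+

lemma sem_Psi: "sem Psi = psi_HA C H \<delta>\<^sub>H A \<phi>"
  by (simp add: Psi_def psi_HA_def)

lemma sem_SigmaHA: "sem SigmaHA = sigma_HA C H \<mu>\<^sub>H \<delta>\<^sub>H \<sigma>"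
  by (simp add: SigmaHA_def delHH_def sigma_HA_def tensor_comult_def)

lemma sem_Mul: "sem Mul = crossed_mult C A H \<mu>\<^sub>A (sem Psi) (sem SigmaHA)"
  by (simp add: Mul_def crossed_mult_def)

lemma sem_Nu: "sem Nu = nabla C A H \<eta>\<^sub>A \<mu>\<^sub>A (sem Psi) \<cdot> (\<eta>\<^sub>A \<otimes> \<eta>\<^sub>H)"
  by (simp add: Nu_def nabla_def)

lemma sem_sections: "sem SigR = \<sigma> \<cdot> (\<I> H \<otimes> \<eta>\<^sub>H)" "sem SigL = \<sigma> \<cdot> (\<eta>\<^sub>H \<otimes> \<I> H)"
    "sem U1 = u1 C H \<eta>\<^sub>A \<phi>"
  by (simp_all add: SigR_def SigL_def U1_def u1_def)

lemma preunit_iff: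
  "is_preunit C (A \<odot> H) (sem Mul) (sem Nu) \<longleftrightarrow>
     Mul \<circ>\<^sub>d (idAH \<otimes>\<^sub>d Nu) \<approx> Mul \<circ>\<^sub>d (Nu \<otimes>\<^sub>d idAH) \<and>
     Mul \<circ>\<^sub>d (Nu \<otimes>\<^sub>d idAH) \<approx> Mul \<circ>\<^sub>d (idAH \<otimes>\<^sub>d (Mul \<circ>\<^sub>d (Nu \<otimes>\<^sub>d Nu)))"
  using sem_typing(1)[of Nu] by (simp add: is_preunit_def Hom_def)

lemma preunit_iff_normal:
  assumes "cocycle_condition C A H \<mu>\<^sub>A (sem Psi) (sem SigmaHA)"
  shows "is_preunit C (A \<odot> H) (sem Mul) (sem Nu) \<longleftrightarrow> SigL \<approx> SigR \<and> SigR \<approx> U1"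
proof
  have cocycle: "(muA \<otimes>\<^sub>d idH) \<circ>\<^sub>d (idA \<otimes>\<^sub>d SigmaHA) \<circ>\<^sub>d (SigmaHA \<otimes>\<^sub>d idH)
      \<approx> (muA \<otimes>\<^sub>d idH) \<circ>\<^sub>d (idA \<otimes>\<^sub>d SigmaHA) \<circ>\<^sub>d (Psi \<otimes>\<^sub>d idH) \<circ>\<^sub>d (idH \<otimes>\<^sub>d SigmaHA)"
    using assms by (simp add: cocycle_condition_def)
  assume "is_preunit C (A \<odot> H) (sem Mul) (sem Nu)"
  then have P1: "Mul \<circ>\<^sub>d (idAH \<otimes>\<^sub>d Nu) \<approx> Mul \<circ>\<^sub>d (Nu \<otimes>\<^sub>d idAH)"
    and P2: "Mul \<circ>\<^sub>d (Nu \<otimes>\<^sub>d idAH) \<approx> Mul \<circ>\<^sub>d (idAH \<otimes>\<^sub>d (Mul \<circ>\<^sub>d (Nu \<otimes>\<^sub>d Nu)))"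
    unfolding preunit_iff by blast+
  have "Extract ((muA \<otimes>\<^sub>d idH) \<circ>\<^sub>d (idA \<otimes>\<^sub>d ((SigL \<otimes>\<^sub>d idH) \<circ>\<^sub>d delH)))
      \<approx> Extract ((muA \<otimes>\<^sub>d idH) \<circ>\<^sub>d (idA \<otimes>\<^sub>d ((SigR \<otimes>\<^sub>d idH) \<circ>\<^sub>d delH)))"
    unfolding Extract_def using Mul_Nu Nu_Mul P1 by (intro program_congs) simp
  then have "SigL \<approx> SigR"
    using extract_SigL extract_SigR by simp
  moreover have "SigR \<approx> U1"
    using U1_eq_SigR[OF SigR_idempotent[OF P1 P2 cocycle]] by simp
  ultimately show "SigL \<approx> SigR \<and> SigR \<approx> U1" ..
next
  assume "SigL \<approx> SigR \<and> SigR \<approx> U1"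
  then have L: "SigL \<approx> U1" and R: "SigR \<approx> U1" by auto
  show "is_preunit C (A \<odot> H) (sem Mul) (sem Nu)"
    unfolding preunit_iff Nu_Nu_normal[OF R] Mul_Nu_normal[OF R] Nu_Mul_normal[OF L] by simp
qed

end

theorem corollary2p20:
  fixes C :: "('o, 'm) smcat" (structure)
    and H A :: 'o
    and \<eta>\<^sub>H \<mu>\<^sub>H \<epsilon>\<^sub>H \<delta>\<^sub>H \<eta>\<^sub>A \<mu>\<^sub>A \<phi>\<^sub>A \<sigma> \<psi> s \<nu> :: 'm
  assumes "strict_symmetric_monoidal_category C"
    and "has_equalizers C"
    and "weak_Hopf_algebra C H \<eta>\<^sub>H \<mu>\<^sub>H \<epsilon>\<^sub>H \<delta>\<^sub>H"
    and "cocommutative C H \<delta>\<^sub>H"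
    and "weak_left_module_algebra C H \<eta>\<^sub>H \<mu>\<^sub>H \<epsilon>\<^sub>H \<delta>\<^sub>H A \<eta>\<^sub>A \<mu>\<^sub>A \<phi>\<^sub>A"
    and "\<sigma> \<in> Reg2 C H \<mu>\<^sub>H \<delta>\<^sub>H A \<eta>\<^sub>A \<mu>\<^sub>A \<phi>\<^sub>A"
    and "\<psi> = psi_HA C H \<delta>\<^sub>H A \<phi>\<^sub>A"
    and "s = sigma_HA C H \<mu>\<^sub>H \<delta>\<^sub>H \<sigma>"
    and "twisted_condition C A H \<mu>\<^sub>A \<psi> s"
    and "cocycle_condition C A H \<mu>\<^sub>A \<psi> s"
    and "\<nu> = nabla C A H \<eta>\<^sub>A \<mu>\<^sub>A \<psi> \<cdot> (\<eta>\<^sub>A \<otimes> \<eta>\<^sub>H)"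
  shows "is_preunit C (A \<odot> H) (crossed_mult C A H \<mu>\<^sub>A \<psi> s) \<nu> \<longleftrightarrow>
    (\<sigma> \<cdot> (\<eta>\<^sub>H \<otimes> \<I> H) = \<sigma> \<cdot> (\<I> H \<otimes> \<eta>\<^sub>H) \<and>
     \<sigma> \<cdot> (\<I> H \<otimes> \<eta>\<^sub>H) = u1 C H \<eta>\<^sub>A \<phi>\<^sub>A)"
proof -
  interpret strict_symmetric_monoidal_category C by fact
  let ?conv = "convolution C (tensor_comult C H \<delta>\<^sub>H H \<delta>\<^sub>H) \<mu>\<^sub>A"
  obtain \<tau> where "\<sigma> \<in> Hom C (H \<odot> H) A" "\<tau> \<in> Hom C (H \<odot> H) A"
    "?conv \<sigma> \<tau> = u2 C \<mu>\<^sub>H \<eta>\<^sub>A \<phi>\<^sub>A" "?conv \<tau> \<sigma> = u2 C \<mu>\<^sub>H \<eta>\<^sub>A \<phi>\<^sub>A" "?conv (?conv \<sigma> \<tau>) \<sigma> = \<sigma>"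
    using assms(6) by (auto simp: Reg2_def Let_def)
  then interpret crossed_data C H A \<eta>\<^sub>H \<mu>\<^sub>H \<epsilon>\<^sub>H \<delta>\<^sub>H \<eta>\<^sub>A \<mu>\<^sub>A \<phi>\<^sub>A \<sigma> \<tau>
    using assms(3,5) by unfold_locales
  have \<psi>: "\<psi> = sem Psi" and s: "s = sem SigmaHA"
    using assms(7,8) by (simp_all add: sem_Psi sem_SigmaHA)
  have "crossed_mult C A H \<mu>\<^sub>A \<psi> s = sem Mul" and "\<nu> = sem Nu"
    using assms(11) \<psi> s by (simp_all add: sem_Mul sem_Nu)
  moreover have "cocycle_condition C A H \<mu>\<^sub>A (sem Psi) (sem SigmaHA)"
    using assms(10) \<psi> s by simp
  ultimately show ?thesis
    using preunit_iff_normal by (simp add: sem_sections)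
qed

end
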